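(* Suppose that $\phi^0:\Omega\to\mathbb{R}$ satisfies $\phi^0>0$ on $\Omega^+(0)$, $\phi^0<0$ on $\Omega^-(0)$, $\{x\in\Omega\mid\phi^0(x)=0\}=\Sigma(0)$ and $\nabla\phi^0\neq0$ on $\Sigma(0)$, and that $\phi^0$ is $C^2$-smooth with $|\nabla\phi^0|\equiv1$ in a neighborhood of $\Sigma(0)$. Then there exist a ($t$-global) tubular neighborhood $\Theta$ of $\{\Sigma(t)\}_{t\ge0}$ and a $C^2$-function $\phi:\Theta\to\mathbb{R}$ solving $$\frac{\partial\phi}{\partial t}(t,x)+v\big(t,\,x-\phi(t,x)\nabla\phi(t,x)\big)\cdot\nabla\phi(t,x)=0\ \text{ in }\Theta|_{t>0},\qquad \phi=\phi^0\ \text{ on }\Theta|_{t=0}.$$ Furthermore, $\phi$ satisfies $|\nabla\phi|\equiv1$ in $\Theta$, and for each $t\ge0$, $\phi(t,\cdot)>0$ in $\Theta\cap\Omega^+(t)$ and $\phi(t,\cdot)<0$ in $\Theta\cap\Omega^-(t)$.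
   Context: Setting. $\Omega\subset\mathbb{R}^3$ is a bounded connected open set and $v=v(t,x):[0,\infty)\times\bar\Omega\to\mathbb{R}^3$ is a given function satisfying: (H1) $v\in C^0([0,\infty)\times\bar\Omega;\mathbb{R}^3)\cap C^1([0,\infty)\times\Omega;\mathbb{R}^3)$; $v$ is Lipschitz continuous in $x$ on $[0,\infty)\times\bar\Omega$; $v$ is twice partially differentiable in $x$; all of these partial derivatives of $v$ belong to $C^0([0,\infty)\times\Omega;\mathbb{R}^3)$. (H2) $\pm v(s,x)\in T_{\partial\Omega}(x)$ for all $(s,x)\in[0,\infty)\times\partial\Omega$, where $T_{\partial\Omega}(x):=\{z\in\mathbb{R}^3\mid\liminf_{h\to0+}\mathrm{dist}(x+hz,\partial\Omega)/h=0\}$. No regularity of $\partial\Omega$ is assumed. $X(s,\tau,\xi)$ denotes the flow of $x'(s)=v(s,x(s))$, i.e. $s\mapsto X(s,\tau,\xi)$ is the unique solution with $x(\tau)=\xi$; by (H1), (H2), $\Omega$ and $\partial\Omega$ are forward and backward flow invariant for times in $[0,\infty)$. $\Omega^+(0)\subset\Omega$ is a subdomain such that $\Sigma(0):=\partial\Omega^+(0)$ is a closed $C^2$-smooth surface with $\Sigma(0)\cap\partial\Omega=\emptyset$, and $\Omega^-(0):=\Omega\setminus(\Omega^+(0)\cup\Sigma(0))$. For $t\ge0$, $\Omega^\pm(t):=X(t,0,\Omega^\pm(0))$ and $\Sigma(t):=X(t,0,\Sigma(0))$ (the moving interface). For $\varepsilon>0$, $\Sigma_\varepsilon(t):=\bigcup_{x\in\Sigma(t)}\{y\in\mathbb{R}^3\mid|x-y|<\varepsilon\}$.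 A set $\Theta\subset[0,\infty)\times\Omega$ is a ($t$-global) tubular neighborhood of $\{\Sigma(t)\}_{t\ge0}$ if $\Theta\supset\bigcup_{t\ge0}(\{t\}\times\Sigma(t))$, the set $\{x\in\Omega\mid(t,x)\in\Theta\}$ is open for each $t\ge0$, and there is a nonincreasing function $\varepsilon:[0,\infty)\to\mathbb{R}_{>0}$ with $\{t\}\times\Sigma_{\varepsilon(t)}(t)\subset\Theta$ for all $t\ge0$. $\Theta|_{t>0}$ and $\Theta|_{t=0}$ denote the parts of $\Theta$ with $t>0$ and $t=0$; "in $\Theta\cap\Omega^\pm(t)$" refers to points $x\in\Omega^\pm(t)$ with $(t,x)\in\Theta$. $\nabla$ is the gradient in $x$. Solving the PDE includes that the spatial argument at which $v$ is evaluated lies where $v$ is defined. *)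

theory Defs
  imports "HOL-Analysis.Analysis"
begin

text \<open>
  Continuous differentiability on a set \<open>S\<close> uses Frechet derivatives within \<open>S\<close>. It is only applied
  to open sets and to relatively open subsets of \<open>[0, \<infinity>) \<times> \<Omega>\<close> with \<open>\<Omega>\<close> open; there the derivative
  within \<open>S\<close> is unique, and at \<open>t = 0\<close> it is one-sided in time.
\<close>

definition C1_on :: "'a::euclidean_space set \<Rightarrow> ('a \<Rightarrow> 'b::real_normed_vector) \<Rightarrow> bool" where
  "C1_on S f \<longleftrightarrow>
     (\<exists>f' :: 'a \<Rightarrow> 'a \<Rightarrow>\<^sub>L 'b.
        (\<forall>p\<in>S. (f has_derivative blinfun_apply (f' p)) (at p within S)) \<and>
        continuous_on S f')"

definition C2_on :: "'a::euclidean_space set \<Rightarrow> ('a \<Rightarrow> 'b::real_normed_vector) \<Rightarrow> bool" where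
  "C2_on S f \<longleftrightarrow>
     (\<exists>f' :: 'a \<Rightarrow> 'a \<Rightarrow>\<^sub>L 'b.
        (\<forall>p\<in>S. (f has_derivative blinfun_apply (f' p)) (at p within S)) \<and>
        C1_on S f')"

text \<open>
  A tubular neighbourhood has open time slices but need not be relatively open in space-time, so
  being \<open>C\<^sup>2\<close> on a subset \<open>\<Theta>\<close> of \<open>D\<close> is taken in the usual sense for arbitrary subsets: \<open>C\<^sup>2\<close> on a
  relatively open neighbourhood of \<open>\<Theta>\<close> in \<open>D\<close>.
\<close>

definition C2_on_subset ::
  "'a::euclidean_space set \<Rightarrow> 'a set \<Rightarrow> ('a \<Rightarrow> 'b::real_normed_vector) \<Rightarrow> bool" where
  "C2_on_subset D \<Theta> f \<longleftrightarrow> (\<exists>W. openin (top_of_set D) W \<and> \<Theta> \<subseteq> W \<and> C2_on W f)"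

definition grad :: "('a::real_inner \<Rightarrow> real) \<Rightarrow> 'a \<Rightarrow> 'a" where
  "grad f x = (THE D. GDERIV f x :> D)"

definition partially_differentiable ::
  "'n::finite \<Rightarrow> (real ^ 'n \<Rightarrow> 'b::real_normed_vector) \<Rightarrow> real ^ 'n \<Rightarrow> bool" where
  "partially_differentiable i f x \<longleftrightarrow> (\<lambda>h. f (x + h *\<^sub>R axis i 1)) differentiable (at 0)"

definition partial_deriv ::
  "'n::finite \<Rightarrow> (real ^ 'n \<Rightarrow> 'b::real_normed_vector) \<Rightarrow> real ^ 'n \<Rightarrow> 'b" where
  "partial_deriv i f x = vector_derivative (\<lambda>h. f (x + h *\<^sub>R axis i 1)) (at 0)"

text \<open>
  Throughout, only the values of \<open>v\<close> on \<open>[0, \<infinity>) \<times> closure \<Omega>\<close> matter. The Lipschitz constant in \<open>x\<close>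
  is uniform in time.
\<close>

definition velocity_regular ::
  "(real ^ 3) set \<Rightarrow> (real \<Rightarrow> real ^ 3 \<Rightarrow> real ^ 3) \<Rightarrow> bool" where
  "velocity_regular \<Omega> v \<longleftrightarrow>
     continuous_on ({0..} \<times> closure \<Omega>) (\<lambda>(t, x). v t x) \<and>
     C1_on ({0..} \<times> \<Omega>) (\<lambda>(t, x). v t x) \<and>
     (\<exists>L. \<forall>t\<ge>0. L-lipschitz_on (closure \<Omega>) (v t)) \<and>
     (\<forall>i. (\<forall>t\<ge>0. \<forall>x\<in>\<Omega>. partially_differentiable i (v t) x) \<and>
          continuous_on ({0..} \<times> \<Omega>) (\<lambda>(t, x). partial_deriv i (v t) x)) \<and>
     (\<forall>i j. (\<forall>t\<ge>0. \<forall>x\<in>\<Omega>. partially_differentiable j (partial_deriv i (v t)) x) \<and>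
          continuous_on ({0..} \<times> \<Omega>) (\<lambda>(t, x). partial_deriv j (partial_deriv i (v t)) x))"

definition tangent_cone :: "'a::euclidean_space set \<Rightarrow> 'a \<Rightarrow> 'a set" where
  "tangent_cone K x =
     {z. Liminf (at_right 0) (\<lambda>h. ereal (infdist (x + h *\<^sub>R z) K / h)) = 0}"

definition velocity_tangential ::
  "(real ^ 3) set \<Rightarrow> (real \<Rightarrow> real ^ 3 \<Rightarrow> real ^ 3) \<Rightarrow> bool" where
  "velocity_tangential \<Omega> v \<longleftrightarrow>
     (\<forall>s\<ge>0. \<forall>x\<in>frontier \<Omega>.
        v s x \<in> tangent_cone (frontier \<Omega>) x \<and> - v s x \<in> tangent_cone (frontier \<Omega>) x)"

definition solution_curve ::
  "(real ^ 3) set \<Rightarrow> (real \<Rightarrow> real ^ 3 \<Rightarrow> real ^ 3) \<Rightarrow> (real \<Rightarrow> real ^ 3) \<Rightarrow> bool" where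
  "solution_curve \<Omega> v x \<longleftrightarrow>
     (\<forall>s\<ge>0. x s \<in> closure \<Omega> \<and> (x has_vector_derivative v s (x s)) (at s within {0..}))"

text \<open>
  The flow \<open>X(s, \<tau>, \<xi>)\<close>, for \<open>s, \<tau> \<ge> 0\<close> and \<open>\<xi> \<in> closure \<Omega>\<close>. The description ranges over the value at
  time \<open>s\<close>, since solution curves are only determined on \<open>[0, \<infinity>)\<close>.
\<close>

definition flow ::
  "(real ^ 3) set \<Rightarrow> (real \<Rightarrow> real ^ 3 \<Rightarrow> real ^ 3) \<Rightarrow> real \<Rightarrow> real \<Rightarrow> real ^ 3 \<Rightarrow> real ^ 3" where
  "flow \<Omega> v s \<tau> \<xi> = (THE y. \<exists>x. solution_curve \<Omega> v x \<and> x \<tau> = \<xi> \<and> x s = y)"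

definition transported ::
  "(real ^ 3) set \<Rightarrow> (real \<Rightarrow> real ^ 3 \<Rightarrow> real ^ 3) \<Rightarrow> (real ^ 3) set \<Rightarrow> real \<Rightarrow> (real ^ 3) set" where
  "transported \<Omega> v A t = flow \<Omega> v t 0 ` A"

text \<open>Closed surface means compact without boundary; it is not required to be connected.\<close>

definition closed_C2_surface :: "(real ^ 3) set \<Rightarrow> bool" where
  "closed_C2_surface S \<longleftrightarrow>
     compact S \<and>
     (\<forall>p\<in>S. \<exists>U (g :: real ^ 3 \<Rightarrow> real). open U \<and> p \<in> U \<and> C2_on U g \<and>
        (\<forall>x\<in>U. grad g x \<noteq> 0) \<and> S \<inter> U = {x \<in> U. g x = 0})"

definition tubular_neighborhood ::
  "(real ^ 3) set \<Rightarrow> (real \<Rightarrow> (real ^ 3) set) \<Rightarrow> (real \<times> (real ^ 3)) set \<Rightarrow> bool" where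
  "tubular_neighborhood \<Omega> \<Sigma> \<Theta> \<longleftrightarrow>
     \<Theta> \<subseteq> {0..} \<times> \<Omega> \<and>
     (\<Union>t\<in>{0..}. {t} \<times> \<Sigma> t) \<subseteq> \<Theta> \<and>
     (\<forall>t\<ge>0. open {x \<in> \<Omega>. (t, x) \<in> \<Theta>}) \<and>
     (\<exists>\<epsilon> :: real \<Rightarrow> real. (\<forall>t\<ge>0. \<epsilon> t > 0) \<and> antimono_on {0..} \<epsilon> \<and>
        (\<forall>t\<ge>0. {t} \<times> (\<Union>x\<in>\<Sigma> t. ball x (\<epsilon> t)) \<subseteq> \<Theta>))"

end

theory Submission
  imports Defs
begin

text \<open>
  Let \<open>X\<close> be the flow and \<open>n = \<nabla>\<phi>\<^sup>0\<close>, a unit field near \<open>\<Sigma>(0)\<close>. The function sought is the signed distance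
  to \<open>\<Sigma>(t)\<close>, but it is built without any geometry of \<open>\<Sigma>(t)\<close>. Put \<open>y(z) = z - \<phi>\<^sup>0(z) n(z)\<close>, transport
  \<open>n(z)\<close> by \<open>P' = - (D v(t, X))\<^sup>T P\<close> along the trajectory of \<open>y(z)\<close>, and let \<open>N = P / |P|\<close> and
  \<open>G(t, z) = X(t, y(z)) + \<phi>\<^sup>0(z) N(t, z)\<close>, so that \<open>G(0, z) = z\<close>. Define \<open>\<phi>\<close> by \<open>\<phi>(t, G(t, z)) = \<phi>\<^sup>0(z)\<close>.

  Since \<open>n \<bullet> D y = 0\<close> and \<open>P \<bullet> D X\<close> is conserved, \<open>N \<bullet> D G (dt, dz) = dt N \<bullet> v(t, X) + n \<bullet> dz\<close>. This
  says \<open>\<nabla>\<phi> = N\<close> and \<open>\<partial>\<phi>/\<partial>t = - N \<bullet> v(t, X)\<close> at \<open>x = G(t, z)\<close>, where \<open>X(t, y(z)) = x - \<phi> \<nabla>\<phi>\<close>: the equation, the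
  unit gradient and \<open>\<phi> \<in> C\<^sup>2\<close> follow once \<open>G\<close> is \<open>C\<^sup>1\<close> with a \<open>C\<^sup>1\<close> inverse. Only \<open>C\<^sup>1\<close> dependence of
  \<open>(X, P)\<close> on the initial data is needed, because the right-hand side of that system is \<open>C\<^sup>1\<close> in the
  state when \<open>v(t, \<cdot>)\<close> is \<open>C\<^sup>2\<close>. On \<open>\<Sigma>(0)\<close> the map \<open>G(t, \<cdot>)\<close> is the flow and \<open>D G\<close> is injective, so \<open>G\<close>
  is injective on a space-time neighbourhood of \<open>[0, \<infinity>) \<times> \<Sigma>(0)\<close> whose image is \<open>\<Theta>\<close>. For the signs,
  pull the path \<open>s \<mapsto> G(s, z)\<close> back by the flow: the result starts at \<open>z\<close> and never meets \<open>\<Sigma>(0)\<close>.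
\<close>

section \<open>Gronwall estimates and existence of solutions\<close>

text \<open>Two boundaries shape the proof. \<open>v\<close> lives only on
  \<open>closure \<Omega>\<close>, whose frontier is arbitrary: solutions are taken for a Lipschitz
  extension of \<open>v\<close> to the whole space, and the tangency condition keeps them in
  \<open>\<Omega>\<close>. At \<open>t = 0\<close> the time domain ends, whereas invariance of
  domain and the inverse function theorem ask for open sets: \<open>G\<close> is therefore continued
  to negative times.

  Since \<open>[0, \<infinity>) \<times> \<Sigma>(0)\<close> is not compact, a single compactness
  argument cannot make \<open>G\<close> injective near it. Each slab \<open>[0, n]\<close> has its
  own radius; decreasing radii glue the slabs and lead to the nonincreasing
  \<open>\<epsilon>\<close>. The resulting set of labels is closed under decreasing time, so the
  path used for the signs stays inside it.

  The foot point \<open>y(z)\<close> is transported, and not \<open>z\<close>, because the equation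
  evaluates \<open>v\<close> at \<open>x - \<phi> \<nabla>\<phi>\<close>; the distance from the foot
  along the normal is frozen. Differentiating \<open>|n| = 1\<close> yields
  \<open>n \<bullet> D n = 0\<close>, which makes \<open>n \<bullet> D y\<close> vanish. Joint
  differentiability of \<open>v\<close> in \<open>(t, x)\<close> enters through
  \<open>\<partial>\<phi>/\<partial>t\<close>, which contains \<open>v\<close> itself.\<close>

lemma gronwall_square:
  fixes e :: "real \<Rightarrow> 'a::real_inner"
  assumes "a \<le> b"
    and der: "\<And>s. s \<in> {a..b} \<Longrightarrow> (e has_vector_derivative e' s) (at s within {a..b})"
    and bnd: "\<And>s. s \<in> {a..b} \<Longrightarrow> norm (e' s) \<le> A * norm (e s) + B"
    and "0 \<le> A"
  shows "(norm (e b))\<^sup>2 \<le> ((norm (e a))\<^sup>2 + B\<^sup>2 * (b - a)) * exp ((2 * A + 1) * (b - a))"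
    and "(norm (e a))\<^sup>2 \<le> ((norm (e b))\<^sup>2 + B\<^sup>2 * (b - a)) * exp ((2 * A + 1) * (b - a))"
proof -
  \<comment> \<open>The squared norm stays differentiable where \<open>e\<close> vanishes. The
    summand 1 pays for
    \<open>2 * B * norm (e s) \<le> (norm (e s))\<^sup>2 + B\<^sup>2\<close>.\<close>
  define c where "c = 2 * A + 1"
  have "0 \<le> c" using \<open>0 \<le> A\<close> by (simp add: c_def)
  define q where "q = (\<lambda>s. (norm (e s))\<^sup>2)"
  define q' where "q' = (\<lambda>s. 2 * (e s \<bullet> e' s))"
  have q': "\<bar>q' s\<bar> \<le> c * q s + B\<^sup>2" if "s \<in> {a..b}" for s
  proof -
    have "\<bar>q' s\<bar> \<le> 2 * (norm (e s) * norm (e' s))"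
      unfolding q'_def using Cauchy_Schwarz_ineq2[of "e s" "e' s"] by (simp add: abs_mult)
    also have "\<dots> \<le> 2 * (norm (e s) * (A * norm (e s) + B))"
      using bnd[OF that] by (intro mult_left_mono) auto
    also have "\<dots> \<le> c * q s + B\<^sup>2"
      using zero_le_power2[of "norm (e s) - B"]
      by (simp add: c_def q_def algebra_simps power2_eq_square)
    finally show ?thesis .
  qed
  have dq: "(q has_real_derivative q' s) (at s within {a..b})" if "s \<in> {a..b}" for s
  proof -
    have "((\<lambda>s. e s \<bullet> e s) has_vector_derivative (e s \<bullet> e' s + e' s \<bullet> e s)) (at s within {a..b})"
      by (rule bounded_bilinear.has_vector_derivative[OF bounded_bilinear_inner]) (auto intro: der that)
    then show ?thesis
      unfolding q_def q'_def power2_norm_eq_inner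
      by (simp add: has_real_derivative_iff_has_vector_derivative inner_commute)
  qed
  have mono: "k a \<le> k b" if dk: "\<And>s. s \<in> {a..b} \<Longrightarrow> (k has_real_derivative k' s) (at s within {a..b})"
    and pos: "\<And>s. s \<in> {a..b} \<Longrightarrow> 0 \<le> k' s" for k k' :: "real \<Rightarrow> real"
  proof (rule DERIV_nonneg_imp_increasing_open[OF \<open>a \<le> b\<close>])
    show "\<exists>y. (k has_real_derivative y) (at x) \<and> 0 \<le> y" if "a < x" "x < b" for x
      using dk[of x] pos[of x] that by (auto simp: at_within_Icc_at)
    show "continuous_on {a..b} k"
      by (meson DERIV_continuous continuous_on_eq_continuous_within dk)
  qed
  \<comment> \<open>After multiplication by a decaying integrating factor, \<open>q\<close> minus
    the accumulated source \<open>B\<^sup>2 * (s - a)\<close> is nonincreasing; the outer minus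
    signs fit it to \<open>mono\<close>.\<close>
  have "- (q a * exp (c * (a - a)) - B\<^sup>2 * (a - a)) \<le> - (q b * exp (c * (a - b)) - B\<^sup>2 * (b - a))"
  proof (rule mono)
    fix s assume s: "s \<in> {a..b}"
    show "((\<lambda>s. - (q s * exp (c * (a - s)) - B\<^sup>2 * (s - a))) has_real_derivative
        - ((q' s - c * q s) * exp (c * (a - s)) - B\<^sup>2)) (at s within {a..b})"
      by (auto intro!: derivative_eq_intros dq[OF s] simp: algebra_simps)
    have "c * (a - s) \<le> 0" using s \<open>0 \<le> c\<close> by (auto simp: mult_nonneg_nonpos)
    have "(q' s - c * q s) * exp (c * (a - s)) \<le> B\<^sup>2"
    proof -
      have "(q' s - c * q s) * exp (c * (a - s)) \<le> B\<^sup>2 * exp (c * (a - s))"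
        using q'[OF s] by (intro mult_right_mono) auto
      also have "\<dots> \<le> B\<^sup>2 * 1" using \<open>c * (a - s) \<le> 0\<close> by (intro mult_left_mono) auto
      finally show ?thesis by simp
    qed
    then show "0 \<le> - ((q' s - c * q s) * exp (c * (a - s)) - B\<^sup>2)" by simp
  qed
  then have *: "q b * exp (c * (a - b)) \<le> q a + B\<^sup>2 * (b - a)" by simp
  have "q b = q b * exp (c * (a - b)) * exp (c * (b - a))"
    by (simp add: mult.assoc flip: exp_add) (simp add: algebra_simps)
  also have "\<dots> \<le> (q a + B\<^sup>2 * (b - a)) * exp (c * (b - a))"
    using * by (intro mult_right_mono) auto
  finally
show "(norm (e b))\<^sup>2 \<le> ((norm (e a))\<^sup>2 + B\<^sup>2 * (b - a)) * exp ((2 * A + 1) * (b - a))"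
    by (simp add: q_def c_def)
  \<comment> \<open>The lower bound on \<open>q'\<close> with a growing factor gives the estimate
    backwards in time.\<close>
  have "q a * exp (c * (a - b)) + B\<^sup>2 * (a - b) \<le> q b * exp (c * (b - b)) + B\<^sup>2 * (b - b)"
  proof (rule mono)
    fix s assume s: "s \<in> {a..b}"
    show "((\<lambda>s. q s * exp (c * (s - b)) + B\<^sup>2 * (s - b)) has_real_derivative
        (q' s + c * q s) * exp (c * (s - b)) + B\<^sup>2) (at s within {a..b})"
      by (auto intro!: derivative_eq_intros dq[OF s] simp: algebra_simps)
    have "c * (s - b) \<le> 0" using s \<open>0 \<le> c\<close> by (auto simp: mult_nonneg_nonpos)
    have "(- (B\<^sup>2)) * 1 \<le> - (B\<^sup>2) * exp (c * (s - b))"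
      using \<open>c * (s - b) \<le> 0\<close> by (intro mult_left_mono_neg) auto
    also have "\<dots> \<le> (q' s + c * q s) * exp (c * (s - b))"
      using q'[OF s] by (intro mult_right_mono) auto
    finally show "0 \<le> (q' s + c * q s) * exp (c * (s - b)) + B\<^sup>2" by simp
  qed
  then have *: "q a * exp (c * (a - b)) \<le> q b + B\<^sup>2 * (b - a)" by (simp add: algebra_simps)
  have "q a = q a * exp (c * (a - b)) * exp (c * (b - a))"
    by (simp add: mult.assoc flip: exp_add) (simp add: algebra_simps)
  also have "\<dots> \<le> (q b + B\<^sup>2 * (b - a)) * exp (c * (b - a))"
    using * by (intro mult_right_mono) auto
  finally
  show "(norm (e a))\<^sup>2 \<le> ((norm (e b))\<^sup>2 + B\<^sup>2 * (b - a)) * exp ((2 * A + 1) * (b - a))"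
    by (simp add: q_def c_def)
qed

text \<open>Square root of the previous estimate without source, with \<open>L + 1/2\<close> rounded
  up to \<open>L + 1\<close>. The backward half later yields injectivity of the flow and keeps
  transported conormals from vanishing.\<close>

lemma gronwall_lipschitz:
  fixes x y :: "real \<Rightarrow> 'a::real_inner"
  assumes "a \<le> b" "0 \<le> L"
    and dx: "\<And>s. s \<in> {a..b} \<Longrightarrow> (x has_vector_derivative x' s) (at s within {a..b})"
    and dy: "\<And>s. s \<in> {a..b} \<Longrightarrow> (y has_vector_derivative y' s) (at s within {a..b})"
    and lip: "\<And>s. s \<in> {a..b} \<Longrightarrow> norm (x' s - y' s) \<le> L * norm (x s - y s)"
  shows "norm (x b - y b) \<le> exp ((L + 1) * (b - a)) * norm (x a - y a)"
    and "norm (x a - y a) \<le> exp ((L + 1) * (b - a)) * norm (x b - y b)"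
proof -
  have le: "p \<le> exp ((L + 1) * (b - a)) * r"
    if "0 \<le> r" "p\<^sup>2 \<le> (r\<^sup>2 + 0\<^sup>2 * (b - a)) * exp ((2 * L + 1) * (b - a))" for p r :: real
  proof (rule power2_le_imp_le)
    have "p\<^sup>2 \<le> r\<^sup>2 * exp ((2 * L + 1) * (b - a))" using that by simp
    also have "\<dots> \<le> r\<^sup>2 * exp (2 * ((L + 1) * (b - a)))"
      using \<open>a \<le> b\<close> by (intro mult_left_mono) (auto simp: algebra_simps)
    also have "\<dots> = (exp ((L + 1) * (b - a)) * r)\<^sup>2"
      by (simp add: power_mult_distrib exp_double)
    finally show "p\<^sup>2 \<le> (exp ((L + 1) * (b - a)) * r)\<^sup>2" .
  qed (use that in auto)
  have d: "((\<lambda>s. x s - y s) has_vector_derivative (x' s - y' s)) (at s within {a..b})"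
    if "s \<in> {a..b}" for s
    using dx[OF that] dy[OF that] by (rule has_vector_derivative_diff)
  note g = gronwall_square[OF \<open>a \<le> b\<close> d, where A = L and B = 0]
  show "norm (x b - y b) \<le> exp ((L + 1) * (b - a)) * norm (x a - y a)"
    by (intro le g(1)) (use lip \<open>0 \<le> L\<close> in auto)
  show "norm (x a - y a) \<le> exp ((L + 1) * (b - a)) * norm (x b - y b)"
    by (intro le g(2)) (use lip \<open>0 \<le> L\<close> in auto)
qed

text \<open>Picard iteration on the whole half-line. The Lipschitz constant may grow with the
  horizon \<open>T\<close>, as it does for linear equations whose coefficients are taken along a
  trajectory.\<close>

lemma picard_existence:
  fixes f :: "real \<Rightarrow> 'a::euclidean_space \<Rightarrow> 'a"
  assumes contf: "continuous_on ({0..} \<times> UNIV) (\<lambda>(t, x). f t x)"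
    and lip: "\<And>T. \<exists>L. \<forall>t\<in>{0..T}. L-lipschitz_on UNIV (f t)"
  obtains x where "x 0 = \<xi>"
    "\<And>t. 0 \<le> t \<Longrightarrow> (x has_vector_derivative f t (x t)) (at t within {0..})"
proof -
  have lipK: "\<exists>K>0. \<forall>t\<in>{0..T}. \<forall>y z. norm (f t y - f t z) \<le> K * norm (y - z)" for T
  proof -
    obtain L where L: "\<And>t. t \<in> {0..T} \<Longrightarrow> L-lipschitz_on UNIV (f t)" using lip by blast
    have "norm (f t y - f t z) \<le> (\<bar>L\<bar> + 1) * norm (y - z)" if "t \<in> {0..T}" for t y z
    proof -
      have "norm (f t y - f t z) \<le> L * norm (y - z)"
        using lipschitz_onD[OF L[OF that], of y z] by (simp add: dist_norm)
      also have "\<dots> \<le> (\<bar>L\<bar> + 1) * norm (y - z)" by (intro mult_right_mono) auto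
      finally show ?thesis .
    qed
    then show ?thesis by (intro exI[of _ "\<bar>L\<bar> + 1"]) auto
  qed
  have cf: "continuous_on {0..T} (\<lambda>s. f s (y s))" if "continuous_on {0..T} y" for T y
  proof -
    have "continuous_on {0..T} (\<lambda>s. (\<lambda>(t, x). f t x) (s, y s))"
      by (rule continuous_on_compose2[OF contf]) (use that in \<open>auto intro: continuous_on_Pair continuous_on_id\<close>)
    then show ?thesis by simp
  qed
  define u where "u = rec_nat (\<lambda>t::real. \<xi>) (\<lambda>n y t. \<xi> + integral {0..t} (\<lambda>s. f s (y s)))"
  have u0: "u 0 = (\<lambda>t. \<xi>)" and uS: "u (Suc n) = (\<lambda>t. \<xi> + integral {0..t} (\<lambda>s. f s (u n s)))" for n
    by (simp_all add: u_def)
  have cu: "continuous_on {0..T} (u n)" for n T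
  proof (induction n)
    case (Suc n)
    have "(\<lambda>s. f s (u n s)) integrable_on {0..T}"
      by (intro integrable_continuous_real cf Suc)
    then show ?case unfolding uS by (intro continuous_intros indefinite_integral_continuous_1)
  qed (simp add: u0)
  \<comment> \<open>Bielecki weight: integrating \<open>K * exp (2 * K * s)\<close> gives half the
    weight back, so successive differences halve on all of \<open>{0..T}\<close>, however long the
    interval.\<close>
  have step: "\<exists>C K. 0 \<le> C \<and> 0 < K \<and> (\<forall>n. \<forall>t\<in>{0..T}. norm (u (Suc n) t - u n t) \<le> C * (1/2)^n * exp (2 * K * t))"
    if "0 \<le> T" for T
  proof -
    obtain K where "0 < K" and K: "\<And>t y z. t \<in> {0..T} \<Longrightarrow> norm (f t y - f t z) \<le> K * norm (y - z)"
      using lipK by blast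
    have "bounded ((\<lambda>s. f s \<xi>) ` {0..T})"
      by (intro compact_imp_bounded compact_continuous_image cf continuous_on_const compact_Icc)
    then obtain M where M: "0 < M" "\<And>s. s \<in> {0..T} \<Longrightarrow> norm (f s \<xi>) \<le> M"
      unfolding bounded_pos by blast
    define C where "C = M * T"
    have "norm (u (Suc n) t - u n t) \<le> C * (1/2)^n * exp (2 * K * t)" if "t \<in> {0..T}" for n t
      using that
    proof (induction n arbitrary: t)
      case 0
      have "norm (integral {0..t} (\<lambda>s. f s \<xi>)) \<le> M * (t - 0)"
        by (rule integral_bound) (use 0 M in \<open>auto intro!: cf\<close>)
      also have "\<dots> \<le> C" using 0 M(1) by (auto simp: C_def)
      also have "\<dots> = C * 1" by simp
      also have "\<dots> \<le> C * exp (2 * K * t)"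
        using 0 M(1) \<open>0 < K\<close> by (intro mult_left_mono) (auto simp: C_def)
      finally show ?case by (simp add: u0 uS)
    next
      case (Suc n)
      define D where "D = C * (1/2)^n"
      have "0 \<le> D" using M(1) \<open>0 \<le> T\<close> by (simp add: D_def C_def)
      have i: "(\<lambda>s. f s (u n s)) integrable_on {0..t}" for n
        by (intro integrable_continuous_real cf cu)
      have I: "((\<lambda>s. K * (D * exp (2 * K * s))) has_integral (D / 2 * exp (2 * K * t) - D / 2 * exp (2 * K * 0))) {0..t}"
        using Suc \<open>0 < K\<close>
        by (intro fundamental_theorem_of_calculus)
          (auto intro!: derivative_eq_intros simp flip: has_real_derivative_iff_has_vector_derivative)
      have "u (Suc (Suc n)) t - u (Suc n) t = integral {0..t} (\<lambda>s. f s (u (Suc n) s) - f s (u n s))"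
        unfolding uS[of "Suc n"] by (subst uS) (simp add: integral_diff i)
      also have "norm \<dots> \<le> D / 2 * exp (2 * K * t) - D / 2 * exp (2 * K * 0)"
        unfolding integral_unique[OF I, symmetric]
      proof (rule integral_norm_bound_integral)
        fix s assume s: "s \<in> {0..t}"
        have "norm (f s (u (Suc n) s) - f s (u n s)) \<le> K * norm (u (Suc n) s - u n s)"
          using s Suc.prems by (intro K) auto
        also have "\<dots> \<le> K * (D * exp (2 * K * s))"
          using Suc.IH[of s] Suc.prems s \<open>0 < K\<close> unfolding D_def by (intro mult_left_mono) auto
        finally show "norm (f s (u (Suc n) s) - f s (u n s)) \<le> K * (D * exp (2 * K * s))" .
      qed (use I in \<open>auto intro!: integrable_diff i\<close>)
      also have "\<dots> \<le> C * (1/2)^Suc n * exp (2 * K * t)"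
        using \<open>0 \<le> D\<close> by (simp add: D_def)
      finally show ?case .
    qed
    moreover have "0 \<le> C" using M(1) that by (simp add: C_def)
    ultimately show ?thesis using \<open>0 < K\<close> by blast
  qed
  \<comment> \<open>A telescoping series evaluated pointwise: one and the same limit function serves
    every horizon \<open>T\<close>.\<close>
  define x where "x = (\<lambda>t. (\<Sum>i. u (Suc i) t - u i t) + \<xi>)"
  have lim: "uniform_limit {0..T} u x sequentially" if "0 \<le> T" for T
  proof -
    obtain C K where C: "0 \<le> C" and "0 < K" and K: "\<And>n t. t \<in> {0..T} \<Longrightarrow> norm (u (Suc n) t - u n t) \<le> C * (1/2)^n * exp (2 * K * t)"
      using step[OF \<open>0 \<le> T\<close>] by metis
    have "uniform_limit {0..T} (\<lambda>n t. \<Sum>i<n. u (Suc i) t - u i t) (\<lambda>t. \<Sum>i. u (Suc i) t - u i t) sequentially"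
    proof (rule Weierstrass_m_test)
      fix n t assume t: "t \<in> {0..T}"
      have "norm (u (Suc n) t - u n t) \<le> C * (1/2)^n * exp (2 * K * t)" by (rule K[OF t])
      also have "\<dots> \<le> C * (1/2)^n * exp (2 * K * T)"
        using t C \<open>0 < K\<close> by (intro mult_left_mono) auto
      finally show "norm (u (Suc n) t - u n t) \<le> C * (1/2)^n * exp (2 * K * T)" .
    qed (intro summable_mult summable_mult2 summable_geometric, simp)
    then have "uniform_limit {0..T} (\<lambda>n t. (\<Sum>i<n. u (Suc i) t - u i t) + \<xi>) x sequentially"
      unfolding x_def by (intro uniform_limit_intros)
    moreover have "(\<Sum>i<n. u (Suc i) t - u i t) + \<xi> = u n t" for n t
      using sum_lessThan_telescope[of "\<lambda>i. u i t" n] by (simp add: u0)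
    ultimately show ?thesis by simp
  qed
  have cx: "continuous_on {0..T} x" if "0 \<le> T" for T
    by (rule uniform_limit_theorem[OF _ lim[OF that]]) (auto intro: always_eventually cu)
  have eq: "x t = \<xi> + integral {0..t} (\<lambda>s. f s (x s))" if "0 \<le> t" for t
  proof -
    obtain K where "0 < K" and K: "\<And>s y z. s \<in> {0..t} \<Longrightarrow> norm (f s y - f s z) \<le> K * norm (y - z)"
      using lipK by blast
    have ul: "uniform_limit {0..t} (\<lambda>n s. f s (u n s)) (\<lambda>s. f s (x s)) sequentially"
      unfolding uniform_limit_iff
    proof safe
      fix e :: real assume "0 < e"
      then have "\<forall>\<^sub>F n in sequentially. \<forall>s\<in>{0..t}. dist (u n s) (x s) < e / K"
        using lim[OF that] \<open>0 < K\<close> by (auto simp: uniform_limit_iff)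
      then show "\<forall>\<^sub>F n in sequentially. \<forall>s\<in>{0..t}. dist (f s (u n s)) (f s (x s)) < e"
      proof eventually_elim
        case (elim n)
        show ?case
        proof
          fix s assume s: "s \<in> {0..t}"
          have "dist (f s (u n s)) (f s (x s)) \<le> K * norm (u n s - x s)"
            using K[OF s] by (simp add: dist_norm)
          also have "\<dots> < e" using elim[rule_format, OF s] \<open>0 < K\<close> by (simp add: dist_norm field_simps)
          finally show "dist (f s (u n s)) (f s (x s)) < e" .
        qed
      qed
    qed
    obtain I J where IJ: "\<And>n. ((\<lambda>s. f s (u n s)) has_integral I n) {0..t}"
      "((\<lambda>s. f s (x s)) has_integral J) {0..t}" "I \<longlonglongrightarrow> J"
      by (rule uniform_limit_integral[OF ul]) (auto intro: cf cu)
    have "(\<lambda>n. u (Suc n) t) \<longlonglongrightarrow> \<xi> + J"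
      unfolding uS integral_unique[OF IJ(1)] by (intro tendsto_intros IJ)
    moreover have "(\<lambda>n. u (Suc n) t) \<longlonglongrightarrow> x t"
      by (rule LIMSEQ_Suc, rule tendsto_uniform_limitI[OF lim[OF that]]) (use that in simp)
    ultimately show ?thesis using LIMSEQ_unique integral_unique[OF IJ(2)] by metis
  qed
  show thesis
  proof (rule that[of x])
    show "x 0 = \<xi>" using eq[of 0] by simp
    fix t :: real assume t: "0 \<le> t"
    \<comment> \<open>The integral is differentiated on a compact interval; ending it at
      \<open>t + 1\<close> leaves the filter at \<open>t\<close> the same as for the
      half-line.\<close>
    have *: "((\<lambda>t. \<xi> + integral {0..t} (\<lambda>s. f s (x s))) has_vector_derivative 0 + f t (x t)) (at t within {0..t+1})"
      by (intro has_vector_derivative_add has_vector_derivative_const integral_has_vector_derivative cf cx)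
        (use t in auto)
    have "(x has_vector_derivative 0 + f t (x t)) (at t within {0..t+1})"
      by (rule has_vector_derivative_transform[OF _ _ *]) (use eq t in auto)
    moreover have "at t within {0..t+1} = at t within {0..}"
      by (rule at_within_nhd[of _ "{..<t+1}"]) auto
    ultimately show "(x has_vector_derivative f t (x t)) (at t within {0..})" by simp
  qed
qed

section \<open>Viability and Lipschitz extension\<close>

text \<open>An exponential barrier starts above \<open>d\<close>. At the last time when
  \<open>d\<close> is below it, \<open>step\<close> produces a later such time. \<open>step\<close>
  promises only some small \<open>h\<close>, not all, because a vanishing liminf supplies no
  more.\<close>

lemma dini_comparison:
  fixes d :: "real \<Rightarrow> real"
  assumes cont: "continuous_on {a..b} d" and "d a \<le> 0" "0 \<le> C"
    and step: "\<And>t \<eta> c. \<lbrakk>a \<le> t; t < b; 0 < \<eta>; 0 < c\<rbrakk> \<Longrightarrow>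
      \<exists>h. 0 < h \<and> h < c \<and> d (t + h) \<le> d t + h * (C * d t + \<eta>)"
    and t: "t \<in> {a..b}"
  shows "d t \<le> 0"
proof (rule ccontr)
  assume "\<not> d t \<le> 0"
  define E where "E = exp ((C + 1) * (t - a))"
  \<comment> \<open>This makes the barrier equal to \<open>d t / 2\<close> at time \<open>t\<close>,
    strictly below \<open>d t\<close>.\<close>
  define \<eta> where "\<eta> = d t / (2 * E)"
  have "0 < E" by (simp add: E_def)
  with \<open>\<not> d t \<le> 0\<close> have "0 < \<eta>" by (simp add: \<eta>_def)
  define w where "w = (\<lambda>s. \<eta> * exp ((C + 1) * (s - a)))"
  have "0 < w s" for s using \<open>0 < \<eta>\<close> by (simp add: w_def)
  have "w t = d t / 2" using \<open>0 < E\<close> by (simp add: w_def \<eta>_def flip: E_def)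
  with \<open>\<not> d t \<le> 0\<close> have "w t < d t" by simp
  define S where "S = {a..t} \<inter> (\<lambda>s. d s - w s) -` {..0}"
  have "closed S"
    unfolding S_def w_def
    by (intro continuous_closed_preimage continuous_intros continuous_on_subset[OF cont])
      (use t in auto)
  moreover have "bounded S" unfolding S_def by (meson bounded_Int bounded_closed_interval)
  ultimately have "compact S" by (simp add: compact_eq_bounded_closed)
  moreover have "a \<in> S" using t \<open>d a \<le> 0\<close> \<open>0 < w a\<close> by (auto simp: S_def)
  ultimately obtain s where s: "s \<in> S" "\<And>r. r \<in> S \<Longrightarrow> r \<le> s"
    using compact_attains_sup[of S] by auto
  from s(1) have "a \<le> s" "s \<le> t" "d s \<le> w s" by (auto simp: S_def)
  with \<open>w t < d t\<close> have "s < t" by (cases "s = t") auto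
  \<comment> \<open>The slack is chosen as the barrier value \<open>w s\<close> itself; the extra 1
    in the exponent \<open>C + 1\<close> absorbs it.\<close>
  obtain h where h: "0 < h" "h < t - s" "d (s + h) \<le> d s + h * (C * d s + w s)"
    using step[of s "w s" "t - s"] \<open>a \<le> s\<close> \<open>s < t\<close> t \<open>0 < w s\<close> by auto
  have "d (s + h) \<le> w s + h * (C * w s + w s)"
    using h \<open>d s \<le> w s\<close> \<open>0 \<le> C\<close>
    by (intro order.trans[OF h(3)] add_mono mult_left_mono) auto
  also have "\<dots> = w s * (1 + (C + 1) * h)" by (simp add: algebra_simps)
  also have "\<dots> \<le> w s * exp ((C + 1) * h)"
    using \<open>0 < w s\<close> by (intro mult_left_mono exp_ge_add_one_self) auto
  also have "\<dots> = w (s + h)" by (simp add: w_def mult.assoc algebra_simps flip: exp_add)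
  finally have "s + h \<in> S" using h \<open>a \<le> s\<close> by (auto simp: S_def)
  with s(2) h(1) show False by fastforce
qed

text \<open>Nagumo's viability theorem: the distance to \<open>K\<close> satisfies a Dini differential inequality,
  seen by comparing with the motion of a nearest point.\<close>
lemma tangent_cone_viability:
  fixes K :: "'a::euclidean_space set"
  assumes "closed K" "x a \<in> K" "0 \<le> L"
    and dx: "\<And>s. s \<in> {a..b} \<Longrightarrow> (x has_vector_derivative f s (x s)) (at s within {a..b})"
    and lip: "\<And>s y. \<lbrakk>s \<in> {a..b}; y \<in> K\<rbrakk> \<Longrightarrow> norm (f s (x s) - f s y) \<le> L * norm (x s - y)"
    and tan: "\<And>s y. \<lbrakk>s \<in> {a..b}; y \<in> K\<rbrakk> \<Longrightarrow> f s y \<in> tangent_cone K y"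
    and t: "t \<in> {a..b}"
  shows "x t \<in> K"
proof -
  have "K \<noteq> {}" using assms(2) by auto
  have "infdist (x t) K \<le> 0"
  proof (rule dini_comparison[where d = "\<lambda>t. infdist (x t) K" and C = L and a = a and b = b])
    have "continuous_on {a..b} x"
      using dx by (meson continuous_on_eq_continuous_within has_vector_derivative_continuous)
    then show "continuous_on {a..b} (\<lambda>t. infdist (x t) K)" by (intro continuous_on_infdist)
    show "infdist (x a) K \<le> 0" using assms(2) by simp
    fix s \<eta> c :: real assume s: "a \<le> s" "s < b" and "0 < \<eta>" "0 < c"
    obtain y where y: "y \<in> K" "infdist (x s) K = dist (x s) y"
      using infdist_attains_inf[OF \<open>closed K\<close> \<open>K \<noteq> {}\<close>] by blast
    let ?q = "\<lambda>h. ereal (infdist (y + h *\<^sub>R f s y) K / h)"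
    \<comment> \<open>A zero liminf makes the quotient small frequently, not eventually. Half of
      \<open>\<eta>\<close> is spent here, the other half on the remainder in the derivative of
      \<open>x\<close>.\<close>
    have fr: "\<exists>\<^sub>F h in at_right 0. ?q h < ereal (\<eta> / 2)"
    proof (rule ccontr)
      assume "\<not> ?thesis"
      then have "\<forall>\<^sub>F h in at_right 0. ereal (\<eta> / 2) \<le> ?q h"
        by (simp add: not_frequently not_less)
      then have "ereal (\<eta> / 2) \<le> Liminf (at_right 0) ?q" by (rule Liminf_bounded)
      also have "\<dots> = 0" using tan[of s y] s y(1) by (simp add: tangent_cone_def)
      finally show False using \<open>0 < \<eta>\<close> by simp
    qed
    obtain \<delta> where "0 < \<delta>" and \<delta>: "\<And>r. \<lbrakk>r \<in> {a..b}; norm (r - s) < \<delta>\<rbrakk> \<Longrightarrow>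
        norm (x r - x s - (r - s) *\<^sub>R f s (x s)) \<le> \<eta> / 2 * norm (r - s)"
      using dx[of s] s \<open>0 < \<eta>\<close>
      unfolding has_vector_derivative_def has_derivative_within_alt
      by (metis atLeastAtMost_iff half_gt_zero less_eq_real_def)
    have "\<forall>\<^sub>F h in at_right 0. h \<in> {0<..<min c (min \<delta> (b - s))}"
      using \<open>0 < c\<close> \<open>0 < \<delta>\<close> s by (intro eventually_at_right_real) auto
    with fr have "\<exists>\<^sub>F h in at_right 0. ?q h < ereal (\<eta> / 2) \<and> h \<in> {0<..<min c (min \<delta> (b - s))}"
      by (rule frequently_eventually_frequently)
    then obtain h where "?q h < ereal (\<eta> / 2)" and h: "0 < h" "h < c" "h < \<delta>" "h < b - s"
      using frequently_ex by fastforce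
    then have q: "infdist (y + h *\<^sub>R f s y) K < h * (\<eta> / 2)" by (simp add: field_simps)
    have "infdist (x (s + h)) K \<le> infdist (y + h *\<^sub>R f s y) K + dist (x (s + h)) (y + h *\<^sub>R f s y)"
      by (rule infdist_triangle)
    \<comment> \<open>The nearest point \<open>y\<close> is moved with its own velocity. The three
      summands are the derivative remainder, the present distance and the difference of
      velocities.\<close>
    also have "dist (x (s + h)) (y + h *\<^sub>R f s y) =
        norm ((x (s + h) - x s - h *\<^sub>R f s (x s)) + (x s - y) + h *\<^sub>R (f s (x s) - f s y))"
      by (simp add: dist_norm algebra_simps)
    also have "\<dots> \<le> norm (x (s + h) - x s - h *\<^sub>R f s (x s)) + norm (x s - y) + norm (h *\<^sub>R (f s (x s) - f s y))"
      by (intro norm_triangle_le add_mono) auto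
    also have "\<dots> \<le> \<eta> / 2 * h + dist (x s) y + h * (L * dist (x s) y)"
    proof (intro add_mono)
      show "norm (x (s + h) - x s - h *\<^sub>R f s (x s)) \<le> \<eta> / 2 * h"
        using \<delta>[of "s + h"] h s by auto
      show "norm (h *\<^sub>R (f s (x s) - f s y)) \<le> h * (L * dist (x s) y)"
        using lip[of s y] s h y(1) by (simp add: dist_norm)
    qed (simp add: dist_norm)
    finally have "infdist (x (s + h)) K \<le> infdist (x s) K + h * (L * infdist (x s) K + \<eta>)"
      using q unfolding y(2) by (simp add: algebra_simps)
    with h show "\<exists>h>0. h < c \<and> infdist (x (s + h)) K \<le> infdist (x s) K + h * (L * infdist (x s) K + \<eta>)"
      by blast
  qed (use \<open>0 \<le> L\<close> t in auto)
  then have "infdist (x t) K = 0" using infdist_nonneg[of "x t" K] by linarith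
  then show ?thesis using in_closed_iff_infdist_zero[OF \<open>closed K\<close> \<open>K \<noteq> {}\<close>] by simp
qed

text \<open>McShane's formula at each time, with an unchanged constant. Compactness of
  \<open>C\<close> makes the infima finite and the dependence of \<open>u\<close> on time uniform
  over \<open>C\<close>, hence the extension jointly continuous.\<close>

lemma mcshane_extension_real:
  fixes u :: "real \<Rightarrow> 'a::metric_space \<Rightarrow> real"
  assumes C: "compact C" "C \<noteq> {}"
    and cont: "continuous_on ({0..} \<times> C) (\<lambda>(t, x). u t x)"
    and lip: "\<And>t. 0 \<le> t \<Longrightarrow> L-lipschitz_on C (u t)"
  obtains w where "continuous_on ({0..} \<times> UNIV) (\<lambda>(t, x). w t x)"
    "\<And>t. 0 \<le> t \<Longrightarrow> L-lipschitz_on UNIV (w t)"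
    "\<And>t x. \<lbrakk>0 \<le> t; x \<in> C\<rbrakk> \<Longrightarrow> w t x = u t x"
proof -
  define w where "w = (\<lambda>t x. INF y\<in>C. u t y + L * dist x y)"
  have "0 \<le> L" using lip[of 0] by (simp add: lipschitz_on_def)
  have bdd: "bdd_below ((\<lambda>y. u t y + L * dist x y) ` C)" if "0 \<le> t" for t x
  proof -
    have "continuous_on C (\<lambda>y. (\<lambda>(t, x). u t x) (t, y))"
      by (rule continuous_on_compose2[OF cont]) (use that in \<open>auto intro!: continuous_intros\<close>)
    then have "compact ((\<lambda>y. u t y + L * dist x y) ` C)"
      by (intro compact_continuous_image continuous_intros C) simp
    then show ?thesis by (meson bounded_imp_bdd_below compact_imp_bounded)
  qed
  \<comment> \<open>Infima inherit a pointwise bound with a constant offset \<open>r\<close>; the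
    Lipschitz estimate and the joint continuity both reduce to a choice of \<open>r\<close>.\<close>
  have le: "w t x \<le> w s x' + r"
    if "0 \<le> t" and "\<And>y. y \<in> C \<Longrightarrow> u t y + L * dist x y \<le> u s y + L * dist x' y + r" for t s x x' r
  proof -
    have "w t x - r \<le> w s x'"
      unfolding w_def
    proof (rule cINF_greatest[OF \<open>C \<noteq> {}\<close>])
      fix y assume y: "y \<in> C"
      have "(INF y\<in>C. u t y + L * dist x y) \<le> u t y + L * dist x y"
        by (rule cINF_lower[OF bdd[OF \<open>0 \<le> t\<close>] y])
      with that(2)[OF y] show "(INF y\<in>C. u t y + L * dist x y) - r \<le> u s y + L * dist x' y" by linarith
    qed
    then show ?thesis by simp
  qed
  have tri: "L * dist x y \<le> L * dist x' y + L * dist x x'" for x x' y :: 'a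
    using mult_left_mono[OF dist_triangle[of x y x'] \<open>0 \<le> L\<close>] by (simp add: algebra_simps)
  show thesis
  proof (rule that[of w])
    show "L-lipschitz_on UNIV (w t)" if "0 \<le> t" for t
    proof (rule lipschitz_onI)
      fix x x' :: 'a
      have "w t x \<le> w t x' + L * dist x x'"
        by (rule le[OF that]) (use tri in \<open>simp add: add.assoc\<close>)
      moreover have "w t x' \<le> w t x + L * dist x x'"
        by (rule le[OF that]) (use tri[of x' _ x] in \<open>simp add: dist_commute[of x x']\<close>)
      ultimately show "dist (w t x) (w t x') \<le> L * dist x x'" by (simp add: dist_real_def abs_le_iff)
    qed (rule \<open>0 \<le> L\<close>)
    show "w t x = u t x" if t: "0 \<le> t" and x: "x \<in> C" for t x
    proof (rule antisym)
      show "w t x \<le> u t x" unfolding w_def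
        using cINF_lower[OF bdd[OF t] x, of x] by simp
      show "u t x \<le> w t x" unfolding w_def
      proof (rule cINF_greatest[OF \<open>C \<noteq> {}\<close>])
        fix y assume "y \<in> C"
        with lipschitz_onD[OF lip[OF t] x, of y] show "u t x \<le> u t y + L * dist x y"
          by (simp add: dist_real_def abs_le_iff)
      qed
    qed
    show "continuous_on ({0..} \<times> UNIV) (\<lambda>(t, x). w t x)"
      unfolding continuous_on_iff
    proof (clarsimp)
      fix t :: real and x and e :: real assume t: "0 \<le> t" and "0 < e"
      have "uniformly_continuous_on ({0..t + 1} \<times> C) (\<lambda>(t, x). u t x)"
        by (intro compact_uniformly_continuous continuous_on_subset[OF cont] compact_Times C) auto
      then obtain d where "0 < d" and d: "\<And>p q. \<lbrakk>p \<in> {0..t + 1} \<times> C; q \<in> {0..t + 1} \<times> C; dist q p < d\<rbrakk> \<Longrightarrow>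
          dist ((\<lambda>(t, x). u t x) q) ((\<lambda>(t, x). u t x) p) < e / 2"
        unfolding uniformly_continuous_on_def using \<open>0 < e\<close> half_gt_zero by metis
      \<comment> \<open>\<open>L + 1\<close> avoids dividing by zero when \<open>L = 0\<close>; the
        bound 1 keeps the other time inside \<open>{0..t + 1}\<close>.\<close>
      define d' where "d' = min (min d 1) (e / (2 * (L + 1)))"
      have "0 < d'" using \<open>0 < d\<close> \<open>0 < e\<close> \<open>0 \<le> L\<close> by (simp add: d'_def)
      moreover have "dist (w s x') (w t x) < e" if s: "0 \<le> s" and near: "dist (s, x') (t, x) < d'" for s x'
      proof -
        have ds: "dist s t < d" "dist s t < 1" using near dist_fst_le[of "(s, x')" "(t, x)"] by (auto simp: d'_def)
        have dx: "dist x' x < e / (2 * (L + 1))"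
          using near dist_snd_le[of "(s, x')" "(t, x)"] by (auto simp: d'_def)
        have "L * dist x' x \<le> (L + 1) * dist x' x" by (intro mult_right_mono) auto
        also have "\<dots> < e / 2" using dx \<open>0 \<le> L\<close> by (simp add: field_simps)
        finally have Lx: "L * dist x' x < e / 2" .
        have uy: "\<bar>u s y - u t y\<bar> < e / 2" if "y \<in> C" for y
          using d[of "(t, y)" "(s, y)"] that t s ds by (auto simp: dist_Pair_Pair dist_real_def)
        let ?r = "L * dist x' x"
        obtain \<rho> where \<rho>: "\<And>y. y \<in> C \<Longrightarrow> \<bar>u s y - u t y\<bar> \<le> \<rho>" "\<rho> + ?r < e"
          using uy Lx by (intro that[of "e/2"]) (auto intro: less_imp_le)
        have "w s x' \<le> w t x + (\<rho> + ?r)"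
          by (rule le[OF s]) (use tri[of x' _ x] \<rho>(1) in \<open>smt (verit)\<close>)
        moreover have "w t x \<le> w s x' + (\<rho> + ?r)"
          by (rule le[OF t]) (use tri[of x _ x'] \<rho>(1) in \<open>smt (verit) dist_commute\<close>)
        ultimately show ?thesis using \<rho>(2) by (simp add: dist_real_def)
      qed
      ultimately show "\<exists>d>0. \<forall>s\<in>{0..}. \<forall>x'. dist (s, x') (t, x) < d \<longrightarrow> dist (w s x') (w t x) < e"
        by auto
    qed
  qed
qed

text \<open>Componentwise extension. The constant worsens by the dimension, which is harmless: the
  flow only asks for one that does not depend on time.\<close>

lemma mcshane_extension:
  fixes u :: "real \<Rightarrow> 'a::metric_space \<Rightarrow> 'b::euclidean_space"
  assumes C: "compact C" "C \<noteq> {}"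
    and cont: "continuous_on ({0..} \<times> C) (\<lambda>(t, x). u t x)"
    and lip: "\<And>t. 0 \<le> t \<Longrightarrow> L-lipschitz_on C (u t)"
  obtains w M where "continuous_on ({0..} \<times> UNIV) (\<lambda>(t, x). w t x)"
    "\<And>t. 0 \<le> t \<Longrightarrow> M-lipschitz_on UNIV (w t)"
    "\<And>t x. \<lbrakk>0 \<le> t; x \<in> C\<rbrakk> \<Longrightarrow> w t x = u t x"
proof -
  have "\<exists>w. continuous_on ({0..} \<times> UNIV) (\<lambda>(t, x). w t x) \<and>
    (\<forall>t\<ge>0. L-lipschitz_on UNIV (w t)) \<and> (\<forall>t\<ge>0. \<forall>x\<in>C. w t x = u t x \<bullet> i)" if "i \<in> Basis" for i
  proof -
    have "continuous_on ({0..} \<times> C) (\<lambda>(t, x). u t x \<bullet> i)"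
      using continuous_on_inner[OF cont continuous_on_const, of i] by (simp add: case_prod_unfold)
    moreover have "L-lipschitz_on C (\<lambda>x. u t x \<bullet> i)" if "0 \<le> t" for t
    proof (rule lipschitz_onI)
      show "0 \<le> L" using lip[of 0] by (simp add: lipschitz_on_def)
      fix x y assume "x \<in> C" "y \<in> C"
      have "dist (u t x \<bullet> i) (u t y \<bullet> i) \<le> dist (u t x) (u t y)"
        using Basis_le_norm[OF \<open>i \<in> Basis\<close>, of "u t x - u t y"] by (simp add: dist_norm inner_diff_left)
      also have "\<dots> \<le> L * dist x y" by (rule lipschitz_onD[OF lip[OF that] \<open>x \<in> C\<close> \<open>y \<in> C\<close>])
      finally show "dist (u t x \<bullet> i) (u t y \<bullet> i) \<le> L * dist x y" .
    qed
    ultimately show ?thesis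
      using mcshane_extension_real[OF C, of "\<lambda>t x. u t x \<bullet> i" L] by metis
  qed
  then obtain e where e: "\<And>i. i \<in> Basis \<Longrightarrow> continuous_on ({0..} \<times> UNIV) (\<lambda>(t, x). e i t x)"
    "\<And>i t. \<lbrakk>i \<in> Basis; 0 \<le> t\<rbrakk> \<Longrightarrow> L-lipschitz_on UNIV (e i t)"
    "\<And>i t x. \<lbrakk>i \<in> Basis; 0 \<le> t; x \<in> C\<rbrakk> \<Longrightarrow> e i t x = u t x \<bullet> i"
    by metis
  define w where "w = (\<lambda>t x. \<Sum>i\<in>Basis. e i t x *\<^sub>R (i::'b))"
  show thesis
  proof (rule that[of w "DIM('b) * L"])
    show "continuous_on ({0..} \<times> UNIV) (\<lambda>(t, x). w t x)"
      unfolding w_def case_prod_unfold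
      by (intro continuous_intros) (use e(1) in \<open>simp add: case_prod_unfold\<close>)
    show "w t x = u t x" if "0 \<le> t" "x \<in> C" for t x
      unfolding w_def using e(3) that by (simp add: euclidean_representation)
    show "(DIM('b) * L)-lipschitz_on UNIV (w t)" if "0 \<le> t" for t
    proof (rule lipschitz_onI)
      show "0 \<le> DIM('b) * L" using lip[of 0] by (simp add: lipschitz_on_def)
      fix x y :: 'a
      have "dist (w t x) (w t y) = norm (\<Sum>i\<in>Basis. (e i t x - e i t y) *\<^sub>R (i::'b))"
        by (simp add: dist_norm w_def sum_subtractf scaleR_diff_left)
      also have "\<dots> \<le> (\<Sum>i\<in>(Basis::'b set). L * dist x y)"
        using lipschitz_onD[OF e(2)[OF _ that], of _ x y]
        by (intro sum_norm_le) (simp add: dist_real_def)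
      finally show "dist (w t x) (w t y) \<le> DIM('b) * L * dist x y" by simp
    qed
  qed
qed

section \<open>Continuous differentiability on sets\<close>

text \<open>The derivative is an explicit plain function, continuous direction by direction. In
  finite dimensions this amounts to continuity in operator norm, while derivatives can be written as
  formulas.\<close>

definition C1_deriv :: "'a::euclidean_space set \<Rightarrow> ('a \<Rightarrow> 'b::real_normed_vector) \<Rightarrow> ('a \<Rightarrow> 'a \<Rightarrow> 'b) \<Rightarrow> bool" where
  "C1_deriv S f D \<longleftrightarrow> (\<forall>p\<in>S. (f has_derivative D p) (at p within S)) \<and> (\<forall>w. continuous_on S (\<lambda>p. D p w))"

lemma C1_derivI:
  assumes "\<And>p. p \<in> S \<Longrightarrow> (f has_derivative D p) (at p within S)"
    and "\<And>w. continuous_on S (\<lambda>p. D p w)"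
  shows "C1_deriv S f D"
  using assms by (auto simp: C1_deriv_def)

lemma C1_derivD:
  assumes "C1_deriv S f D"
  shows "p \<in> S \<Longrightarrow> (f has_derivative D p) (at p within S)" "continuous_on S (\<lambda>p. D p w)"
    "p \<in> S \<Longrightarrow> bounded_linear (D p)" "continuous_on S f"
  using assms unfolding C1_deriv_def
  by (auto intro: has_derivative_bounded_linear has_derivative_continuous_on)

text \<open>On a finite-dimensional domain, operator norm continuity is decided by the finitely many
  basis vectors.\<close>

lemma continuous_on_Blinfun:
  fixes D :: "'p::t2_space \<Rightarrow> 'a::euclidean_space \<Rightarrow> 'b::real_normed_vector"
  assumes "\<And>p. p \<in> S \<Longrightarrow> bounded_linear (D p)" and "\<And>w. continuous_on S (\<lambda>p. D p w)"
  shows "continuous_on S (\<lambda>p. Blinfun (D p))"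
proof (rule continuous_on_blinfun_componentwise)
  fix i :: 'a
  have "continuous_on S (\<lambda>p. blinfun_apply (Blinfun (D p)) i) \<longleftrightarrow> continuous_on S (\<lambda>p. D p i)"
    by (rule continuous_on_cong) (auto simp: bounded_linear_Blinfun_apply assms)
  then show "continuous_on S (\<lambda>p. blinfun_apply (Blinfun (D p)) i)" using assms by simp
qed

lemma C1_on_iff_C1_deriv: "C1_on S f \<longleftrightarrow> (\<exists>D. C1_deriv S f D)"
proof
  assume "C1_on S f"
  then obtain f' where "\<forall>p\<in>S. (f has_derivative blinfun_apply (f' p)) (at p within S)" "continuous_on S f'"
    by (auto simp: C1_on_def)
  then have "C1_deriv S f (\<lambda>p. blinfun_apply (f' p))"
    by (auto simp: C1_deriv_def intro: continuous_intros)
  then show "\<exists>D. C1_deriv S f D" by blast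
next
  assume "\<exists>D. C1_deriv S f D"
  then obtain D where D: "C1_deriv S f D" ..
  show "C1_on S f" unfolding C1_on_def
    by (rule exI[of _ "\<lambda>p. Blinfun (D p)"])
      (auto simp: bounded_linear_Blinfun_apply C1_derivD[OF D] intro!: continuous_on_Blinfun)
qed

lemma C1_deriv_subset: "C1_deriv S f D \<Longrightarrow> T \<subseteq> S \<Longrightarrow> C1_deriv T f D"
  unfolding C1_deriv_def by (meson continuous_on_subset has_derivative_subset subsetD)

lemma C1_deriv_compose:
  assumes f: "C1_deriv S f D" and g: "C1_deriv T g E" and sub: "f ` S \<subseteq> T"
  shows "C1_deriv S (\<lambda>p. g (f p)) (\<lambda>p w. E (f p) (D p w))"
proof (rule C1_derivI)
  fix p assume p: "p \<in> S"
  show "((\<lambda>p. g (f p)) has_derivative (\<lambda>w. E (f p) (D p w))) (at p within S)"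
    by (rule has_derivative_in_compose2[OF C1_derivD(1)[OF g] sub p C1_derivD(1)[OF f p]])
next
  fix w
  \<comment> \<open>Operator and argument both vary with \<open>p\<close>, so continuity in each
    fixed direction does not suffice here; continuity in operator norm does.\<close>
  have "continuous_on S (\<lambda>p. blinfun_apply (Blinfun (E (f p))) (D p w))"
    by (intro continuous_intros C1_derivD[OF f]
        continuous_on_compose2[OF continuous_on_Blinfun[OF C1_derivD(3,2)[OF g]] C1_derivD(4)[OF f] sub])
  then show "continuous_on S (\<lambda>p. E (f p) (D p w))"
    by (rule continuous_on_eq) (use sub in \<open>auto simp: bounded_linear_Blinfun_apply C1_derivD(3)[OF g]\<close>)
qed

section \<open>Differentiable dependence on parameters\<close>

text \<open>Separate continuity becomes joint continuity once continuity in \<open>z\<close> is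
  uniform on compact time intervals, which is the form in which Gronwall estimates come.\<close>

lemma continuous_on_prod_of_uniform:
  fixes F :: "real \<Rightarrow> 'b::metric_space \<Rightarrow> 'c::metric_space"
  assumes t: "\<And>z. z \<in> U \<Longrightarrow> continuous_on {0..} (\<lambda>t. F t z)"
    and z: "\<And>z T e. \<lbrakk>z \<in> U; 0 \<le> T; 0 < e\<rbrakk> \<Longrightarrow>
      \<exists>d>0. \<forall>z'\<in>U. dist z' z < d \<longrightarrow> (\<forall>t\<in>{0..T}. dist (F t z') (F t z) \<le> e)"
  shows "continuous_on ({0..} \<times> U) (\<lambda>(t, z). F t z)"
  unfolding continuous_on_iff
proof (clarsimp)
  fix t :: real and z and e :: real assume "0 \<le> t" "z \<in> U" "0 < e"
  obtain d where "0 < d" and d: "\<And>z' s. \<lbrakk>z' \<in> U; dist z' z < d; s \<in> {0..t + 1}\<rbrakk> \<Longrightarrow> dist (F s z') (F s z) \<le> e / 2"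
    using z[OF \<open>z \<in> U\<close>, of "t + 1" "e / 2"] \<open>0 \<le> t\<close> \<open>0 < e\<close> by auto
  obtain d' where "0 < d'" and d': "\<And>s. \<lbrakk>0 \<le> s; dist s t < d'\<rbrakk> \<Longrightarrow> dist (F s z) (F t z) < e / 2"
    using t[OF \<open>z \<in> U\<close>] \<open>0 \<le> t\<close> \<open>0 < e\<close> unfolding continuous_on_iff by (metis atLeast_iff half_gt_zero)
  define r where "r = min d (min d' 1)"
  have "dist (F s z') (F t z) < e" if s: "0 \<le> s" "z' \<in> U" and near: "dist (s, z') (t, z) < r" for s z'
  proof -
    have "dist s t < r" using near dist_fst_le[of "(s, z')" "(t, z)"] by simp
    moreover have "dist z' z < r" using near dist_snd_le[of "(s, z')" "(t, z)"] by simp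
    ultimately have "dist (F s z') (F s z) \<le> e / 2" "dist (F s z) (F t z) < e / 2"
      using d[OF \<open>z' \<in> U\<close>, of s] d'[of s] s by (auto simp: r_def dist_real_def)
    then show ?thesis using dist_triangle[of "F s z'" "F t z" "F s z"] by linarith
  qed
  moreover have "0 < r" using \<open>0 < d\<close> \<open>0 < d'\<close> by (simp add: r_def)
  ultimately show "\<exists>d>0. \<forall>s\<in>{0..}. \<forall>z'\<in>U. dist (s, z') (t, z) < d \<longrightarrow> dist (F s z') (F t z) < e"
    by auto
qed

text \<open>\<open>Y\<close> is a given family of global solutions inside the open state set
  \<open>V\<close>; the parameter enters only through the initial value \<open>Y 0\<close>, with
  derivative \<open>E\<close>. In the application the state is the pair of flow and conormal, and
  the parameter is the label \<open>z\<close>.\<close>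

locale parametric_flow =
  fixes f :: "real \<Rightarrow> 'a::euclidean_space \<Rightarrow> 'a" and D :: "real \<Rightarrow> 'a \<Rightarrow> 'a \<Rightarrow> 'a"
    and V :: "'a set" and U :: "'b::euclidean_space set"
    and Y :: "real \<Rightarrow> 'b \<Rightarrow> 'a" and E :: "'b \<Rightarrow> 'b \<Rightarrow> 'a"
  assumes open_V: "open V" and open_U: "open U"
    and f_cont: "continuous_on ({0..} \<times> V) (\<lambda>(t, x). f t x)"
    and f_deriv: "\<And>t x. \<lbrakk>0 \<le> t; x \<in> V\<rbrakk> \<Longrightarrow> (f t has_derivative D t x) (at x)"
    and D_cont: "\<And>w. continuous_on ({0..} \<times> V) (\<lambda>(t, x). D t x w)"
    and Y_in: "\<And>t z. \<lbrakk>0 \<le> t; z \<in> U\<rbrakk> \<Longrightarrow> Y t z \<in> V"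
    and Y_deriv: "\<And>t z. \<lbrakk>0 \<le> t; z \<in> U\<rbrakk> \<Longrightarrow>
      ((\<lambda>t. Y t z) has_vector_derivative f t (Y t z)) (at t within {0..})"
    and Y_init: "C1_deriv U (Y 0) E"
begin

text \<open>Bundles \<open>D\<close> as an operator, which gives access to the operator norm and to
  uniform continuity on compact sets.\<close>

definition DB :: "real \<times> 'a \<Rightarrow> 'a \<Rightarrow>\<^sub>L 'a" where
  "DB p = Blinfun (D (fst p) (snd p))"

lemma DB_apply: "0 \<le> t \<Longrightarrow> x \<in> V \<Longrightarrow> blinfun_apply (DB (t, x)) = D t x"
  unfolding DB_def using has_derivative_bounded_linear[OF f_deriv]
  by (simp add: bounded_linear_Blinfun_apply)

lemma DB_cont: "continuous_on ({0..} \<times> V) DB"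
  unfolding DB_def
  by (intro continuous_on_Blinfun)
    (use D_cont has_derivative_bounded_linear[OF f_deriv] in \<open>auto simp: case_prod_unfold\<close>)

lemma Y_time_cont: "z \<in> U \<Longrightarrow> T \<subseteq> {0..} \<Longrightarrow> continuous_on T (\<lambda>t. Y t z)"
  by (rule continuous_on_subset[of "{0..}"])
    (simp_all add: continuous_on_eq_continuous_within has_vector_derivative_continuous[OF Y_deriv])

lemma Y_deriv_Icc: "\<lbrakk>z \<in> U; t \<in> {0..T}\<rbrakk> \<Longrightarrow>
    ((\<lambda>t. Y t z) has_vector_derivative f t (Y t z)) (at t within {0..T})"
  using Y_deriv[of t z] by (rule has_vector_derivative_within_subset) auto

lemma DB_along_bounded:
  assumes "z \<in> U"
  obtains A where "0 \<le> A" "\<And>t. t \<in> {0..T} \<Longrightarrow> norm (DB (t, Y t z)) \<le> A"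
proof -
  have "continuous_on {0..T} (\<lambda>t. DB (t, Y t z))"
    by (rule continuous_on_compose2[OF DB_cont])
      (use assms Y_in in \<open>auto intro!: continuous_on_Pair continuous_on_id Y_time_cont\<close>)
  then have "bounded ((\<lambda>t. DB (t, Y t z)) ` {0..T})"
    by (intro compact_imp_bounded compact_continuous_image compact_Icc)
  then obtain A where "0 < A" "\<And>t. t \<in> {0..T} \<Longrightarrow> norm (DB (t, Y t z)) \<le> A"
    unfolding bounded_pos by blast
  then show thesis by (intro that[of A]) auto
qed

text \<open>A compact piece of trajectory has a compact neighbourhood in \<open>V\<close>, and on it
  the derivative is uniformly continuous.\<close>

lemma tube:
  assumes "z \<in> U" "0 < e"
  obtains \<delta> where "0 < \<delta>"
    "\<And>t y. \<lbrakk>t \<in> {0..T}; norm (y - Y t z) \<le> \<delta>\<rbrakk> \<Longrightarrow> y \<in> V \<and> norm (DB (t, y) - DB (t, Y t z)) \<le> e"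
proof -
  define C where "C = (\<lambda>t. Y t z) ` {0..T}"
  have "compact C" unfolding C_def
    by (intro compact_continuous_image Y_time_cont assms) auto
  moreover have "C \<subseteq> V" using Y_in assms by (auto simp: C_def)
  ultimately obtain \<epsilon> where \<epsilon>: "0 < \<epsilon>" "(\<Union>x\<in>C. ball x \<epsilon>) \<subseteq> V"
    using compact_subset_open_imp_ball_epsilon_subset[OF _ open_V] by blast
  \<comment> \<open>Closed balls of half the radius keep the neighbourhood both compact and inside
    \<open>V\<close>.\<close>
  define C' where "C' = {x + y |x y. x \<in> C \<and> y \<in> cball 0 (\<epsilon> / 2)}"
  have "compact C'" unfolding C'_def by (intro compact_sums \<open>compact C\<close>) simp
  have "C' \<subseteq> V"
  proof
    fix a assume "a \<in> C'"
    then obtain x y where "a = x + y" "x \<in> C" "norm y \<le> \<epsilon> / 2" by (auto simp: C'_def)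
    then have "a \<in> ball x \<epsilon>" using \<epsilon>(1) by (simp add: dist_norm)
    then show "a \<in> V" using \<epsilon>(2) \<open>x \<in> C\<close> by blast
  qed
  have "uniformly_continuous_on ({0..T} \<times> C') DB"
    by (intro compact_uniformly_continuous continuous_on_subset[OF DB_cont] compact_Times \<open>compact C'\<close>)
      (use \<open>C' \<subseteq> V\<close> in auto)
  then obtain d where "0 < d" and d: "\<And>p q. \<lbrakk>p \<in> {0..T} \<times> C'; q \<in> {0..T} \<times> C'; dist q p < d\<rbrakk> \<Longrightarrow> dist (DB q) (DB p) < e"
    unfolding uniformly_continuous_on_def using \<open>0 < e\<close> by metis
  show thesis
  proof (rule that[of "min (\<epsilon> / 2) (d / 2)"])
    fix t y assume t: "t \<in> {0..T}" and y: "norm (y - Y t z) \<le> min (\<epsilon> / 2) (d / 2)"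
    have "Y t z \<in> C" using t by (auto simp: C_def)
    have "y = Y t z + (y - Y t z)" by simp
    then have "y \<in> C'" unfolding C'_def using y \<open>Y t z \<in> C\<close> by force
    moreover have "Y t z \<in> C'" unfolding C'_def using \<open>Y t z \<in> C\<close> \<epsilon>(1) by force
    moreover have "dist (t, y) (t, Y t z) < d" using y \<open>0 < d\<close> by (auto simp: dist_Pair_Pair dist_norm)
    ultimately show "y \<in> V \<and> norm (DB (t, y) - DB (t, Y t z)) \<le> e"
      using d[of "(t, Y t z)" "(t, y)"] t \<open>C' \<subseteq> V\<close> by (auto simp: dist_norm)
  qed (use \<epsilon> \<open>0 < d\<close> in auto)
qed

text \<open>Mean value inequality on a ball where the derivative deviates from its value at the
  centre by at most \<open>e\<close>.\<close>

lemma linearization: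
  assumes "0 \<le> t" and V: "\<And>y. norm (y - x) \<le> \<delta> \<Longrightarrow> y \<in> V \<and> norm (DB (t, y) - DB (t, x)) \<le> e"
    and y: "norm (y - x) \<le> \<delta>"
  shows "norm (f t y - f t x - D t x (y - x)) \<le> e * norm (y - x)"
proof -
  have "0 \<le> \<delta>" using y norm_ge_zero order_trans by blast
  have "norm (f t y - f t x - D t x (y - x)) \<le> norm (y - x) * e"
  proof (rule differentiable_bound_linearization[where S = "cball x \<delta>" and f' = "D t" and ?x0.0 = x])
    show "x + s *\<^sub>R (y - x) \<in> cball x \<delta>" if "s \<in> {0..1}" for s
      using that y mult_left_le_one_le[of "norm (y - x)" s] by (simp add: dist_norm)
    fix y' assume y': "y' \<in> cball x \<delta>"
    then have V': "y' \<in> V" "norm (DB (t, y') - DB (t, x)) \<le> e"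
      using V[of y'] by (auto simp: dist_norm norm_minus_commute)
    have "x \<in> V" using V[of x] \<open>0 \<le> \<delta>\<close> by simp
    show "(f t has_derivative D t y') (at y' within cball x \<delta>)"
      by (rule has_derivative_at_withinI[OF f_deriv[OF \<open>0 \<le> t\<close> V'(1)]])
    show "onorm (D t y' - D t x) \<le> e"
      using V' \<open>0 \<le> t\<close> \<open>x \<in> V\<close>
      by (simp add: norm_blinfun.rep_eq minus_blinfun.rep_eq DB_apply fun_diff_def)
  qed (use \<open>0 \<le> \<delta>\<close> in auto)
  then show ?thesis by (simp add: mult.commute)
qed

text \<open>The three estimates that later arguments need on all of \<open>{0..T}\<close>: growth of
  the deviation, oscillation of the derivative, linearization error. \<open>C\<close> is kept apart
  from \<open>e\<close> because it must not change when \<open>e\<close> shrinks.\<close>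

definition shadows :: "real \<Rightarrow> real \<Rightarrow> real \<Rightarrow> 'b \<Rightarrow> 'b \<Rightarrow> bool" where
  "shadows T C e z z' \<longleftrightarrow> (\<forall>t\<in>{0..T}. norm (Y t z' - Y t z) \<le> C * norm (Y 0 z' - Y 0 z) \<and>
      norm (DB (t, Y t z') - DB (t, Y t z)) \<le> e \<and>
      norm (f t (Y t z') - f t (Y t z) - D t (Y t z) (Y t z' - Y t z)) \<le> e * norm (Y t z' - Y t z))"

text \<open>A solution starting close to \<open>Y \<cdot> z\<close> cannot leave the tube, by Gronwall up to the first exit time.\<close>
lemma nearby:
  assumes z: "z \<in> U" and T: "0 \<le> T"
  obtains C where "0 \<le> C" "\<And>e. 0 < e \<Longrightarrow> \<exists>r>0. \<forall>z'\<in>U. norm (Y 0 z' - Y 0 z) < r \<longrightarrow> shadows T C e z z'"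
proof -
  obtain A where A: "0 \<le> A" "\<And>t. t \<in> {0..T} \<Longrightarrow> norm (DB (t, Y t z)) \<le> A"
    using DB_along_bounded[OF z] by blast
  \<comment> \<open>\<open>A + 1\<close> is the Lipschitz constant inside the tube, and Gronwall
    adds another 1.\<close>
  define C where "C = exp ((A + 2) * T)"
  have "0 < C" by (simp add: C_def)
  show thesis
  proof (rule that[of C])
    fix e :: real assume "0 < e"
    \<comment> \<open>Capping at 1 makes the Lipschitz constant in the tube, and thereby
      \<open>C\<close>, independent of \<open>e\<close>.\<close>
    have "0 < min e 1" using \<open>0 < e\<close> by simp
    from tube[OF z this, of T]
    obtain \<delta> where "0 < \<delta>" and \<delta>: "\<And>t y. \<lbrakk>t \<in> {0..T}; norm (y - Y t z) \<le> \<delta>\<rbrakk> \<Longrightarrow>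
        y \<in> V \<and> norm (DB (t, y) - DB (t, Y t z)) \<le> min e 1"
      by blast
    have lin: "norm (f t y - f t (Y t z) - D t (Y t z) (y - Y t z)) \<le> min e 1 * norm (y - Y t z)"
      if "t \<in> {0..T}" "norm (y - Y t z) \<le> \<delta>" for t y
      using that \<delta> by (intro linearization) auto
    have lip: "norm (f t y - f t (Y t z)) \<le> (A + 1) * norm (y - Y t z)"
      if t: "t \<in> {0..T}" and y: "norm (y - Y t z) \<le> \<delta>" for t y
    proof -
      have "norm (f t y - f t (Y t z)) \<le> norm (f t y - f t (Y t z) - D t (Y t z) (y - Y t z)) + norm (D t (Y t z) (y - Y t z))"
        using norm_triangle_sub[of "f t y - f t (Y t z)" "D t (Y t z) (y - Y t z)"] by simp
      also have "\<dots> \<le> min e 1 * norm (y - Y t z) + A * norm (y - Y t z)"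
      proof (rule add_mono[OF lin[OF t y]])
        have "norm (DB (t, Y t z) (y - Y t z)) \<le> norm (DB (t, Y t z)) * norm (y - Y t z)" by (rule norm_blinfun)
        also have "\<dots> \<le> A * norm (y - Y t z)" by (intro mult_right_mono A t) simp
        finally show "norm (D t (Y t z) (y - Y t z)) \<le> A * norm (y - Y t z)"
          using t z by (simp add: DB_apply Y_in)
      qed
      also have "\<dots> \<le> 1 * norm (y - Y t z) + A * norm (y - Y t z)"
        by (intro add_mono mult_right_mono) auto
      finally show ?thesis by (simp add: algebra_simps)
    qed
    have gr: "norm (Y \<tau> z' - Y \<tau> z) \<le> C * norm (Y 0 z' - Y 0 z)"
      if "z' \<in> U" "\<tau> \<in> {0..T}" and in_tube: "\<And>t. t \<in> {0..\<tau>} \<Longrightarrow> norm (Y t z' - Y t z) \<le> \<delta>" for z' \<tau>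
    proof -
      have "(A + 1 + 1) * (\<tau> - 0) \<le> (A + 2) * T"
        using that A by (intro mult_mono) auto
      have "norm (Y \<tau> z' - Y \<tau> z) \<le> exp ((A + 1 + 1) * (\<tau> - 0)) * norm (Y 0 z' - Y 0 z)"
        by (rule gronwall_lipschitz(1)[OF _ _ Y_deriv_Icc[OF that(1)] Y_deriv_Icc[OF z]])
          (use that A in \<open>auto intro!: lip\<close>)
      also have "\<dots> \<le> C * norm (Y 0 z' - Y 0 z)"
        using \<open>(A + 1 + 1) * (\<tau> - 0) \<le> (A + 2) * T\<close>
        unfolding C_def by (intro mult_right_mono) auto
      finally show ?thesis .
    qed
    have "norm (Y \<tau> z' - Y \<tau> z) < \<delta>" if z': "z' \<in> U" and small: "norm (Y 0 z' - Y 0 z) < \<delta> / C" and "\<tau> \<in> {0..T}" for z' \<tau>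
    proof (rule ccontr)
      assume far: "\<not> norm (Y \<tau> z' - Y \<tau> z) < \<delta>"
      define n where "n = (\<lambda>t. norm (Y t z' - Y t z))"
      have cn: "continuous_on {0..T} n" unfolding n_def
        by (intro continuous_intros Y_time_cont z z') auto
      define S where "S = {0..T} \<inter> n -` {\<delta>..}"
      have "closed S" unfolding S_def by (intro continuous_closed_preimage cn) auto
      moreover have "bounded S" unfolding S_def by (meson bounded_Int bounded_closed_interval)
      ultimately have "compact S" by (simp add: compact_eq_bounded_closed)
      moreover have "\<tau> \<in> S" using far that by (auto simp: S_def n_def)
      ultimately obtain \<sigma> where \<sigma>: "\<sigma> \<in> S" "\<And>t. t \<in> S \<Longrightarrow> \<sigma> \<le> t"
        using compact_attains_inf[of S] by auto
      then have \<sigma>T: "0 \<le> \<sigma>" "\<sigma> \<le> T" "\<delta> \<le> n \<sigma>" by (auto simp: S_def)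
      have "1 \<le> C" using A T by (simp add: C_def)
      then have "\<delta> / C \<le> \<delta>" using \<open>0 < \<delta>\<close> by (simp add: field_simps)
      then have "n 0 \<le> \<delta>" using small by (simp add: n_def)
      \<comment> \<open>By the intermediate value theorem the deviation at the first exit time is
        exactly \<open>\<delta>\<close>, so the tube estimates hold up to and including that time,
        where Gronwall contradicts them.\<close>
      obtain t where t: "0 \<le> t" "t \<le> \<sigma>" "n t = \<delta>"
        using IVT'[OF \<open>n 0 \<le> \<delta>\<close> \<sigma>T(3) \<sigma>T(1)] continuous_on_subset[OF cn, of "{0..\<sigma>}"] \<sigma>T by auto
      then have "t \<in> S" using \<sigma>T by (auto simp: S_def)
      with \<sigma>(2) t have "n \<sigma> = \<delta>" by force
      have "n s \<le> \<delta>" if "s \<in> {0..\<sigma>}" for s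
        using \<sigma>(2)[of s] that \<sigma>T \<open>n \<sigma> = \<delta>\<close> by (cases "s = \<sigma>") (force simp: S_def)+
      then have "n \<sigma> \<le> C * norm (Y 0 z' - Y 0 z)"
        unfolding n_def using \<sigma>T z' by (intro gr) auto
      also have "\<dots> < \<delta>" using small \<open>0 < C\<close> by (simp add: field_simps)
      finally show False using \<open>n \<sigma> = \<delta>\<close> by simp
    qed
    note stay = this
    show "\<exists>r>0. \<forall>z'\<in>U. norm (Y 0 z' - Y 0 z) < r \<longrightarrow> shadows T C e z z'"
      unfolding shadows_def
    proof (intro exI[of _ "\<delta> / C"] conjI ballI impI)
      show "0 < \<delta> / C" using \<open>0 < \<delta>\<close> \<open>0 < C\<close> by simp
      fix z' t assume z': "z' \<in> U" "norm (Y 0 z' - Y 0 z) < \<delta> / C" and t: "t \<in> {0..T}"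
      note st = stay[OF z', THEN less_imp_le]
      show "norm (Y t z' - Y t z) \<le> C * norm (Y 0 z' - Y 0 z)"
        using t by (intro gr z'(1) st) auto
      show "norm (DB (t, Y t z') - DB (t, Y t z)) \<le> e"
        using \<delta>[OF t st[OF t]] by simp
      have "norm (f t (Y t z') - f t (Y t z) - D t (Y t z) (Y t z' - Y t z)) \<le> min e 1 * norm (Y t z' - Y t z)"
        by (rule lin[OF t st[OF t]])
      also have "\<dots> \<le> e * norm (Y t z' - Y t z)" by (intro mult_right_mono) auto
      finally show "norm (f t (Y t z') - f t (Y t z) - D t (Y t z) (Y t z' - Y t z)) \<le> e * norm (Y t z' - Y t z)" .
    qed
  qed (use \<open>0 < C\<close> in simp)
qed

section \<open>The variational equation along a trajectory\<close>

lemma variation_exists: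
  obtains m where "\<And>z w. z \<in> U \<Longrightarrow> m 0 z w = E z w"
    "\<And>t z w. \<lbrakk>0 \<le> t; z \<in> U\<rbrakk> \<Longrightarrow>
      ((\<lambda>t. m t z w) has_vector_derivative D t (Y t z) (m t z w)) (at t within {0..})"
proof -
  have "\<exists>y. y 0 = E z w \<and> (\<forall>t\<ge>0. (y has_vector_derivative D t (Y t z) (y t)) (at t within {0..}))"
    if z: "z \<in> U" for z w
  proof -
    \<comment> \<open>The equation is linear with coefficients bounded on \<open>{0..T}\<close>,
      hence globally Lipschitz in the state there. It is solved separately for each pair
      \<open>z\<close>, \<open>w\<close>.\<close>
    have c: "continuous_on ({0..} \<times> UNIV) (\<lambda>(t, y). blinfun_apply (DB (t, Y t z)) y)"
      unfolding case_prod_unfold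
    proof (intro continuous_intros)
      show "continuous_on ({0..} \<times> UNIV) (\<lambda>x. DB (fst x, Y (fst x) z))"
      proof (rule continuous_on_compose2[OF DB_cont])
        show "continuous_on ({0..} \<times> UNIV) (\<lambda>x. (fst x, Y (fst x) z))"
          by (intro continuous_on_Pair continuous_on_fst continuous_on_id
              continuous_on_compose2[OF Y_time_cont[OF z order_refl]]) auto
      qed (use z Y_in in auto)
    qed
    have l: "\<exists>L. \<forall>t\<in>{0..T}. L-lipschitz_on UNIV (blinfun_apply (DB (t, Y t z)))" for T
    proof -
      obtain A where A: "0 \<le> A" "\<And>t. t \<in> {0..T} \<Longrightarrow> norm (DB (t, Y t z)) \<le> A"
        using DB_along_bounded[OF z] by blast
      have "A-lipschitz_on UNIV (blinfun_apply (DB (t, Y t z)))" if "t \<in> {0..T}" for t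
      proof (rule lipschitz_onI[OF _ A(1)])
        fix x y
        have "dist (DB (t, Y t z) x) (DB (t, Y t z) y) \<le> norm (DB (t, Y t z)) * norm (x - y)"
          by (simp add: dist_norm norm_blinfun flip: blinfun.diff_right)
        also have "\<dots> \<le> A * norm (x - y)" by (intro mult_right_mono A that) simp
        finally show "dist (DB (t, Y t z) x) (DB (t, Y t z) y) \<le> A * dist x y" by (simp add: dist_norm)
      qed
      then show ?thesis by blast
    qed
    obtain y where y: "y 0 = E z w"
      "\<And>t. 0 \<le> t \<Longrightarrow> (y has_vector_derivative blinfun_apply (DB (t, Y t z)) (y t)) (at t within {0..})"
      using picard_existence[OF c l, of "E z w"] by blast
    then show ?thesis
      using z by (intro exI[of _ y]) (simp add: DB_apply Y_in)
  qed
  then have "\<forall>z w. \<exists>y. z \<in> U \<longrightarrow> y 0 = E z w \<and>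
      (\<forall>t\<ge>0. (y has_vector_derivative D t (Y t z) (y t)) (at t within {0..}))"
    by blast
  then obtain m where m: "\<And>z w. z \<in> U \<Longrightarrow> m z w 0 = E z w \<and>
      (\<forall>t\<ge>0. (m z w has_vector_derivative D t (Y t z) (m z w t)) (at t within {0..}))"
    unfolding choice_iff by blast
  show thesis by (rule that[of "\<lambda>t z w. m z w t"]) (use m in auto)
qed

lemma D_bounded_linear: "\<lbrakk>0 \<le> t; z \<in> U\<rbrakk> \<Longrightarrow> bounded_linear (D t (Y t z))"
  using has_derivative_bounded_linear[OF f_deriv] Y_in by blast

lemma D_along_bounded:
  assumes "z \<in> U"
  obtains A where "0 \<le> A" "\<And>t y. t \<in> {0..T} \<Longrightarrow> norm (D t (Y t z) y) \<le> A * norm y"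
proof -
  obtain A where A: "0 \<le> A" "\<And>t. t \<in> {0..T} \<Longrightarrow> norm (DB (t, Y t z)) \<le> A"
    using DB_along_bounded[OF assms] by blast
  have "norm (D t (Y t z) y) \<le> A * norm y" if t: "t \<in> {0..T}" for t y
  proof -
    have "norm (DB (t, Y t z) y) \<le> norm (DB (t, Y t z)) * norm y" by (rule norm_blinfun)
    also have "\<dots> \<le> A * norm y" by (intro mult_right_mono A t) simp
    finally show ?thesis using t assms by (simp add: DB_apply Y_in)
  qed
  with A(1) show thesis using that by blast
qed

lemma linear_ode_unique:
  assumes z: "z \<in> U" and "0 \<le> t"
    and a: "\<And>s. s \<in> {0..t} \<Longrightarrow> (a has_vector_derivative D s (Y s z) (a s)) (at s within {0..t})"
    and b: "\<And>s. s \<in> {0..t} \<Longrightarrow> (b has_vector_derivative D s (Y s z) (b s)) (at s within {0..t})"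
    and "a 0 = b 0"
  shows "a t = b t"
proof -
  obtain A where A: "0 \<le> A" "\<And>s y. s \<in> {0..t} \<Longrightarrow> norm (D s (Y s z) y) \<le> A * norm y"
    using D_along_bounded[OF z] by blast
  have "norm (a t - b t) \<le> exp ((A + 1) * (t - 0)) * norm (a 0 - b 0)"
  proof (rule gronwall_lipschitz(1)[OF \<open>0 \<le> t\<close> A(1) a b])
    fix s assume s: "s \<in> {0..t}"
    then show "norm (D s (Y s z) (a s) - D s (Y s z) (b s)) \<le> A * norm (a s - b s)"
      using A(2)[OF s, of "a s - b s"] bounded_linear.linear[OF D_bounded_linear[OF _ z]]
      by (simp add: linear_diff)
  qed auto
  with \<open>a 0 = b 0\<close> show ?thesis by simp
qed

text \<open>Linearity in \<open>w\<close> is uniqueness: sums and multiples of solutions solve the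
  same linear equation with the matching initial values.\<close>

lemma variation_bounded_linear:
  assumes z: "z \<in> U" and "0 \<le> t"
    and m0: "\<And>w. m 0 w = E z w"
    and m: "\<And>t w. 0 \<le> t \<Longrightarrow> ((\<lambda>t. m t w) has_vector_derivative D t (Y t z) (m t w)) (at t within {0..})"
  shows "bounded_linear (m t)"
proof (rule bounded_linearI')
  have mI: "((\<lambda>t. m t w) has_vector_derivative D s (Y s z) (m s w)) (at s within {0..t})" if "s \<in> {0..t}" for s w
    by (rule has_vector_derivative_within_subset[OF m]) (use that in auto)
  have E: "linear (E z)" using C1_derivD(3)[OF Y_init z] by (rule bounded_linear.linear)
  have D: "linear (D s (Y s z))" if "s \<in> {0..t}" for s
    using D_bounded_linear[OF _ z] that by (simp add: bounded_linear.linear)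
  show "m t (v + w) = m t v + m t w" for v w
  proof (rule linear_ode_unique[OF z \<open>0 \<le> t\<close> mI])
    fix s assume s: "s \<in> {0..t}"
    show "((\<lambda>t. m t v + m t w) has_vector_derivative D s (Y s z) (m s v + m s w)) (at s within {0..t})"
      unfolding linear_add[OF D[OF s]] by (intro has_vector_derivative_add mI s)
  qed (auto simp: m0 linear_add[OF E])
  show "m t (c *\<^sub>R w) = c *\<^sub>R m t w" for c w
  proof (rule linear_ode_unique[OF z \<open>0 \<le> t\<close> mI])
    fix s assume s: "s \<in> {0..t}"
    show "((\<lambda>t. c *\<^sub>R m t w) has_vector_derivative D s (Y s z) (c *\<^sub>R m s w)) (at s within {0..t})"
      unfolding linear_scale[OF D[OF s]]
      by (rule bounded_linear.has_vector_derivative[OF bounded_linear_scaleR_right mI[OF s]])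
  qed (auto simp: m0 linear_scale[OF E])
qed

text \<open>The error \<open>Y t z' - Y t z - m t (z' - z)\<close> solves the linearized equation up
  to a source of order \<open>o(norm (z' - z))\<close>, and starts at that order too; Gronwall keeps
  it small.\<close>

lemma variation_is_derivative:
  assumes z: "z \<in> U" and t: "0 \<le> t"
    and m0: "\<And>w. m 0 w = E z w"
    and m: "\<And>t w. 0 \<le> t \<Longrightarrow> ((\<lambda>t. m t w) has_vector_derivative D t (Y t z) (m t w)) (at t within {0..})"
  shows "((\<lambda>z. Y t z) has_derivative m t) (at z)"
  unfolding has_derivative_at_alt
proof (intro conjI allI impI)
  show "bounded_linear (m t)" by (rule variation_bounded_linear[OF z t m0 m])
  have E: "bounded_linear (E z)" by (rule C1_derivD(3)[OF Y_init z])
  then obtain B where B: "0 < B" "\<And>w. norm (E z w) \<le> norm w * B"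
    using bounded_linear.pos_bounded by blast
  obtain A where A: "0 \<le> A" "\<And>s y. s \<in> {0..t} \<Longrightarrow> norm (D s (Y s z) y) \<le> A * norm y"
    using D_along_bounded[OF z] by blast
  obtain C where C: "0 \<le> C" "\<And>e. 0 < e \<Longrightarrow> \<exists>r>0. \<forall>z'\<in>U. norm (Y 0 z' - Y 0 z) < r \<longrightarrow> shadows t C e z z'"
    using nearby[OF z t] by blast
  \<comment> \<open>\<open>c * norm (z' - z)\<close> bounds the distance of the trajectories up to
    time \<open>t\<close>: \<open>B\<close> bounds \<open>E z\<close>, the 1 covers the remainder of
    \<open>Y 0\<close>, and \<open>C\<close> is the growth factor.\<close>
  define c where "c = C * (B + 1)"
  define Q where "Q = (1 + c\<^sup>2 * t) * exp ((2 * A + 1) * t)"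
  have "0 < Q" unfolding Q_def using t by (intro mult_pos_pos add_pos_nonneg) auto
  fix e :: real assume "0 < e"
  \<comment> \<open>Gronwall bounds the squared error by
    \<open>\<eta>\<^sup>2 * Q * (norm (z' - z))\<^sup>2\<close>; this \<open>\<eta>\<close> turns
    the root into \<open>e * norm (z' - z)\<close>.\<close>
  define \<eta> where "\<eta> = min 1 (e / sqrt Q)"
  have "0 < \<eta>" using \<open>0 < e\<close> \<open>0 < Q\<close> by (simp add: \<eta>_def)
  obtain r where "0 < r" and r: "\<And>z' s. \<lbrakk>z' \<in> U; norm (Y 0 z' - Y 0 z) < r; s \<in> {0..t}\<rbrakk> \<Longrightarrow>
      norm (Y s z' - Y s z) \<le> C * norm (Y 0 z' - Y 0 z) \<and>
      norm (f s (Y s z') - f s (Y s z) - D s (Y s z) (Y s z' - Y s z)) \<le> \<eta> * norm (Y s z' - Y s z)"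
    using C(2)[OF \<open>0 < \<eta>\<close>] unfolding shadows_def by blast
  have "(Y 0 has_derivative E z) (at z)"
    using C1_derivD(1)[OF Y_init z] at_within_open[OF z open_U] by simp
  then obtain d where "0 < d" and d: "\<And>z'. norm (z' - z) < d \<Longrightarrow>
      norm (Y 0 z' - Y 0 z - E z (z' - z)) \<le> \<eta> * norm (z' - z)"
    using \<open>0 < \<eta>\<close> unfolding has_derivative_at_alt by metis
  obtain d' where "0 < d'" and d': "ball z d' \<subseteq> U" using open_U z open_contains_ball by blast
  define \<rho> where "\<rho> = min (min d d') (r / (B + 1))"
  have "0 < \<rho>" using \<open>0 < d\<close> \<open>0 < d'\<close> \<open>0 < r\<close> B by (simp add: \<rho>_def)
  moreover have "norm (Y t z' - Y t z - m t (z' - z)) \<le> e * norm (z' - z)" if near: "norm (z' - z) < \<rho>" for z'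
  proof -
    have z': "z' \<in> U" using near d' by (force simp: \<rho>_def dist_norm norm_minus_commute)
    define n where "n = norm (z' - z)"
    have i0: "norm (Y 0 z' - Y 0 z - E z (z' - z)) \<le> \<eta> * n"
      unfolding n_def using near by (intro d) (simp add: \<rho>_def)
    have "norm (Y 0 z' - Y 0 z) \<le> norm (Y 0 z' - Y 0 z - E z (z' - z)) + norm (E z (z' - z))"
      using norm_triangle_sub[of "Y 0 z' - Y 0 z" "E z (z' - z)"] by simp
    also have "\<dots> \<le> 1 * n + n * B"
      by (rule add_mono[OF order_trans[OF i0 mult_right_mono] B(2)[of "z' - z", folded n_def]])
        (auto simp: \<eta>_def n_def)
    finally have Y0: "norm (Y 0 z' - Y 0 z) \<le> (B + 1) * n" by (simp add: algebra_simps)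
    also have "\<dots> < r" using near B by (simp add: \<rho>_def n_def field_simps)
    finally have Yr: "norm (Y 0 z' - Y 0 z) < r" .
    define g where "g = (\<lambda>s. Y s z' - Y s z - m s (z' - z))"
    have "(norm (g t))\<^sup>2 \<le> ((norm (g 0))\<^sup>2 + (\<eta> * (c * n))\<^sup>2 * (t - 0)) * exp ((2 * A + 1) * (t - 0))"
    proof (rule gronwall_square(1)[OF t])
      fix s assume s: "s \<in> {0..t}"
      show "(g has_vector_derivative f s (Y s z') - f s (Y s z) - D s (Y s z) (m s (z' - z))) (at s within {0..t})"
        unfolding g_def
        by (intro has_vector_derivative_diff Y_deriv_Icc z z' s has_vector_derivative_within_subset[OF m])
          (use s in auto)
      have lin: "linear (D s (Y s z))" using D_bounded_linear[OF _ z] s by (simp add: bounded_linear.linear)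
      have "norm (Y s z' - Y s z) \<le> C * ((B + 1) * n)"
        using r[OF z' Yr s] Y0 C(1) by (meson mult_left_mono order_trans)
      have "f s (Y s z') - f s (Y s z) - D s (Y s z) (m s (z' - z)) =
          D s (Y s z) (g s) + (f s (Y s z') - f s (Y s z) - D s (Y s z) (Y s z' - Y s z))"
        by (simp add: g_def linear_diff[OF lin])
      also have "norm \<dots> \<le> A * norm (g s) + \<eta> * norm (Y s z' - Y s z)"
        by (intro norm_triangle_le add_mono A(2) s) (use r[OF z' Yr s] in blast)
      also have "\<dots> \<le> A * norm (g s) + \<eta> * (c * n)"
        using \<open>0 < \<eta>\<close> \<open>norm (Y s z' - Y s z) \<le> C * ((B + 1) * n)\<close>
        by (intro add_left_mono mult_left_mono) (auto simp: c_def mult.assoc)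
      finally show "norm (f s (Y s z') - f s (Y s z) - D s (Y s z) (m s (z' - z))) \<le> A * norm (g s) + \<eta> * (c * n)" .
    qed (rule A(1))
    also have "\<dots> \<le> ((\<eta> * n)\<^sup>2 + (\<eta> * (c * n))\<^sup>2 * t) * exp ((2 * A + 1) * t)"
    proof -
      have "(norm (g 0))\<^sup>2 \<le> (\<eta> * n)\<^sup>2"
        using i0 by (intro power_mono) (auto simp: g_def m0)
      then show ?thesis by (simp add: mult_right_mono)
    qed
    also have "\<dots> = (\<eta> * sqrt Q * n)\<^sup>2"
      using \<open>0 < Q\<close> by (simp add: power_mult_distrib) (simp add: Q_def algebra_simps)
    finally have "norm (g t) \<le> \<eta> * sqrt Q * n"
      by (rule power2_le_imp_le) (use \<open>0 < \<eta>\<close> \<open>0 < Q\<close> in \<open>auto simp: n_def\<close>)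
    also have "\<dots> \<le> e * n"
    proof (intro mult_right_mono)
      have "\<eta> * sqrt Q \<le> e / sqrt Q * sqrt Q"
        using \<open>0 < Q\<close> by (intro mult_right_mono) (auto simp: \<eta>_def)
      then show "\<eta> * sqrt Q \<le> e" using \<open>0 < Q\<close> by simp
    qed (simp add: n_def)
    finally show ?thesis by (simp add: g_def n_def)
  qed
  ultimately show "\<exists>d>0. \<forall>y. norm (y - z) < d \<longrightarrow> norm (Y t y - Y t z - m t (y - z)) \<le> e * norm (y - z)"
    by blast
qed

lemma Y_init_close:
  assumes "z \<in> U" "0 < r"
  obtains d where "0 < d" "\<And>z'. \<lbrakk>z' \<in> U; dist z' z < d\<rbrakk> \<Longrightarrow> norm (Y 0 z' - Y 0 z) < r"
  using C1_derivD(4)[OF Y_init] assms unfolding continuous_on_iff dist_norm by metis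

lemma Y_cont: "continuous_on ({0..} \<times> U) (\<lambda>(t, z). Y t z)"
proof (rule continuous_on_prod_of_uniform)
  fix z assume z: "z \<in> U"
  then show "continuous_on {0..} (\<lambda>t. Y t z)" by (rule Y_time_cont) simp
  fix T e :: real assume "0 \<le> T" "0 < e"
  obtain C where C: "0 \<le> C" "\<And>e. 0 < e \<Longrightarrow> \<exists>r>0. \<forall>z'\<in>U. norm (Y 0 z' - Y 0 z) < r \<longrightarrow> shadows T C e z z'"
    using nearby[OF z \<open>0 \<le> T\<close>] by blast
  obtain r where "0 < r" and r: "\<And>z' s. \<lbrakk>z' \<in> U; norm (Y 0 z' - Y 0 z) < r; s \<in> {0..T}\<rbrakk> \<Longrightarrow>
      norm (Y s z' - Y s z) \<le> C * norm (Y 0 z' - Y 0 z)"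
    using C(2)[of 1] unfolding shadows_def by auto
  have "0 < min r (e / (C + 1))" using \<open>0 < r\<close> \<open>0 < e\<close> C(1) by simp
  then obtain d where "0 < d" and d: "\<And>z'. \<lbrakk>z' \<in> U; dist z' z < d\<rbrakk> \<Longrightarrow> norm (Y 0 z' - Y 0 z) < min r (e / (C + 1))"
    using Y_init_close[OF z] by blast
  have "dist (Y s z') (Y s z) \<le> e" if z': "z' \<in> U" "dist z' z < d" and s: "s \<in> {0..T}" for z' s
  proof -
    have small: "norm (Y 0 z' - Y 0 z) < r" "norm (Y 0 z' - Y 0 z) < e / (C + 1)" using d[OF z'] by auto
    have "dist (Y s z') (Y s z) \<le> C * norm (Y 0 z' - Y 0 z)"
      using r[OF z'(1) small(1) s] by (simp add: dist_norm)
    also have "\<dots> \<le> (C + 1) * norm (Y 0 z' - Y 0 z)" by (intro mult_right_mono) auto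
    also have "\<dots> \<le> e" using small(2) C(1) by (simp add: field_simps)
    finally show ?thesis .
  qed
  then show "\<exists>d>0. \<forall>z'\<in>U. dist z' z < d \<longrightarrow> (\<forall>t\<in>{0..T}. dist (Y t z') (Y t z) \<le> e)"
    using \<open>0 < d\<close> by blast
qed

text \<open>Along neighbouring trajectories the coefficients of the variational equation are
  uniformly close, so Gronwall compares their solutions.\<close>

lemma variation_cont:
  assumes m0: "\<And>z w. z \<in> U \<Longrightarrow> m 0 z w = E z w"
    and m: "\<And>t z w. \<lbrakk>0 \<le> t; z \<in> U\<rbrakk> \<Longrightarrow>
      ((\<lambda>t. m t z w) has_vector_derivative D t (Y t z) (m t z w)) (at t within {0..})"
  shows "continuous_on ({0..} \<times> U) (\<lambda>(t, z). m t z w)"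
proof (rule continuous_on_prod_of_uniform)
  fix z assume z: "z \<in> U"
  have mc: "continuous_on {0..} (\<lambda>t. m t z w)"
    using has_vector_derivative_continuous[OF m[OF _ z]]
    by (simp add: continuous_on_eq_continuous_within)
  then show "continuous_on {0..} (\<lambda>t. m t z w)" .
  fix T e :: real assume T: "0 \<le> T" and "0 < e"
  obtain A where A: "0 \<le> A" "\<And>s y. s \<in> {0..T} \<Longrightarrow> norm (D s (Y s z) y) \<le> A * norm y"
    using D_along_bounded[OF z] by blast
  have "bounded ((\<lambda>t. m t z w) ` {0..T})"
    by (intro compact_imp_bounded compact_continuous_image compact_Icc continuous_on_subset[OF mc]) auto
  then obtain M where M: "0 < M" "\<And>t. t \<in> {0..T} \<Longrightarrow> norm (m t z w) \<le> M"
    unfolding bounded_pos by blast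
  define Q where "Q = (1 + M\<^sup>2 * T) * exp ((2 * (A + 1) + 1) * T)"
  have "0 \<le> M\<^sup>2 * T" using T by simp
  then have "0 < 1 + M\<^sup>2 * T" by linarith
  then have "0 < Q" by (simp add: Q_def)
  define \<eta> where "\<eta> = min 1 (e / sqrt Q)"
  have "0 < \<eta>" using \<open>0 < e\<close> \<open>0 < Q\<close> by (simp add: \<eta>_def)
  obtain C where "0 \<le> C" and C: "\<And>e. 0 < e \<Longrightarrow> \<exists>r>0. \<forall>z'\<in>U. norm (Y 0 z' - Y 0 z) < r \<longrightarrow> shadows T C e z z'"
    using nearby[OF z T] by blast
  obtain r where "0 < r" and r: "\<And>z' s. \<lbrakk>z' \<in> U; norm (Y 0 z' - Y 0 z) < r; s \<in> {0..T}\<rbrakk> \<Longrightarrow>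
      norm (DB (s, Y s z') - DB (s, Y s z)) \<le> \<eta>"
    using C[OF \<open>0 < \<eta>\<close>] unfolding shadows_def by blast
  obtain d where "0 < d" and d: "\<And>z'. \<lbrakk>z' \<in> U; dist z' z < d\<rbrakk> \<Longrightarrow> norm (Y 0 z' - Y 0 z) < r"
    using Y_init_close[OF z \<open>0 < r\<close>] by blast
  obtain d' where "0 < d'" and d': "\<And>z'. \<lbrakk>z' \<in> U; dist z' z < d'\<rbrakk> \<Longrightarrow> norm (E z' w - E z w) < \<eta>"
    using C1_derivD(2)[OF Y_init, of w] z \<open>0 < \<eta>\<close> unfolding continuous_on_iff dist_norm by metis
  have "dist (m t z' w) (m t z w) \<le> e"
    if z': "z' \<in> U" "dist z' z < min d d'" and t: "t \<in> {0..T}" for z' t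
  proof -
    have t0: "0 \<le> t" and tT: "t \<le> T" using t by auto
    define g where "g = (\<lambda>s. m s z' w - m s z w)"
    have "(norm (g t))\<^sup>2 \<le> ((norm (g 0))\<^sup>2 + (\<eta> * M)\<^sup>2 * (t - 0)) * exp ((2 * (A + 1) + 1) * (t - 0))"
    proof (rule gronwall_square(1)[OF t0])
      fix s assume "s \<in> {0..t}"
      then have s: "s \<in> {0..T}" "0 \<le> s" using tT by auto
      show "(g has_vector_derivative D s (Y s z') (m s z' w) - D s (Y s z) (m s z w)) (at s within {0..t})"
        unfolding g_def
        by (intro has_vector_derivative_diff has_vector_derivative_within_subset[OF m] z z' s) auto
      have DBr: "norm (DB (s, Y s z') - DB (s, Y s z)) \<le> \<eta>"
        using z' d s by (intro r) auto
      have DD: "norm (D s (Y s z') y - D s (Y s z) y) \<le> \<eta> * norm y" for y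
      proof -
        have "norm ((DB (s, Y s z') - DB (s, Y s z)) y) \<le> norm (DB (s, Y s z') - DB (s, Y s z)) * norm y"
          by (rule norm_blinfun)
        also have "\<dots> \<le> \<eta> * norm y" by (intro mult_right_mono DBr) simp
        finally show ?thesis using s z z' by (simp add: blinfun.diff_left DB_apply Y_in)
      qed
      have lin: "linear (D s (Y s z'))" using D_bounded_linear[OF s(2) z'(1)] by (rule bounded_linear.linear)
      \<comment> \<open>Written so that the source involves only the fixed, bounded solution along
        \<open>z\<close>; the term with \<open>g s\<close> raises the growth rate from
        \<open>A\<close> to \<open>A + 1\<close>.\<close>
      have "D s (Y s z') (m s z' w) - D s (Y s z) (m s z w) =
          D s (Y s z) (g s) + (D s (Y s z') (g s) - D s (Y s z) (g s)) + (D s (Y s z') (m s z w) - D s (Y s z) (m s z w))"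
        by (simp add: g_def linear_diff[OF lin])
      also have "norm \<dots> \<le> A * norm (g s) + \<eta> * norm (g s) + \<eta> * norm (m s z w)"
        by (intro norm_triangle_le add_mono A(2) s DD)
      also have "\<dots> \<le> A * norm (g s) + 1 * norm (g s) + \<eta> * M"
        using M(2)[OF s(1)] \<open>0 < \<eta>\<close>
        by (intro add_mono mult_right_mono mult_left_mono) (auto simp: \<eta>_def)
      finally show "norm (D s (Y s z') (m s z' w) - D s (Y s z) (m s z w)) \<le> (A + 1) * norm (g s) + \<eta> * M"
        by (simp add: algebra_simps)
    qed (use A(1) in auto)
    also have "\<dots> \<le> (\<eta>\<^sup>2 + (\<eta> * M)\<^sup>2 * T) * exp ((2 * (A + 1) + 1) * T)"
    proof (intro mult_mono add_mono)
      show "(norm (g 0))\<^sup>2 \<le> \<eta>\<^sup>2"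
        using d'[OF z'(1)] z' z by (intro power_mono) (auto simp: g_def m0)
    qed (use t0 tT A in auto)
    also have "\<dots> = (\<eta> * sqrt Q)\<^sup>2"
      using \<open>0 < Q\<close> by (simp add: power_mult_distrib) (simp add: Q_def algebra_simps)
    finally have "norm (g t) \<le> \<eta> * sqrt Q"
      by (rule power2_le_imp_le) (use \<open>0 < \<eta>\<close> \<open>0 < Q\<close> in auto)
    also have "\<dots> \<le> e / sqrt Q * sqrt Q"
      using \<open>0 < Q\<close> by (intro mult_right_mono) (auto simp: \<eta>_def)
    also have "\<dots> = e" using \<open>0 < Q\<close> by simp
    finally show ?thesis by (simp add: g_def dist_norm)
  qed
  moreover have "0 < min d d'" using \<open>0 < d\<close> \<open>0 < d'\<close> by simp
  ultimately show "\<exists>d>0. \<forall>z'\<in>U. dist z' z < d \<longrightarrow> (\<forall>t\<in>{0..T}. dist (m t z' w) (m t z w) \<le> e)"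
    by blast
qed

text \<open>The time derivative at the point and the jointly continuous derivative in
  \<open>z\<close> combine to a total derivative, one-sided in time at \<open>t = 0\<close>.\<close>

theorem C1_dependence:
  obtains m where "\<And>z w. z \<in> U \<Longrightarrow> m 0 z w = E z w"
    "\<And>t z w. \<lbrakk>0 \<le> t; z \<in> U\<rbrakk> \<Longrightarrow>
      ((\<lambda>t. m t z w) has_vector_derivative D t (Y t z) (m t z w)) (at t within {0..})"
    "C1_deriv ({0..} \<times> U) (\<lambda>(t, z). Y t z) (\<lambda>(t, z) (dt, dz). dt *\<^sub>R f t (Y t z) + m t z dz)"
proof -
  obtain m where m0: "\<And>z w. z \<in> U \<Longrightarrow> m 0 z w = E z w"
    and m: "\<And>t z w. \<lbrakk>0 \<le> t; z \<in> U\<rbrakk> \<Longrightarrow>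
      ((\<lambda>t. m t z w) has_vector_derivative D t (Y t z) (m t z w)) (at t within {0..})"
    using variation_exists by blast
  have lin: "bounded_linear (m t z)" if "0 \<le> t" "z \<in> U" for t z
    by (rule variation_bounded_linear[OF that(2,1), where m = "\<lambda>t. m t z"])
      (use that in \<open>auto intro: m0 m\<close>)
  have mc: "continuous_on ({0..} \<times> U) (\<lambda>p. m (fst p) (snd p) w)" for w
    using variation_cont[OF m0 m] by (simp add: case_prod_unfold)
  have fc: "continuous_on ({0..} \<times> U) (\<lambda>p. f (fst p) (Y (fst p) (snd p)))"
  proof -
    have "continuous_on ({0..} \<times> U) (\<lambda>p. (\<lambda>(t, x). f t x) (fst p, Y (fst p) (snd p)))"
      by (rule continuous_on_compose2[OF f_cont])
        (use Y_cont Y_in in \<open>auto intro!: continuous_intros simp: case_prod_unfold\<close>)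
    then show ?thesis by simp
  qed
  have "C1_deriv ({0..} \<times> U) (\<lambda>(t, z). Y t z) (\<lambda>(t, z) (dt, dz). dt *\<^sub>R f t (Y t z) + m t z dz)"
  proof (rule C1_derivI)
    fix p assume "p \<in> {0::real..} \<times> U"
    then obtain t z where p: "p = (t, z)" "0 \<le> t" "z \<in> U" by auto
    \<comment> \<open>The combination of partial derivatives works over a convex set of parameters,
      hence the ball.\<close>
    obtain r where "0 < r" and r: "ball z r \<subseteq> U" using open_U p open_contains_ball by blast
    have "((\<lambda>(t, z). Y t z) has_derivative
        (\<lambda>(dt, dz). dt *\<^sub>R f t (Y t z) + blinfun_apply (Blinfun (m t z)) dz)) (at (t, z) within {0..} \<times> ball z r)"
    proof (rule has_derivative_partialsI[where fx = "\<lambda>dt. dt *\<^sub>R f t (Y t z)" and fy = "\<lambda>t z. Blinfun (m t z)"])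
      show "((\<lambda>t. Y t z) has_derivative (\<lambda>dt. dt *\<^sub>R f t (Y t z))) (at t within {0..})"
        using Y_deriv p by (simp add: has_vector_derivative_def)
      fix s y assume "s \<in> {0::real..}" "y \<in> ball z r"
      then have sy: "0 \<le> s" "y \<in> U" using r by auto
      have "(Y s has_derivative m s y) (at y)"
        by (rule variation_is_derivative[OF sy(2) sy(1), where m = "\<lambda>s. m s y"]) (use sy in \<open>auto intro: m0 m\<close>)
      then show "(Y s has_derivative blinfun_apply (Blinfun (m s y))) (at y within ball z r)"
        by (simp add: bounded_linear_Blinfun_apply lin sy has_derivative_at_withinI)
    next
      have "continuous_on ({0..} \<times> U) (\<lambda>p. Blinfun (m (fst p) (snd p)))"
        by (rule continuous_on_Blinfun) (use lin mc in auto)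
      then have "continuous_on ({0..} \<times> ball z r) (\<lambda>(t, z). Blinfun (m t z))"
        by (rule continuous_on_subset[THEN continuous_on_eq]) (use r in auto)
      then show "continuous (at (t, z) within {0..} \<times> ball z r) (\<lambda>(t, z). Blinfun (m t z))"
        using p \<open>0 < r\<close> by (simp add: continuous_on_eq_continuous_within)
    qed (use \<open>0 < r\<close> in auto)
    moreover have "at (t, z) within {0..} \<times> ball z r = at (t, z) within {0..} \<times> U"
      by (rule at_within_nhd[of _ "UNIV \<times> ball z r"]) (use \<open>0 < r\<close> r in \<open>auto intro: open_Times\<close>)
    ultimately show "((\<lambda>(t, z). Y t z) has_derivative (case p of (t, z) \<Rightarrow>
        \<lambda>(dt, dz). dt *\<^sub>R f t (Y t z) + m t z dz)) (at p within {0..} \<times> U)"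
      by (simp add: p bounded_linear_Blinfun_apply lin)
  next
    show "continuous_on ({0..} \<times> U) (\<lambda>p. (case p of (t, z) \<Rightarrow>
        \<lambda>(dt, dz). dt *\<^sub>R f t (Y t z) + m t z dz) w)" for w
      unfolding case_prod_unfold by (intro continuous_intros mc fc)
  qed
  with m0 m show thesis using that by blast
qed

end

section \<open>Partial derivatives, reflection and inverse functions\<close>

text \<open>Change one coordinate at a time and apply the mean value inequality to each move. This
  turns the partial derivatives of \<open>v\<close> in the regularity hypothesis into total
  derivatives in \<open>x\<close>.\<close>

lemma has_derivative_of_partials:
  fixes g :: "real ^ 'n::finite \<Rightarrow> 'b::real_normed_vector"
  assumes "open S" "x \<in> S"
    and partial: "\<And>i y. y \<in> S \<Longrightarrow> ((\<lambda>h. g (y + h *\<^sub>R axis i 1)) has_vector_derivative P i y) (at 0)"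
    and cont: "\<And>i. continuous_on S (P i)"
  shows "(g has_derivative (\<lambda>w. \<Sum>i\<in>UNIV. (w $ i) *\<^sub>R P i x)) (at x)"
  unfolding has_derivative_at_alt
proof (intro conjI allI impI)
  show "bounded_linear (\<lambda>w. \<Sum>i\<in>UNIV. (w $ i) *\<^sub>R P i x)"
    by (intro bounded_linear_sum bounded_linear_compose[OF bounded_linear_scaleR_left] bounded_linear_vec_nth)
  fix e :: real assume "0 < e"
  \<comment> \<open>The sum of the absolute coordinates is at most the dimension times the norm;
    dividing by it in advance leaves \<open>e\<close>.\<close>
  define \<epsilon> where "\<epsilon> = e / real CARD('n)"
  have "0 < \<epsilon>" using \<open>0 < e\<close> by (simp add: \<epsilon>_def)
  have "\<exists>d>0. \<forall>y\<in>ball x d. y \<in> S \<and> norm (P i y - P i x) \<le> \<epsilon>" for i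
  proof -
    obtain d1 where "0 < d1" "ball x d1 \<subseteq> S" using assms open_contains_ball by blast
    moreover obtain d2 where "0 < d2" "\<forall>y\<in>S. dist y x < d2 \<longrightarrow> dist (P i y) (P i x) < \<epsilon>"
      using cont[of i] \<open>x \<in> S\<close> \<open>0 < \<epsilon>\<close> unfolding continuous_on_iff by blast
    ultimately show ?thesis
      by (intro exI[of _ "min d1 d2"]) (auto simp: dist_commute dist_norm subset_eq less_imp_le)
  qed
  then obtain d where d: "\<And>i. 0 < d i" "\<And>i y. y \<in> ball x (d i) \<Longrightarrow> y \<in> S \<and> norm (P i y - P i x) \<le> \<epsilon>"
    by metis
  define \<delta> where "\<delta> = Min (range d)"
  have "0 < \<delta>" using d(1) by (simp add: \<delta>_def)
  have \<delta>: "y \<in> S \<and> norm (P i y - P i x) \<le> \<epsilon>" if "norm (y - x) < \<delta>" for i y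
  proof (rule d(2))
    have "\<delta> \<le> d i" by (simp add: \<delta>_def)
    then show "y \<in> ball x (d i)" using that by (simp add: dist_norm norm_minus_commute)
  qed
  have one: "norm (g (y + c *\<^sub>R axis i 1) - g y - c *\<^sub>R P i x) \<le> \<epsilon> * \<bar>c\<bar>"
    if small: "norm (y - x) + \<bar>c\<bar> < \<delta>" for y c i
  proof -
    define k where "k = (\<lambda>s. g (y + s *\<^sub>R axis i 1) - s *\<^sub>R P i x)"
    have "norm (k c - k 0) \<le> \<epsilon> * norm (c - 0)"
    proof (rule differentiable_bound[where S = "closed_segment 0 c"
          and f' = "\<lambda>s h. h *\<^sub>R (P i (y + s *\<^sub>R axis i 1) - P i x)"])
      fix s assume "s \<in> closed_segment 0 c"
      then have "\<bar>s\<bar> \<le> \<bar>c\<bar>" by (auto simp: closed_segment_eq_real_ivl split: if_splits)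
      have "norm (y + s *\<^sub>R axis i 1 - x) \<le> norm (y - x) + \<bar>s\<bar>"
        using norm_triangle_ineq[of "y - x" "s *\<^sub>R axis i 1"] by (simp add: algebra_simps norm_axis_1)
      also have "\<dots> < \<delta>" using small \<open>\<bar>s\<bar> \<le> \<bar>c\<bar>\<close> by simp
      finally have in\<delta>: "norm (y + s *\<^sub>R axis i 1 - x) < \<delta>" .
      have "((\<lambda>h. g (y + s *\<^sub>R axis i 1 + (h - s) *\<^sub>R axis i 1)) has_vector_derivative 1 *\<^sub>R P i (y + s *\<^sub>R axis i 1)) (at s)"
      proof (rule vector_diff_chain_at[where f = "\<lambda>h. h - s" and g = "\<lambda>h. g (y + s *\<^sub>R axis i 1 + h *\<^sub>R axis i 1)", unfolded o_def])
        show "((\<lambda>h. h - s) has_vector_derivative 1) (at s)"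
          by (auto intro!: derivative_eq_intros simp flip: has_real_derivative_iff_has_vector_derivative)
        show "((\<lambda>h. g (y + s *\<^sub>R axis i 1 + h *\<^sub>R axis i 1)) has_vector_derivative P i (y + s *\<^sub>R axis i 1)) (at (s - s))"
          using partial[of "y + s *\<^sub>R axis i 1" i] \<delta>[OF in\<delta>] by simp
      qed
      then have "((\<lambda>h. g (y + h *\<^sub>R axis i 1)) has_vector_derivative P i (y + s *\<^sub>R axis i 1)) (at s)"
        by (simp add: algebra_simps)
      then have "(k has_vector_derivative (P i (y + s *\<^sub>R axis i 1) - P i x)) (at s)"
        unfolding k_def by (auto intro!: derivative_eq_intros)
      then show "(k has_derivative (\<lambda>h. h *\<^sub>R (P i (y + s *\<^sub>R axis i 1) - P i x))) (at s within closed_segment 0 c)"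
        by (simp add: has_vector_derivative_def has_derivative_at_withinI)
      show "onorm (\<lambda>h. h *\<^sub>R (P i (y + s *\<^sub>R axis i 1) - P i x)) \<le> \<epsilon>"
        using \<delta>[OF in\<delta>, of i] \<open>0 < \<epsilon>\<close>
        by (intro onorm_bound) (auto simp: mult.commute[of \<epsilon>] intro!: mult_left_mono)
    qed auto
    then show ?thesis by (simp add: k_def algebra_simps)
  qed
  have many: "norm (g (y + (\<Sum>i\<in>I. c i *\<^sub>R axis i 1)) - g y - (\<Sum>i\<in>I. c i *\<^sub>R P i x)) \<le> \<epsilon> * (\<Sum>i\<in>I. \<bar>c i\<bar>)"
    if "finite I" "norm (y - x) + (\<Sum>i\<in>I. \<bar>c i\<bar>) < \<delta>" for I y c
    using that
  proof (induction I arbitrary: y rule: finite_induct)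
    case (insert j I)
    define y' where "y' = y + c j *\<^sub>R axis j 1"
    have "norm (y' - x) \<le> norm (y - x) + \<bar>c j\<bar>"
      using norm_triangle_ineq[of "y - x" "c j *\<^sub>R axis j 1"] by (simp add: y'_def algebra_simps norm_axis_1)
    then have IH: "norm (g (y' + (\<Sum>i\<in>I. c i *\<^sub>R axis i 1)) - g y' - (\<Sum>i\<in>I. c i *\<^sub>R P i x)) \<le> \<epsilon> * (\<Sum>i\<in>I. \<bar>c i\<bar>)"
      using insert.prems insert.hyps by (intro insert.IH) simp
    have "0 \<le> (\<Sum>i\<in>I. \<bar>c i\<bar>)" by (rule sum_nonneg) simp
    moreover have "norm (y - x) + (\<bar>c j\<bar> + (\<Sum>i\<in>I. \<bar>c i\<bar>)) < \<delta>"
      using insert.prems insert.hyps by simp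
    ultimately have "norm (g y' - g y - c j *\<^sub>R P j x) \<le> \<epsilon> * \<bar>c j\<bar>"
      unfolding y'_def by (intro one) linarith
    note norm_triangle_mono[OF IH this]
    then show ?case using insert.hyps by (simp add: y'_def algebra_simps)
  qed simp
  have "norm (g y - g x - (\<Sum>i\<in>UNIV. (y - x) $ i *\<^sub>R P i x)) \<le> e * norm (y - x)"
    if near: "norm (y - x) < \<delta> / real CARD('n)" for y
  proof -
    have "(\<Sum>i\<in>UNIV. \<bar>(y - x) $ i\<bar>) \<le> (\<Sum>i\<in>(UNIV::'n set). norm (y - x))"
      by (intro sum_mono component_le_norm_cart)
    then have le: "(\<Sum>i\<in>UNIV. \<bar>(y - x) $ i\<bar>) \<le> real CARD('n) * norm (y - x)" by simp
    also have "\<dots> < \<delta>" using near by (simp add: field_simps)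
    finally have "norm (g (x + (\<Sum>i\<in>UNIV. (y - x) $ i *\<^sub>R axis i 1)) - g x - (\<Sum>i\<in>UNIV. (y - x) $ i *\<^sub>R P i x))
        \<le> \<epsilon> * (\<Sum>i\<in>UNIV. \<bar>(y - x) $ i\<bar>)"
      by (intro many) auto
    also have "(\<Sum>i\<in>UNIV. (y - x) $ i *\<^sub>R axis i 1) = y - x"
      using basis_expansion[of "y - x"] by (simp add: scalar_mult_eq_scaleR)
    also have "\<epsilon> * (\<Sum>i\<in>UNIV. \<bar>(y - x) $ i\<bar>) \<le> \<epsilon> * (real CARD('n) * norm (y - x))"
      using le \<open>0 < \<epsilon>\<close> by (intro mult_left_mono) auto
    finally show ?thesis by (simp add: \<epsilon>_def)
  qed
  moreover have "0 < \<delta> / real CARD('n)" using \<open>0 < \<delta>\<close> by simp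
  ultimately show "\<exists>d>0. \<forall>y. norm (y - x) < d \<longrightarrow>
      norm (g y - g x - (\<Sum>i\<in>UNIV. (y - x) $ i *\<^sub>R P i x)) \<le> e * norm (y - x)"
    by blast
qed

lemma has_derivative_within_Un:
  "\<lbrakk>(f has_derivative f') (at x within S); (f has_derivative f') (at x within T)\<rbrakk> \<Longrightarrow>
    (f has_derivative f') (at x within S \<union> T)"
  unfolding has_derivative_within by (simp add: Lim_within_Un)

text \<open>Odd reflection in time: \<open>F (t, z) = 2 f (0, z) - f (- t, z)\<close> for \<open>t < 0\<close>.\<close>
lemma C1_deriv_reflect:
  fixes f :: "real \<times> 'a::euclidean_space \<Rightarrow> 'b::real_normed_vector"
  assumes f: "C1_deriv ({0..} \<times> U) f D"
  obtains F D' where "C1_deriv (UNIV \<times> U) F D'"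
    "\<And>t z. \<lbrakk>0 \<le> t; z \<in> U\<rbrakk> \<Longrightarrow> F (t, z) = f (t, z)"
    "\<And>t z. \<lbrakk>0 \<le> t; z \<in> U\<rbrakk> \<Longrightarrow> D' (t, z) = D (t, z)"
proof -
  define G where "G = (\<lambda>p. 2 *\<^sub>R f (0, snd p) - f (- fst p, snd p))"
  define DG where "DG = (\<lambda>p w. 2 *\<^sub>R D (0, snd p) (0, snd w) - D (- fst p, snd p) (- fst w, snd w))"
  have c1: "C1_deriv ({..0} \<times> U) (\<lambda>p. (0::real, snd p)) (\<lambda>p w. (0, snd w))"
    by (rule C1_derivI) (auto intro!: derivative_eq_intros continuous_intros)
  have c2: "C1_deriv ({..0} \<times> U) (\<lambda>p. (- fst p :: real, snd p)) (\<lambda>p w. (- fst w, snd w))"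
    by (rule C1_derivI) (auto intro!: derivative_eq_intros continuous_intros)
  have s1: "C1_deriv ({..0} \<times> U) (\<lambda>p. f (0, snd p)) (\<lambda>p w. D (0, snd p) (0, snd w))"
    by (rule C1_deriv_compose[OF c1 f]) auto
  have s2: "C1_deriv ({..0} \<times> U) (\<lambda>p. f (- fst p, snd p)) (\<lambda>p w. D (- fst p, snd p) (- fst w, snd w))"
    by (rule C1_deriv_compose[OF c2 f]) auto
  have G: "C1_deriv ({..0} \<times> U) G DG"
  proof (rule C1_derivI)
    show "(G has_derivative DG p) (at p within {..0} \<times> U)" if "p \<in> {..0} \<times> U" for p
      unfolding G_def DG_def
      by (intro has_derivative_diff has_derivative_scaleR_right C1_derivD(1)[OF s1 that] C1_derivD(1)[OF s2 that])
    show "continuous_on ({..0} \<times> U) (\<lambda>p. DG p w)" for w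
      unfolding DG_def
      by (intro continuous_on_diff continuous_on_scaleR continuous_on_const C1_derivD(2)[OF s1] C1_derivD(2)[OF s2])
  qed
  define F where "F = (\<lambda>p. if 0 \<le> fst p then f p else G p)"
  define D' where "D' = (\<lambda>p. if 0 \<le> fst p then D p else DG p)"
  have eqG: "F p = G p" "D' p = DG p" if "p \<in> {..0} \<times> U" for p
  proof -
    show "F p = G p"
    proof (cases "0 \<le> fst p")
      case True
      with that obtain z where p: "p = (0, z)" by (cases p) auto
      have "f p = 2 *\<^sub>R f p - f p" by (simp add: scaleR_2)
      then show ?thesis by (simp add: F_def G_def p)
    qed (simp add: F_def)
    \<comment> \<open>At \<open>t = 0\<close> the one-sided derivatives agree:
      \<open>2 *\<^sub>R D p (0, dz) - D p (- dt, dz) = D p (dt, dz)\<close> by linearity. This is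
      why the reflection is odd.\<close>
    show "D' p = DG p"
    proof (cases "0 \<le> fst p")
      case True
      with that obtain z where p: "p = (0, z)" "z \<in> U" by (cases p) auto
      have lin: "linear (D p)" using C1_derivD(3)[OF f, of p] p by (simp add: bounded_linear.linear)
      have "D p w = 2 *\<^sub>R D p (0, snd w) - D p (- fst w, snd w)" for w
      proof -
        have "2 *\<^sub>R D p (0, snd w) - D p (- fst w, snd w) = D p (2 *\<^sub>R (0, snd w) - (- fst w, snd w))"
          by (simp only: linear_diff[OF lin] linear_scale[OF lin])
        also have "2 *\<^sub>R (0, snd w) - (- fst w, snd w) = w" by (cases w) (simp add: scaleR_2)
        finally show ?thesis by simp
      qed
      moreover have "DG p w = 2 *\<^sub>R D p (0, snd w) - D p (- fst w, snd w)" for w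
        by (simp add: DG_def p(1))
      ultimately have "D p w = DG p w" for w by (rule trans[OF _ sym])
      then have "D p = DG p" by (rule ext)
      then show ?thesis by (simp add: D'_def)
    qed (simp add: D'_def)
  qed
  have eqf: "F p = f p" "D' p = D p" if "p \<in> {0..} \<times> U" for p
    using that by (auto simp: F_def D'_def)
  have un: "UNIV \<times> U = ({0..} \<times> U) \<union> ({..0::real} \<times> U)" by auto
  have dF: "(F has_derivative D' p) (at p within {0..} \<times> U)" if "p \<in> {0..} \<times> U" for p
    unfolding eqf(2)[OF that]
    by (rule has_derivative_transform[OF that _ C1_derivD(1)[OF f that]]) (rule eqf(1))
  have dG: "(F has_derivative D' p) (at p within {..0} \<times> U)" if "p \<in> {..0} \<times> U" for p
    unfolding eqG(2)[OF that]
    by (rule has_derivative_transform[OF that _ C1_derivD(1)[OF G that]]) (rule eqG(1))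
  have "C1_deriv (UNIV \<times> U) F D'"
  proof (rule C1_derivI)
    fix p assume p: "p \<in> (UNIV::real set) \<times> U"
    consider "0 < fst p" | "fst p < 0" | "fst p = 0" by linarith
    then show "(F has_derivative D' p) (at p within UNIV \<times> U)"
    proof cases
      case 1
      have "at p within UNIV \<times> U = at p within {0..} \<times> U"
        by (rule at_within_nhd[of _ "{0<..} \<times> UNIV"]) (use 1 in \<open>auto intro: open_Times simp: mem_Times_iff\<close>)
      then show ?thesis using dF[of p] 1 p by (auto simp: mem_Times_iff)
    next
      case 2
      have "at p within UNIV \<times> U = at p within {..0} \<times> U"
        by (rule at_within_nhd[of _ "{..<0} \<times> UNIV"]) (use 2 in \<open>auto intro: open_Times simp: mem_Times_iff\<close>)
      then show ?thesis using dG[of p] 2 p by (auto simp: mem_Times_iff)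
    next
      case 3
      then show ?thesis unfolding un
        using p by (intro has_derivative_within_Un dF dG) (auto simp: mem_Times_iff)
    qed
  next
    fix w
    have "continuous_on (({0..} \<times> U) \<union> ({..0} \<times> U)) (\<lambda>p. if 0 \<le> fst p then D p w else DG p w)"
    proof (rule continuous_on_cases_local)
      show "closedin (top_of_set ({0::real..} \<times> U \<union> {..0} \<times> U)) ({0..} \<times> U)"
        unfolding closedin_closed by (intro exI[of _ "{0..} \<times> UNIV"]) (auto intro: closed_Times)
      show "closedin (top_of_set ({0::real..} \<times> U \<union> {..0} \<times> U)) ({..0} \<times> U)"
        unfolding closedin_closed by (intro exI[of _ "{..0} \<times> UNIV"]) (auto intro: closed_Times)
      show "continuous_on ({0..} \<times> U) (\<lambda>p. D p w)" by (rule C1_derivD(2)[OF f])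
      show "continuous_on ({..0} \<times> U) (\<lambda>p. DG p w)" by (rule C1_derivD(2)[OF G])
      show "D p w = DG p w" if "p \<in> {0..} \<times> U \<and> \<not> 0 \<le> fst p \<or> p \<in> {..0} \<times> U \<and> 0 \<le> fst p" for p
        using that eqf(2)[of p] eqG(2)[of p] by (auto simp: mem_Times_iff)
    qed
    then show "continuous_on (UNIV \<times> U) (\<lambda>p. D' p w)"
      unfolding un D'_def by (rule continuous_on_eq) auto
  qed
  with eqf show thesis using that by auto
qed

text \<open>Continuity of the solution of \<open>A p x = w\<close> without a formula for the
  inverse: an injective map is bounded below by some \<open>c\<close>, and nearby maps by
  \<open>c / 2\<close>.\<close>

lemma continuous_on_right_inverse:
  fixes A :: "'p::metric_space \<Rightarrow> 'a::euclidean_space \<Rightarrow> 'a"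
  assumes bl: "\<And>p. p \<in> S \<Longrightarrow> bounded_linear (A p)" and cont: "\<And>w. continuous_on S (\<lambda>p. A p w)"
    and inj: "\<And>p. p \<in> S \<Longrightarrow> inj (A p)" and inv: "\<And>p. p \<in> S \<Longrightarrow> A p (b p) = w"
  shows "continuous_on S b"
  unfolding continuous_on_def
proof
  fix p assume p: "p \<in> S"
  obtain c where c: "0 < c" "\<And>x. c * norm x \<le> norm (A p x)"
    using linear_inj_bounded_below_pos[OF bounded_linear.linear[OF bl[OF p]] inj[OF p]] by blast
  define N where "N = (\<lambda>q. norm (Blinfun (A q) - Blinfun (A p)))"
  have "continuous_on S (\<lambda>q. Blinfun (A q))" by (rule continuous_on_Blinfun[OF bl cont])
  then have "((\<lambda>q. Blinfun (A q)) \<longlongrightarrow> Blinfun (A p)) (at p within S)" using p by (simp add: continuous_on_def)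
  then have N0: "(N \<longlongrightarrow> 0) (at p within S)" unfolding N_def by (intro tendsto_norm_zero LIM_zero)
  have diff: "norm (A p x - A q x) \<le> N q * norm x" if "q \<in> S" for q x
    using norm_blinfun[of "Blinfun (A q) - Blinfun (A p)" x] p that
    by (simp add: N_def blinfun.diff_left bounded_linear_Blinfun_apply bl norm_minus_commute)
  have "((\<lambda>q. b q - b p) \<longlongrightarrow> 0) (at p within S)"
  proof (rule Lim_null_comparison)
    have "\<forall>\<^sub>F q in at p within S. N q < c / 2" using N0 c(1) by (intro order_tendstoD(2)) auto
    moreover have "\<forall>\<^sub>F q in at p within S. q \<in> S" by (simp add: eventually_at_filter)
    ultimately show "\<forall>\<^sub>F q in at p within S. norm (b q - b p) \<le> N q * (2 * norm w / c / c)"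
    proof eventually_elim
      case (elim q)
      have "c * norm (b q) \<le> norm (A p (b q))" by (rule c(2))
      also have "\<dots> \<le> norm (A q (b q)) + norm (A p (b q) - A q (b q))"
        by (rule norm_triangle_sub)
      also have "\<dots> \<le> norm w + c / 2 * norm (b q)"
        using elim diff[of q "b q"] inv[of q] mult_right_mono[of "N q" "c / 2" "norm (b q)"]
        by (intro add_mono) (auto intro: order_trans)
      finally have bq: "norm (b q) \<le> 2 * norm w / c" using c(1) by (simp add: field_simps)
      have "c * norm (b q - b p) \<le> norm (A p (b q - b p))" by (rule c(2))
      \<comment> \<open>Both \<open>A p (b p)\<close> and \<open>A q (b q)\<close> equal
        \<open>w\<close>, so the difference of solutions is controlled by the difference of
        operators.\<close>
      also have "A p (b q - b p) = A p (b q) - A q (b q)"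
        using inv[OF p] inv[of q] elim by (simp add: linear_diff[OF bounded_linear.linear[OF bl[OF p]]])
      also have "norm \<dots> \<le> N q * norm (b q)" using elim by (intro diff)
      also have "\<dots> \<le> N q * (2 * norm w / c)" using bq by (intro mult_left_mono) (auto simp: N_def)
      finally show ?case using c(1) by (simp add: field_simps)
    qed
    show "((\<lambda>q. N q * (2 * norm w / c / c)) \<longlongrightarrow> 0) (at p within S)"
      using tendsto_mult_left_zero[OF N0] by blast
  qed
  then show "(b \<longlongrightarrow> b p) (at p within S)" by (rule LIM_zero_cancel)
qed

text \<open>Injectivity is assumed on all of \<open>W\<close>, so invariance of domain opens the
  image at once; the derivative of the inverse solves a linear equation with varying operator and is
  continuous for that reason.\<close>

lemma C1_deriv_inverse:
  fixes F :: "'a::euclidean_space \<Rightarrow> 'a"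
  assumes "open W" and F: "C1_deriv W F DF" and "inj_on F W"
    and injD: "\<And>p. p \<in> W \<Longrightarrow> inj (DF p)"
  obtains g Dg where "open (F ` W)" "\<And>p. p \<in> W \<Longrightarrow> g (F p) = p" "C1_deriv (F ` W) g Dg"
    "\<And>p w. p \<in> W \<Longrightarrow> DF p (Dg (F p) w) = w"
proof -
  define g where "g = the_inv_into W F"
  have g: "g (F p) = p" if "p \<in> W" for p
    unfolding g_def by (rule the_inv_into_f_f[OF \<open>inj_on F W\<close> that])
  define Dg where "Dg = (\<lambda>q. inv (DF (g q)))"
  have cF: "continuous_on W F" by (rule C1_derivD(4)[OF F])
  have oFW: "open (F ` W)" by (rule invariance_of_domain[OF cF \<open>open W\<close> \<open>inj_on F W\<close>])
  have blD: "bounded_linear (DF p)" if "p \<in> W" for p by (rule C1_derivD(3)[OF F that])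
  have surjD: "surj (DF p)" if "p \<in> W" for p
    by (rule linear_inj_imp_surj[OF bounded_linear.linear[OF blD[OF that]] injD[OF that]])
  have DDg: "DF p (Dg (F p) w) = w" if "p \<in> W" for p w
    unfolding Dg_def g[OF that] by (rule surj_f_inv_f[OF surjD[OF that]])
  have dg: "(g has_derivative Dg q) (at q)" if "q \<in> F ` W" for q
  proof -
    from that obtain p where p: "p \<in> W" "q = F p" by blast
    have der: "(F has_derivative DF p) (at p)"
      using C1_derivD(1)[OF F p(1)] at_within_open[OF p(1) \<open>open W\<close>] by simp
    show ?thesis unfolding p(2)
      by (rule has_derivative_inverse_strong[OF \<open>open W\<close> p(1) cF g der]) (auto simp: DDg[OF p(1)])
  qed
  have "C1_deriv (F ` W) g Dg"
  proof (rule C1_derivI)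
    fix q assume q: "q \<in> F ` W"
    show "(g has_derivative Dg q) (at q within F ` W)" by (rule has_derivative_at_withinI[OF dg[OF q]])
  next
    fix w
    have cg: "continuous_on (F ` W) g"
      by (intro continuous_at_imp_continuous_on ballI has_derivative_continuous[OF dg])
    show "continuous_on (F ` W) (\<lambda>q. Dg q w)"
    proof (rule continuous_on_right_inverse[where A = "\<lambda>q. DF (g q)" and w = w])
      show "continuous_on (F ` W) (\<lambda>q. DF (g q) v)" for v
        by (rule continuous_on_compose2[OF C1_derivD(2)[OF F] cg]) (auto simp: g)
    qed (auto simp: g blD injD DDg)
  qed
  then show thesis using that oFW g DDg by blast
qed

text \<open>Injectivity near \<open>K\<close> is an open condition on pairs of points: near the
  diagonal by the inverse function theorem, away from it by separating the images. Compactness of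
  \<open>K \<times> K\<close> gives a uniform radius.\<close>

lemma compact_injective_neighborhood:
  fixes F :: "'a::euclidean_space \<Rightarrow> 'a"
  assumes "open V" and F: "C1_deriv V F DF" and K: "compact K" "K \<subseteq> V" "inj_on F K"
    and injD: "\<And>p. p \<in> K \<Longrightarrow> inj (DF p)"
  obtains \<delta> where "0 < \<delta>" "(\<Union>p\<in>K. ball p \<delta>) \<subseteq> V" "inj_on F (\<Union>p\<in>K. ball p \<delta>)"
    "\<And>p. p \<in> (\<Union>p\<in>K. ball p \<delta>) \<Longrightarrow> inj (DF p)"
proof -
  have cF: "continuous_on V F" by (rule C1_derivD(4)[OF F])
  have local: "\<exists>N. open N \<and> p \<in> N \<and> N \<subseteq> V \<and> inj_on F N \<and> (\<forall>q\<in>N. inj (DF q))" if p: "p \<in> K" for p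
  proof -
    have pV: "p \<in> V" using p K by blast
    have bl: "blinfun_apply (Blinfun (DF q)) = DF q" if "q \<in> V" for q
      by (rule bounded_linear_Blinfun_apply[OF C1_derivD(3)[OF F that]])
    obtain h where h: "linear h" "h \<circ> DF p = id"
      using linear_injective_left_inverse[OF _ injD[OF p]] C1_derivD(3)[OF F pV] by (auto simp: bounded_linear.linear)
    have "Blinfun h o\<^sub>L Blinfun (DF p) = id_blinfun"
      using h(2) by (intro blinfun_eqI)
        (simp add: bl pV bounded_linear_Blinfun_apply h(1) linear_conv_bounded_linear[symmetric] fun_eq_iff)
    moreover have "continuous_on V (\<lambda>q. Blinfun (DF q))"
      by (rule continuous_on_Blinfun[OF C1_derivD(3,2)[OF F]])
    moreover have "(F has_derivative blinfun_apply (Blinfun (DF q))) (at q)" if "q \<in> V" for q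
      using C1_derivD(1)[OF F that] at_within_open[OF that \<open>open V\<close>] by (simp add: bl that)
    ultimately obtain U' V' g g' where U': "open U'" "U' \<subseteq> V" "p \<in> U'" "open V'" "F p \<in> V'" "homeomorphism U' V' F g"
      and "\<And>y. y \<in> V' \<Longrightarrow> (g has_derivative (g' y)) (at y)"
      and "\<And>y. y \<in> V' \<Longrightarrow> g' y = inv (blinfun_apply (Blinfun (DF (g y))))"
      and bij: "\<And>y. y \<in> V' \<Longrightarrow> bij (blinfun_apply (Blinfun (DF (g y))))"
      using inverse_function_theorem[OF \<open>open V\<close> _ _ pV] by metis
    have "inj_on F U'"
      by (rule inj_on_inverseI[of _ g]) (use U'(6) in \<open>auto simp: homeomorphism_def\<close>)
    moreover have "inj (DF q)" if "q \<in> U'" for q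
    proof -
      have "F q \<in> V'" "g (F q) = q" using U'(6) that by (auto simp: homeomorphism_def)
      then have "bij (blinfun_apply (Blinfun (DF q)))" using bij by metis
      then show ?thesis using bl[of q] that U'(2) by (auto simp: bij_def)
    qed
    ultimately show ?thesis using U' by blast
  qed
  \<comment> \<open>Membership in \<open>V\<close> and injectivity of the derivative are put into
    the same predicate, so one radius yields all three conclusions.\<close>
  define P where "P = (\<lambda>(p, q). p \<in> V \<and> q \<in> V \<and> inj (DF p) \<and> (F p = F q \<longrightarrow> p = q))"
  have "K \<times> K \<subseteq> interior {x. P x}"
  proof clarify
    fix p q assume p: "p \<in> K" and q: "q \<in> K"
    obtain N where N: "open N" "p \<in> N" "N \<subseteq> V" "inj_on F N" "\<forall>q\<in>N. inj (DF q)" using local[OF p] by blast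
    show "(p, q) \<in> interior {x. P x}"
    proof (cases "p = q")
      case True
      have "N \<times> N \<subseteq> {x. P x}" using N inj_onD[OF N(4)] by (auto simp: P_def)
      moreover have "open (N \<times> N)" using N by (simp add: open_Times)
      ultimately show ?thesis using N True by (intro interiorI[of "N \<times> N"]) auto
    next
      case False
      then have "F p \<noteq> F q" using p q inj_onD[OF K(3)] by blast
      from hausdorff[OF this]
      obtain A B where AB: "open A" "open B" "F p \<in> A" "F q \<in> B" "A \<inter> B = {}" by blast
      define N1 where "N1 = N \<inter> (V \<inter> F -` A)"
      define N2 where "N2 = V \<inter> F -` B"
      have "open N1" "open N2" unfolding N1_def N2_def
        by (intro open_Int N continuous_open_preimage[OF cF \<open>open V\<close>] AB)+
      then have "open (N1 \<times> N2)" by (rule open_Times)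
      moreover have "N1 \<times> N2 \<subseteq> {x. P x}" using N AB by (auto simp: P_def N1_def N2_def)
      moreover have "(p, q) \<in> N1 \<times> N2" using N AB p q K(2) by (auto simp: N1_def N2_def)
      ultimately show ?thesis by (intro interiorI)
    qed
  qed
  then obtain \<epsilon> where "0 < \<epsilon>" and \<epsilon>: "(\<Union>x\<in>K \<times> K. ball x \<epsilon>) \<subseteq> interior {x. P x}"
    using compact_subset_open_imp_ball_epsilon_subset[OF compact_Times[OF K(1) K(1)] open_interior] by metis
  \<comment> \<open>Distances in the two factors add up, hence half the radius for each.\<close>
  have P: "P (p, q)" if "p \<in> (\<Union>p\<in>K. ball p (\<epsilon> / 2))" "q \<in> (\<Union>p\<in>K. ball p (\<epsilon> / 2))" for p q
  proof -
    obtain p0 q0 where pq: "p0 \<in> K" "q0 \<in> K" "dist p0 p < \<epsilon> / 2" "dist q0 q < \<epsilon> / 2"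
      using \<open>p \<in> _\<close> \<open>q \<in> _\<close> by auto
    have "dist (p0, q0) (p, q) \<le> dist p0 p + dist q0 q"
      unfolding dist_Pair_Pair by (rule sqrt_sum_squares_le_sum) auto
    also have "\<dots> < \<epsilon>" using pq by simp
    finally have "(p, q) \<in> ball (p0, q0) \<epsilon>" by simp
    then show ?thesis using \<epsilon> pq interior_subset by blast
  qed
  show thesis
  proof (rule that[of "\<epsilon> / 2"])
    show "(\<Union>p\<in>K. ball p (\<epsilon> / 2)) \<subseteq> V" using P by (force simp: P_def)
    show "inj_on F (\<Union>p\<in>K. ball p (\<epsilon> / 2))" by (rule inj_onI) (use P in \<open>auto simp: P_def\<close>)
    show "inj (DF p)" if "p \<in> (\<Union>p\<in>K. ball p (\<epsilon> / 2))" for p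
      using P[OF that that] by (simp add: P_def)
  qed (use \<open>0 < \<epsilon>\<close> in simp)
qed

section \<open>Gradients and unit vector fields\<close>

lemma grad_eqI:
  assumes "(f has_derivative (\<lambda>h. h \<bullet> D)) (at x)"
  shows "grad f x = D"
  unfolding grad_def gderiv_def
proof (rule the_equality, rule assms)
  fix D' assume "(f has_derivative (\<lambda>h. h \<bullet> D')) (at x)"
  from has_derivative_unique[OF this assms] have "h \<bullet> D' = h \<bullet> D" for h by meson
  then show "D' = D" by (metis inner_commute vector_eq_rdot)
qed

text \<open>Riesz representation trades the operator-valued first derivative for a C1 vector
  field.\<close>

lemma C2_on_grad:
  fixes f :: "'a::euclidean_space \<Rightarrow> real"
  assumes "open U" "C2_on U f"
  obtains H where "\<And>x. x \<in> U \<Longrightarrow> (f has_derivative (\<lambda>h. h \<bullet> grad f x)) (at x)" "C1_deriv U (grad f) H"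
proof -
  obtain f' where f': "\<And>x. x \<in> U \<Longrightarrow> (f has_derivative blinfun_apply (f' x)) (at x within U)"
    and "C1_on U f'" using assms by (auto simp: C2_on_def)
  then obtain D where D: "C1_deriv U f' D" by (auto simp: C1_on_iff_C1_deriv)
  define n where "n = (\<lambda>x. \<Sum>i\<in>Basis. f' x i *\<^sub>R i)"
  have f'n: "blinfun_apply (f' x) = (\<lambda>h. h \<bullet> n x)" for x
  proof
    fix h
    have "f' x h = f' x (\<Sum>i\<in>Basis. (h \<bullet> i) *\<^sub>R i)" by (simp add: euclidean_representation)
    also have "\<dots> = (\<Sum>i\<in>Basis. (h \<bullet> i) * f' x i)" by (simp add: blinfun.sum_right blinfun.scaleR_right)
    finally show "f' x h = h \<bullet> n x" by (simp add: n_def inner_sum_right mult.commute)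
  qed
  have df: "(f has_derivative (\<lambda>h. h \<bullet> n x)) (at x)" if "x \<in> U" for x
    using f'[OF that] at_within_open[OF that \<open>open U\<close>] by (simp add: f'n)
  have gn: "grad f x = n x" if "x \<in> U" for x by (rule grad_eqI[OF df[OF that]])
  have "C1_deriv U n (\<lambda>x w. \<Sum>i\<in>Basis. D x w i *\<^sub>R i)"
  proof (rule C1_derivI)
    show "(n has_derivative (\<lambda>w. \<Sum>i\<in>Basis. D x w i *\<^sub>R i)) (at x within U)" if "x \<in> U" for x
      unfolding n_def
      by (intro has_derivative_sum has_derivative_scaleR_left
          bounded_linear.has_derivative[OF blinfun.bounded_linear_left] C1_derivD(1)[OF D that])
    show "continuous_on U (\<lambda>x. \<Sum>i\<in>Basis. D x w i *\<^sub>R i)" for w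
      by (intro continuous_intros C1_derivD(2)[OF D])
  qed
  moreover have "(grad f has_derivative E) (at x within U)" if "(n has_derivative E) (at x within U)" "x \<in> U" for x E
    by (rule has_derivative_transform[OF that(2) gn that(1)])
  ultimately have C1: "C1_deriv U (grad f) (\<lambda>x w. \<Sum>i\<in>Basis. D x w i *\<^sub>R i)"
    unfolding C1_deriv_def by blast
  show thesis by (rule that[OF _ C1]) (simp add: df gn)
qed

text \<open>The way back from a C1 gradient field. Derivatives are taken within \<open>S\<close>, so
  that it applies to a space-time set containing its initial slice.\<close>

lemma C2_onI_gradient:
  fixes f :: "'a::euclidean_space \<Rightarrow> real"
  assumes N: "C1_deriv S N DN" and f: "\<And>p. p \<in> S \<Longrightarrow> (f has_derivative (\<lambda>h. h \<bullet> N p)) (at p within S)"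
  shows "C2_on S f"
  unfolding C2_on_def
proof (intro exI conjI ballI)
  show "(f has_derivative blinfun_apply (blinfun_inner_left (N p))) (at p within S)" if "p \<in> S" for p
    using f[OF that] by simp
  have "C1_deriv S (\<lambda>p. blinfun_inner_left (N p)) (\<lambda>p w. blinfun_inner_left (DN p w))"
    by (rule C1_derivI)
      (intro bounded_linear.has_derivative[OF bounded_linear_blinfun_inner_left] C1_derivD(1)[OF N]
        bounded_linear.continuous_on[OF bounded_linear_blinfun_inner_left] C1_derivD(2)[OF N], assumption?)+
  then show "C1_on S (\<lambda>p. blinfun_inner_left (N p))" unfolding C1_on_iff_C1_deriv by blast
qed

text \<open>\<open>DN\<close> is the product rule for \<open>P\<close> times the reciprocal of its
  norm; a field of constant length is orthogonal to its variations.\<close>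

lemma C1_deriv_normalize:
  fixes P :: "'a::euclidean_space \<Rightarrow> 'b::real_inner"
  assumes P: "C1_deriv S P DP" and nz: "\<And>s. s \<in> S \<Longrightarrow> P s \<noteq> 0"
  obtains DN where "C1_deriv S (\<lambda>s. P s /\<^sub>R norm (P s)) DN"
    "\<And>s w. s \<in> S \<Longrightarrow> (P s /\<^sub>R norm (P s)) \<bullet> DN s w = 0"
proof (rule that)
  define r where "r = (\<lambda>s. inverse (norm (P s)))"
  define DN where "DN = (\<lambda>s w. r s *\<^sub>R DP s w + (- (r s * (DP s w \<bullet> sgn (P s)) * r s)) *\<^sub>R P s)"
  show "C1_deriv S (\<lambda>s. P s /\<^sub>R norm (P s)) DN"
  proof (rule C1_derivI)
    fix s assume s: "s \<in> S"
    have dn: "((\<lambda>s. norm (P s)) has_derivative (\<lambda>w. DP s w \<bullet> sgn (P s))) (at s within S)"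
      by (rule has_derivative_compose[OF C1_derivD(1)[OF P s] GDERIV_norm[OF nz[OF s], unfolded gderiv_def]])
    have "(r has_derivative (\<lambda>w. - (r s * (DP s w \<bullet> sgn (P s)) * r s))) (at s within S)"
      unfolding r_def by (rule Deriv.has_derivative_inverse[OF _ dn]) (simp add: nz[OF s])
    from has_derivative_scaleR[OF this C1_derivD(1)[OF P s]]
    show "((\<lambda>s. P s /\<^sub>R norm (P s)) has_derivative DN s) (at s within S)"
      by (simp add: DN_def r_def)
  next
    show "continuous_on S (\<lambda>s. DN s w)" for w
      unfolding DN_def r_def sgn_div_norm
      by (intro continuous_intros C1_derivD(2)[OF P] C1_derivD(4)[OF P]) (use nz in auto)
  qed
  show "(P s /\<^sub>R norm (P s)) \<bullet> DN s w = 0" if "s \<in> S" for s w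
    using nz[OF that]
    by (simp add: DN_def r_def sgn_div_norm inner_simps field_simps flip: power2_norm_eq_inner)
      (simp add: power2_eq_square inner_commute)
qed

section \<open>The flow in the domain\<close>

lemma has_vector_derivative_time_reversal:
  assumes x: "\<And>r. r \<in> {0..s} \<Longrightarrow> (x has_vector_derivative x' r) (at r within {0..s})"
    and r: "r \<in> {0..s::real}"
  shows "((\<lambda>r. x (s - r)) has_vector_derivative - x' (s - r)) (at r within {0..s})"
proof -
  have im: "(\<lambda>r. s - r) ` {0..s} = {0..s}" by (auto simp: image_iff intro!: bexI[of _ "s - _"])
  have "((\<lambda>r. s - r) has_vector_derivative - 1) (at r within {0..s})"
    by (auto intro!: derivative_eq_intros simp flip: has_real_derivative_iff_has_vector_derivative)
  moreover have "(x has_vector_derivative x' (s - r)) (at (s - r) within (\<lambda>r. s - r) ` {0..s})"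
    unfolding im by (rule x) (use r in auto)
  ultimately show ?thesis
    using vector_diff_chain_within[of "\<lambda>r. s - r" "- 1" r "{0..s}" x "x' (s - r)"] by (simp add: o_def)
qed

text \<open>A solution reaching the frontier could be followed backwards along the frontier.\<close>
lemma viable_open:
  fixes x :: "real \<Rightarrow> 'a::euclidean_space"
  assumes "open S" "x 0 \<in> S"
    and dx: "\<And>s. s \<in> {0..T} \<Longrightarrow> (x has_vector_derivative f s (x s)) (at s within {0..T})"
    and lip: "\<And>s. s \<in> {0..T} \<Longrightarrow> L-lipschitz_on UNIV (f s)"
    and tan: "\<And>s y. \<lbrakk>s \<in> {0..T}; y \<in> frontier S\<rbrakk> \<Longrightarrow> - f s y \<in> tangent_cone (frontier S) y"
    and t: "t \<in> {0..T}"
  shows "x t \<in> S"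
proof (rule ccontr)
  assume "x t \<notin> S"
  have "continuous_on {0..T} x"
    using has_vector_derivative_continuous[OF dx] by (simp add: continuous_on_eq_continuous_within)
  then have "continuous_on {0..t} x" by (rule continuous_on_subset) (use t in auto)
  then have "connected (x ` {0..t})" by (intro connected_continuous_image) auto
  moreover have "x 0 \<in> x ` {0..t}" "x t \<in> x ` {0..t}" using t by auto
  then have "x ` {0..t} \<inter> S \<noteq> {}" "x ` {0..t} - S \<noteq> {}" using \<open>x 0 \<in> S\<close> \<open>x t \<notin> S\<close> by blast+
  ultimately have "x ` {0..t} \<inter> frontier S \<noteq> {}" by (rule connected_Int_frontier)
  then obtain s where s: "s \<in> {0..t}" "x s \<in> frontier S" by blast
  have dxs: "(x has_vector_derivative f r (x r)) (at r within {0..s})" if "r \<in> {0..s}" for r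
    by (rule has_vector_derivative_within_subset[OF dx]) (use that s t in auto)
  have "(\<lambda>r. x (s - r)) s \<in> frontier S"
  proof (rule tangent_cone_viability[where x = "\<lambda>r. x (s - r)" and f = "\<lambda>r y. - f (s - r) y" and a = 0 and b = s and L = L])
    show "0 \<le> L" using lip[of t] t by (auto simp: lipschitz_on_def)
    show "((\<lambda>r. x (s - r)) has_vector_derivative - f (s - r) (x (s - r))) (at r within {0..s})" if "r \<in> {0..s}" for r
      by (rule has_vector_derivative_time_reversal[OF dxs that])
    show "norm (- f (s - r) (x (s - r)) - - f (s - r) y) \<le> L * norm (x (s - r) - y)"
      if "r \<in> {0..s}" for r y
      using lipschitz_onD[OF lip[of "s - r"], of y "x (s - r)"] that s t
      by (simp add: dist_norm norm_minus_commute)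
    show "- f (s - r) y \<in> tangent_cone (frontier S) y" if "r \<in> {0..s}" "y \<in> frontier S" for r y
      using tan[of "s - r" y] that s t by auto
  qed (use s in auto)
  then have "x 0 \<in> frontier S" by simp
  then show False using \<open>open S\<close> \<open>x 0 \<in> S\<close> by (simp add: frontier_def interior_open)
qed

text \<open>Solutions are built for the extended field \<open>w\<close>, where Picard applies, and
  never leave \<open>\<Omega>\<close>, where \<open>w\<close> is \<open>v\<close>. Viability argues
  in reversed time, so forward invariance uses \<open>- v\<close> in the tangent cone and
  surjectivity, being forward motion of the reversed field, uses \<open>+ v\<close>.\<close>

lemma domain_flow:
  fixes \<Omega> :: "(real ^ 3) set"
  assumes "bounded \<Omega>" "open \<Omega>" "\<Omega> \<noteq> {}" and reg: "velocity_regular \<Omega> v" and tan: "velocity_tangential \<Omega> v"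
  obtains X K where "\<And>\<xi>. X 0 \<xi> = \<xi>" "\<And>t \<xi>. \<lbrakk>0 \<le> t; \<xi> \<in> \<Omega>\<rbrakk> \<Longrightarrow> X t \<xi> \<in> \<Omega>"
    "\<And>t \<xi>. \<lbrakk>0 \<le> t; \<xi> \<in> \<Omega>\<rbrakk> \<Longrightarrow> ((\<lambda>t. X t \<xi>) has_vector_derivative v t (X t \<xi>)) (at t within {0..})"
    "\<And>t x. \<lbrakk>0 \<le> t; x \<in> \<Omega>\<rbrakk> \<Longrightarrow> \<exists>\<xi>\<in>\<Omega>. X t \<xi> = x"
    "\<And>t \<xi> \<xi>'. \<lbrakk>0 \<le> t; \<xi> \<in> \<Omega>; \<xi>' \<in> \<Omega>\<rbrakk> \<Longrightarrow> norm (\<xi> - \<xi>') \<le> exp (K * t) * norm (X t \<xi> - X t \<xi>')"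
    "\<And>t \<xi>. \<lbrakk>0 \<le> t; \<xi> \<in> \<Omega>\<rbrakk> \<Longrightarrow> flow \<Omega> v t 0 \<xi> = X t \<xi>"
proof -
  obtain L where L: "\<And>t. 0 \<le> t \<Longrightarrow> L-lipschitz_on (closure \<Omega>) (v t)"
    and cv: "continuous_on ({0..} \<times> closure \<Omega>) (\<lambda>(t, x). v t x)"
    using reg by (auto simp: velocity_regular_def)
  have "compact (closure \<Omega>)" using \<open>bounded \<Omega>\<close> by simp
  moreover have "closure \<Omega> \<noteq> {}" using \<open>\<Omega> \<noteq> {}\<close> by simp
  ultimately obtain w M where cw: "continuous_on ({0..} \<times> UNIV) (\<lambda>(t, x). w t x)"
    and lipw: "\<And>t. 0 \<le> t \<Longrightarrow> M-lipschitz_on UNIV (w t)"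
    and wv: "\<And>t x. \<lbrakk>0 \<le> t; x \<in> closure \<Omega>\<rbrakk> \<Longrightarrow> w t x = v t x"
    using mcshane_extension[OF _ _ cv L] by metis
  have "0 \<le> M" using lipw[of 0] by (simp add: lipschitz_on_def)
  have lip: "norm (w t x - w t y) \<le> M * norm (x - y)" if "0 \<le> t" for t x y
    using lipschitz_onD[OF lipw[OF that], of x y] by (simp add: dist_norm)
  have tanw: "w t y \<in> tangent_cone (frontier \<Omega>) y" "- w t y \<in> tangent_cone (frontier \<Omega>) y"
    if "0 \<le> t" "y \<in> frontier \<Omega>" for t y
    using tan that wv[OF that(1), of y] by (auto simp: velocity_tangential_def frontier_def)
  have ex: "\<exists>x. x 0 = \<xi> \<and> (\<forall>t\<ge>0. (x has_vector_derivative w t (x t)) (at t within {0..}))" for \<xi>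
  proof -
    have "\<exists>L. \<forall>t\<in>{0..T}. L-lipschitz_on UNIV (w t)" for T using lipw by (metis atLeastAtMost_iff)
    from picard_existence[OF cw this, of \<xi>] show ?thesis by blast
  qed
  obtain X' where X': "\<And>\<xi>. X' \<xi> 0 = \<xi> \<and> (\<forall>t\<ge>0. (X' \<xi> has_vector_derivative w t (X' \<xi> t)) (at t within {0..}))"
    using ex by metis
  define X where "X = (\<lambda>t \<xi>. X' \<xi> t)"
  have X0: "X 0 \<xi> = \<xi>" for \<xi> by (simp add: X_def X')
  have dX: "((\<lambda>t. X t \<xi>) has_vector_derivative w t (X t \<xi>)) (at t within {0..})" if "0 \<le> t" for t \<xi>
    using X' that by (simp add: X_def)
  have dXI: "((\<lambda>t. X t \<xi>) has_vector_derivative w s (X s \<xi>)) (at s within {0..t})" if "s \<in> {0..t}" for s t \<xi>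
    by (rule has_vector_derivative_within_subset[OF dX]) (use that in auto)
  have XO: "X t \<xi> \<in> \<Omega>" if "0 \<le> t" "\<xi> \<in> \<Omega>" for t \<xi>
    by (rule viable_open[OF \<open>open \<Omega>\<close> _ dXI[of _ t] lipw]) (use that tanw X0 in auto)
  have uniq: "X t \<xi> = z t"
    if "0 \<le> t" "z 0 = \<xi>" and dz: "\<And>s. s \<in> {0..t} \<Longrightarrow> (z has_vector_derivative w s (z s)) (at s within {0..t})"
    for t \<xi> z
  proof -
    have "norm (X t \<xi> - z t) \<le> exp ((M + 1) * (t - 0)) * norm (X 0 \<xi> - z 0)"
      by (rule gronwall_lipschitz(1)[OF \<open>0 \<le> t\<close> \<open>0 \<le> M\<close> dXI dz]) (auto intro: lip)
    then show ?thesis using \<open>z 0 = \<xi>\<close> X0 by simp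
  qed
  have surj: "\<exists>\<xi>\<in>\<Omega>. X t \<xi> = x" if t: "0 \<le> t" and x: "x \<in> \<Omega>" for t x
  proof -
    \<comment> \<open>Reversed field starting at the target. Truncating the time at 0 keeps
      \<open>w\<close> at times where its Lipschitz bound holds; on \<open>{0..t}\<close> nothing
      changes.\<close>
    define g where "g = (\<lambda>r y. - w (max 0 (t - r)) y)"
    have "continuous_on ({0..} \<times> UNIV) (\<lambda>p. (\<lambda>(t, x). w t x) (max 0 (t - fst p), snd p))"
      by (rule continuous_on_compose2[OF cw]) (auto intro!: continuous_intros)
    then have cg: "continuous_on ({0..} \<times> UNIV) (\<lambda>(r, y). g r y)"
      by (simp add: g_def case_prod_unfold continuous_on_minus)
    have lipg: "M-lipschitz_on UNIV (g r)" for r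
      unfolding g_def using lipw[of "max 0 (t - r)"] by (simp add: lipschitz_on_minus)
    have "\<exists>L. \<forall>r\<in>{0..T}. L-lipschitz_on UNIV (g r)" for T using lipg by blast
    from picard_existence[OF cg this, of x]
    obtain y where y: "y 0 = x" "\<And>r. 0 \<le> r \<Longrightarrow> (y has_vector_derivative g r (y r)) (at r within {0..})"
      by blast
    have dy: "(y has_vector_derivative g r (y r)) (at r within {0..t})" if "r \<in> {0..t}" for r
      by (rule has_vector_derivative_within_subset[OF y(2)]) (use that in auto)
    have "y t \<in> \<Omega>"
      by (rule viable_open[OF \<open>open \<Omega>\<close> _ dy lipg]) (use t x y tanw in \<open>auto simp: g_def\<close>)
    moreover have "X t (y t) = y (t - t)"
    proof (rule uniq[OF t, where z = "\<lambda>r. y (t - r)"])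
      fix s assume s: "s \<in> {0..t}"
      have "((\<lambda>r. y (t - r)) has_vector_derivative - g (t - s) (y (t - s))) (at s within {0..t})"
        by (rule has_vector_derivative_time_reversal[OF dy s])
      then show "((\<lambda>r. y (t - r)) has_vector_derivative w s (y (t - s))) (at s within {0..t})"
        using s by (simp add: g_def)
    qed simp
    ultimately show ?thesis using y(1) by auto
  qed
  have inj: "norm (\<xi> - \<xi>') \<le> exp ((M + 1) * t) * norm (X t \<xi> - X t \<xi>')" if "0 \<le> t" for t \<xi> \<xi>'
  proof -
    have "norm (X 0 \<xi> - X 0 \<xi>') \<le> exp ((M + 1) * (t - 0)) * norm (X t \<xi> - X t \<xi>')"
      by (rule gronwall_lipschitz(2)[OF \<open>0 \<le> t\<close> \<open>0 \<le> M\<close> dXI dXI]) (auto intro: lip)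
    then show ?thesis by (simp add: X0)
  qed
  have dXv: "((\<lambda>t. X t \<xi>) has_vector_derivative v t (X t \<xi>)) (at t within {0..})" if "0 \<le> t" "\<xi> \<in> \<Omega>" for t \<xi>
  proof -
    have "X t \<xi> \<in> closure \<Omega>" using XO[OF that] closure_subset by blast
    then show ?thesis using dX[OF that(1), of \<xi>] wv[OF that(1)] by simp
  qed
  \<comment> \<open>Every competing solution curve stays in \<open>closure \<Omega>\<close>, where
    \<open>w = v\<close>; it therefore solves the extended equation, for which uniqueness
    holds.\<close>
  have fl: "flow \<Omega> v t 0 \<xi> = X t \<xi>" if "0 \<le> t" "\<xi> \<in> \<Omega>" for t \<xi>
    unfolding flow_def
  proof (rule the_equality)
    have "solution_curve \<Omega> v (\<lambda>t. X t \<xi>)"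
      using dXv XO that closure_subset unfolding solution_curve_def by blast
    then show "\<exists>x. solution_curve \<Omega> v x \<and> x 0 = \<xi> \<and> x t = X t \<xi>" using X0 by blast
    fix y assume "\<exists>x. solution_curve \<Omega> v x \<and> x 0 = \<xi> \<and> x t = y"
    then obtain x where x: "solution_curve \<Omega> v x" "x 0 = \<xi>" "x t = y" by blast
    have "X t \<xi> = x t"
    proof (rule uniq[OF \<open>0 \<le> t\<close>, where z = x])
      fix s assume "s \<in> {0..t}"
      then have "(x has_vector_derivative w s (x s)) (at s within {0..})"
        using x(1) wv by (auto simp: solution_curve_def)
      then show "(x has_vector_derivative w s (x s)) (at s within {0..t})"
        by (rule has_vector_derivative_within_subset) auto
    qed (rule x(2))
    with x(3) show "y = X t \<xi>" by simp
  qed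
  show thesis by (rule that[of X "M + 1"]) (use X0 XO dXv surj inj fl in auto)
qed

text \<open>Along the flow, \<open>P' = - (D v)\<^sup>T P\<close> transports conormals: \<open>P \<bullet> D X w\<close> is constant in time, so a
  conormal annihilating all \<open>D y0 w\<close> initially keeps annihilating \<open>D (X \<circ> y0) w\<close>.\<close>
lemma conormal_transport:
  fixes \<Omega> :: "(real ^ 3) set" and n y0 :: "real ^ 3 \<Rightarrow> real ^ 3"
  assumes reg: "velocity_regular \<Omega> v" and "open \<Omega>" "open U"
    and X0: "\<And>\<xi>. X 0 \<xi> = \<xi>" and X\<Omega>: "\<And>t \<xi>. \<lbrakk>0 \<le> t; \<xi> \<in> \<Omega>\<rbrakk> \<Longrightarrow> X t \<xi> \<in> \<Omega>"
    and dX: "\<And>t \<xi>. \<lbrakk>0 \<le> t; \<xi> \<in> \<Omega>\<rbrakk> \<Longrightarrow> ((\<lambda>t. X t \<xi>) has_vector_derivative v t (X t \<xi>)) (at t within {0..})"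
    and n: "C1_deriv U n Dn" and y0: "C1_deriv U y0 Dy0"
    and nz: "\<And>z. z \<in> U \<Longrightarrow> n z \<noteq> 0" and y0\<Omega>: "\<And>z. z \<in> U \<Longrightarrow> y0 z \<in> \<Omega>"
    and ortho: "\<And>z w. z \<in> U \<Longrightarrow> n z \<bullet> Dy0 z w = 0"
  obtains P DP DX where "C1_deriv ({0..} \<times> U) P DP" "\<And>t z. \<lbrakk>0 \<le> t; z \<in> U\<rbrakk> \<Longrightarrow> P (t, z) \<noteq> 0"
    "\<And>z. z \<in> U \<Longrightarrow> P (0, z) = n z"
    "C1_deriv ({0..} \<times> U) (\<lambda>(t, z). X t (y0 z)) DX"
    "\<And>t z dt dz. \<lbrakk>0 \<le> t; z \<in> U\<rbrakk> \<Longrightarrow>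
      P (t, z) \<bullet> DX (t, z) (dt, dz) = dt * (P (t, z) \<bullet> v t (X t (y0 z)))"
    "\<And>t z w. \<lbrakk>0 \<le> t; z \<in> U; DX (t, z) (0, w) = 0\<rbrakk> \<Longrightarrow> Dy0 z w = 0"
proof -
  define p where "p = (\<lambda>i t x. partial_deriv i (v t) x)"
  define q where "q = (\<lambda>i j t x. partial_deriv j (partial_deriv i (v t)) x)"
  \<comment> \<open>\<open>A\<close> is the spatial Jacobian of \<open>v\<close>, assembled from its
    columns, and \<open>B\<close> is minus its transpose.\<close>
  define A where "A = (\<lambda>t x a. \<Sum>i\<in>UNIV. (a $ i) *\<^sub>R p i t x)"
  define B where "B = (\<lambda>t x b. - (\<Sum>i\<in>UNIV. (p i t x \<bullet> b) *\<^sub>R axis i 1) :: real ^ 3)"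
  define f where "f = (\<lambda>t s. (v t (fst s), B t (fst s) (snd s)))"
  \<comment> \<open>Linearization of \<open>f\<close> in the state: in the second component the
    product rule brings in the second partial derivatives \<open>q\<close> of
    \<open>v\<close>.\<close>
  define D where "D = (\<lambda>t s w. (A t (fst s) (fst w),
      - (\<Sum>i\<in>UNIV. (p i t (fst s) \<bullet> snd w + (\<Sum>j\<in>UNIV. (fst w $ j) *\<^sub>R q i j t (fst s)) \<bullet> snd s) *\<^sub>R axis i 1) :: real ^ 3))"
  have cv: "continuous_on ({0..} \<times> \<Omega>) (\<lambda>x. v (fst x) (snd x))"
    using reg closure_subset[of \<Omega>] unfolding velocity_regular_def case_prod_unfold
    by (meson Sigma_mono continuous_on_subset order_refl)
  have cp: "continuous_on ({0..} \<times> \<Omega>) (\<lambda>x. p i (fst x) (snd x))" for i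
    using reg unfolding velocity_regular_def case_prod_unfold p_def by blast
  have cq: "continuous_on ({0..} \<times> \<Omega>) (\<lambda>x. q i j (fst x) (snd x))" for i j
    using reg unfolding velocity_regular_def case_prod_unfold q_def by blast
  have fixt: "continuous_on \<Omega> (\<lambda>x. g t x)"
    if "continuous_on ({0..} \<times> \<Omega>) (\<lambda>x. g (fst x) (snd x))" "0 \<le> t" for g :: "real \<Rightarrow> real ^ 3 \<Rightarrow> real ^ 3" and t
  proof -
    have "continuous_on \<Omega> (\<lambda>x. (t, x))" by (intro continuous_intros)
    then show ?thesis using continuous_on_compose2[OF that(1), of \<Omega> "\<lambda>x. (t, x)"] that(2) by auto
  qed
  have dv: "(v t has_derivative A t x) (at x)" if "0 \<le> t" "x \<in> \<Omega>" for t x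
    unfolding A_def
  proof (rule has_derivative_of_partials[OF \<open>open \<Omega>\<close> \<open>x \<in> \<Omega>\<close>])
    show "((\<lambda>h. v t (y + h *\<^sub>R axis i 1)) has_vector_derivative p i t y) (at 0)" if "y \<in> \<Omega>" for i y
      using reg that \<open>0 \<le> t\<close>
      unfolding velocity_regular_def partially_differentiable_def p_def partial_deriv_def
      by (simp add: vector_derivative_works)
    show "continuous_on \<Omega> (p i t)" for i by (rule fixt[OF cp \<open>0 \<le> t\<close>])
  qed
  have dp: "(p i t has_derivative (\<lambda>w. \<Sum>j\<in>UNIV. (w $ j) *\<^sub>R q i j t x)) (at x)" if "0 \<le> t" "x \<in> \<Omega>" for i t x
  proof (rule has_derivative_of_partials[OF \<open>open \<Omega>\<close> \<open>x \<in> \<Omega>\<close>])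
    show "((\<lambda>h. p i t (y + h *\<^sub>R axis j 1)) has_vector_derivative q i j t y) (at 0)" if "y \<in> \<Omega>" for j y
      using reg that \<open>0 \<le> t\<close>
      unfolding velocity_regular_def partially_differentiable_def p_def q_def partial_deriv_def
      by (simp add: vector_derivative_works)
    show "continuous_on \<Omega> (q i j t)" for j by (rule fixt[OF cq \<open>0 \<le> t\<close>])
  qed
  \<comment> \<open>The duality of \<open>A\<close> and \<open>B\<close>, on which conservation of
    the pairing rests.\<close>
  have BA: "B t x b \<bullet> a = - (b \<bullet> A t x a)" for t x a b
    by (simp add: A_def B_def inner_sum_left inner_sum_right inner_axis inner_axis' inner_commute mult.commute)
  have bound: "\<exists>M\<ge>0. \<forall>t\<in>{0..T}. \<forall>w. norm (A t (X t \<xi>) w) \<le> M * norm w \<and> norm (B t (X t \<xi>) w) \<le> M * norm w"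
    if \<xi>: "\<xi> \<in> \<Omega>" for \<xi> T
  proof -
    have cX: "continuous_on {0..T} (\<lambda>t. X t \<xi>)"
      by (rule continuous_on_subset[of "{0..}"])
        (simp_all add: continuous_on_eq_continuous_within has_vector_derivative_continuous[OF dX[OF _ \<xi>]])
    have "\<exists>M. \<forall>t\<in>{0..T}. norm (p i t (X t \<xi>)) \<le> M" for i
    proof -
      have "continuous_on {0..T} (\<lambda>t. (t, X t \<xi>))" by (intro continuous_on_Pair continuous_on_id cX)
      moreover have "(\<lambda>t. (t, X t \<xi>)) ` {0..T} \<subseteq> {0..} \<times> \<Omega>" using X\<Omega> \<xi> by auto
      ultimately have "continuous_on {0..T} (\<lambda>t. p i t (X t \<xi>))"
        using continuous_on_compose2[OF cp] by fastforce
      then have "bounded ((\<lambda>t. p i t (X t \<xi>)) ` {0..T})"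
        by (intro compact_imp_bounded compact_continuous_image compact_Icc)
      then show ?thesis unfolding bounded_iff by blast
    qed
    then obtain M where M: "\<And>i t. t \<in> {0..T} \<Longrightarrow> norm (p i t (X t \<xi>)) \<le> M i" by metis
    have "norm (A t (X t \<xi>) w) \<le> (\<Sum>i\<in>UNIV. \<bar>M i\<bar>) * norm w" "norm (B t (X t \<xi>) w) \<le> (\<Sum>i\<in>UNIV. \<bar>M i\<bar>) * norm w"
      if "t \<in> {0..T}" for t w
    proof -
      have "norm ((w $ i) *\<^sub>R p i t (X t \<xi>)) \<le> \<bar>M i\<bar> * norm w" for i
      proof -
        have "norm (p i t (X t \<xi>)) \<le> \<bar>M i\<bar>" using M[OF that, of i] by linarith
        then have "norm (p i t (X t \<xi>)) * \<bar>w $ i\<bar> \<le> \<bar>M i\<bar> * norm w"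
          by (intro mult_mono component_le_norm_cart) auto
        then show ?thesis by (simp add: mult.commute)
      qed
      then show "norm (A t (X t \<xi>) w) \<le> (\<Sum>i\<in>UNIV. \<bar>M i\<bar>) * norm w"
        unfolding A_def sum_distrib_right by (intro sum_norm_le)
      have "norm ((p i t (X t \<xi>) \<bullet> w) *\<^sub>R (axis i 1 :: real ^ 3)) \<le> \<bar>M i\<bar> * norm w" for i
      proof -
        have "\<bar>p i t (X t \<xi>) \<bullet> w\<bar> \<le> norm (p i t (X t \<xi>)) * norm w" by (rule Cauchy_Schwarz_ineq2)
        also have "\<dots> \<le> \<bar>M i\<bar> * norm w" using M[OF that, of i] by (intro mult_right_mono) auto
        finally show ?thesis by (simp add: norm_axis_1)
      qed
      then show "norm (B t (X t \<xi>) w) \<le> (\<Sum>i\<in>UNIV. \<bar>M i\<bar>) * norm w"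
        unfolding B_def sum_distrib_right norm_minus_cancel by (intro sum_norm_le)
    qed
    then show ?thesis by (intro exI[of _ "\<Sum>i\<in>UNIV. \<bar>M i\<bar>"]) (auto intro: sum_nonneg)
  qed
  have Bdiff: "B t x b - B t x c = B t x (b - c)" for t x b c
    by (simp add: B_def inner_diff_right scaleR_diff_left sum_subtractf)
  have "\<exists>P. P 0 = n z \<and> (\<forall>t\<ge>0. (P has_vector_derivative B t (X t (y0 z)) (P t)) (at t within {0..}))"
    if z: "z \<in> U" for z
  proof -
    have cX: "continuous_on {0..} (\<lambda>t. X t (y0 z))"
      by (simp add: continuous_on_eq_continuous_within has_vector_derivative_continuous[OF dX[OF _ y0\<Omega>[OF z]]])
    have cX': "continuous_on ({0..} \<times> (UNIV :: (real ^ 3) set)) (\<lambda>s. (fst s, X (fst s) (y0 z)))"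
      by (intro continuous_on_Pair continuous_on_fst continuous_on_id continuous_on_compose2[OF cX]) auto
    have "(\<lambda>s. (fst s, X (fst s) (y0 z))) ` ({0..} \<times> (UNIV :: (real ^ 3) set)) \<subseteq> {0..} \<times> \<Omega>"
      using X\<Omega> y0\<Omega>[OF z] by auto
    from continuous_on_compose2[OF cp cX' this]
    have "continuous_on ({0..} \<times> (UNIV :: (real ^ 3) set)) (\<lambda>s. p i (fst s) (X (fst s) (y0 z)))" for i
      by simp
    then have c: "continuous_on ({0..} \<times> UNIV) (\<lambda>(t, b). B t (X t (y0 z)) b)"
      unfolding B_def case_prod_unfold
      by (intro continuous_intros)
    have l: "\<exists>L. \<forall>t\<in>{0..T}. L-lipschitz_on UNIV (B t (X t (y0 z)))" for T
    proof -
      obtain M where M: "0 \<le> M" "\<And>t w. t \<in> {0..T} \<Longrightarrow> norm (B t (X t (y0 z)) w) \<le> M * norm w"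
        using bound[OF y0\<Omega>[OF z], of T] by blast
      then have "M-lipschitz_on UNIV (B t (X t (y0 z)))" if "t \<in> {0..T}" for t
        using that by (intro lipschitz_onI) (simp_all add: dist_norm Bdiff)
      then show ?thesis by blast
    qed
    from picard_existence[OF c l, of "n z"] show ?thesis by blast
  qed
  then obtain Q where Q0: "\<And>z. z \<in> U \<Longrightarrow> Q z 0 = n z"
    and dQ: "\<And>z t. \<lbrakk>z \<in> U; 0 \<le> t\<rbrakk> \<Longrightarrow> (Q z has_vector_derivative B t (X t (y0 z)) (Q z t)) (at t within {0..})"
    by metis
  \<comment> \<open>Flow and conormal are treated as one system, so that a single dependence theorem
    differentiates both with respect to the label.\<close>
  define Y where "Y = (\<lambda>t z. (X t (y0 z), Q z t))"
  define E where "E = (\<lambda>z w. (Dy0 z w, Dn z w))"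
  interpret parametric_flow f D "\<Omega> \<times> UNIV" U Y E
  proof
    show "open (\<Omega> \<times> (UNIV :: (real ^ 3) set))" using \<open>open \<Omega>\<close> by (simp add: open_Times)
    show "open U" by fact
    have c2: "continuous_on ({0..} \<times> \<Omega> \<times> (UNIV :: (real ^ 3) set)) (\<lambda>x. g (fst x) (fst (snd x)))"
      if "continuous_on ({0..} \<times> \<Omega>) (\<lambda>x. g (fst x) (snd x))" for g :: "real \<Rightarrow> real ^ 3 \<Rightarrow> real ^ 3"
    proof -
      have "continuous_on ({0..} \<times> \<Omega> \<times> (UNIV :: (real ^ 3) set)) (\<lambda>x. (fst x, fst (snd x)))"
        by (intro continuous_intros)
      from continuous_on_compose2[OF that this] show ?thesis by force
    qed
    show "continuous_on ({0..} \<times> \<Omega> \<times> UNIV) (\<lambda>(t, x). f t x)"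
      unfolding f_def B_def case_prod_unfold by (intro continuous_intros c2 cv cp)
    show "continuous_on ({0..} \<times> \<Omega> \<times> UNIV) (\<lambda>(t, x). D t x w)" for w
      unfolding D_def A_def case_prod_unfold by (intro continuous_intros c2 cp cq)
    show "(f t has_derivative D t x) (at x)" if "0 \<le> t" "x \<in> \<Omega> \<times> UNIV" for t x
    proof -
      have x: "fst x \<in> \<Omega>" using that(2) by auto
      show ?thesis unfolding f_def D_def B_def
        by (intro has_derivative_Pair has_derivative_minus has_derivative_sum has_derivative_scaleR_left
            has_derivative_inner has_derivative_snd has_derivative_ident
            has_derivative_compose[OF has_derivative_fst[OF has_derivative_ident] dv[OF that(1) x]]
            has_derivative_compose[OF has_derivative_fst[OF has_derivative_ident] dp[OF that(1) x]])
    qed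
    show "Y t z \<in> \<Omega> \<times> UNIV" if "0 \<le> t" "z \<in> U" for t z using that X\<Omega> y0\<Omega> by (simp add: Y_def)
    show "((\<lambda>t. Y t z) has_vector_derivative f t (Y t z)) (at t within {0..})" if "0 \<le> t" "z \<in> U" for t z
      unfolding Y_def f_def fst_conv snd_conv
      by (intro has_vector_derivative_Pair dX dQ that y0\<Omega>)
    have "C1_deriv U (\<lambda>z. (y0 z, n z)) E" unfolding E_def
      by (rule C1_derivI)
        (intro has_derivative_Pair C1_derivD(1)[OF y0] C1_derivD(1)[OF n]
          continuous_on_Pair C1_derivD(2)[OF y0] C1_derivD(2)[OF n], (assumption+)?)+
    moreover have "(y0 z, n z) = Y 0 z" if "z \<in> U" for z using that by (simp add: Y_def X0 Q0)
    moreover have "(Y 0 has_derivative E') (at z within U)" if "((\<lambda>z. (y0 z, n z)) has_derivative E') (at z within U)" "z \<in> U" for z E'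
      by (rule has_derivative_transform[OF that(2) _ that(1)]) (simp add: Y_def X0 Q0)
    ultimately show "C1_deriv U (Y 0) E" unfolding C1_deriv_def by blast
  qed
  obtain m where m0: "\<And>z w. z \<in> U \<Longrightarrow> m 0 z w = E z w"
    and dm: "\<And>t z w. \<lbrakk>0 \<le> t; z \<in> U\<rbrakk> \<Longrightarrow>
      ((\<lambda>t. m t z w) has_vector_derivative D t (Y t z) (m t z w)) (at t within {0..})"
    and YC: "C1_deriv ({0..} \<times> U) (\<lambda>(t, z). Y t z) (\<lambda>(t, z) (dt, dz). dt *\<^sub>R f t (Y t z) + m t z dz)"
    using C1_dependence by blast
  define P where "P = (\<lambda>(t, z). Q z t)"
  define DY where "DY = (\<lambda>(t, z) (dt, dz). dt *\<^sub>R f t (Y t z) + m t z dz)"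
  have XC: "C1_deriv ({0..} \<times> U) (\<lambda>(t, z). X t (y0 z)) (\<lambda>s w. fst (DY s w))"
  proof -
    have "C1_deriv ({0..} \<times> U) (\<lambda>s. fst (case s of (t, z) \<Rightarrow> Y t z)) (\<lambda>s w. fst (DY s w))"
      using YC unfolding DY_def
      by (intro C1_derivI has_derivative_fst continuous_on_fst) (auto simp: C1_deriv_def)
    then show ?thesis by (simp add: Y_def case_prod_unfold)
  qed
  have PC: "C1_deriv ({0..} \<times> U) P (\<lambda>s w. snd (DY s w))"
  proof -
    have "C1_deriv ({0..} \<times> U) (\<lambda>s. snd (case s of (t, z) \<Rightarrow> Y t z)) (\<lambda>s w. snd (DY s w))"
      using YC unfolding DY_def
      by (intro C1_derivI has_derivative_snd continuous_on_snd) (auto simp: C1_deriv_def)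
    then show ?thesis by (simp add: Y_def P_def case_prod_unfold)
  qed
  have sub: "(g has_vector_derivative g') (at s within {0..t})"
    if "(g has_vector_derivative g') (at s within {0..})" for g :: "real \<Rightarrow> real ^ 3" and g' s t
    by (rule has_vector_derivative_within_subset[OF that]) auto
  have da: "((\<lambda>t. fst (m t z w)) has_vector_derivative A t (X t (y0 z)) (fst (m t z w))) (at t within {0..})"
    if "0 \<le> t" "z \<in> U" for t z w
    using bounded_linear.has_vector_derivative[OF bounded_linear_fst dm[OF that, of w]]
    by (simp add: D_def Y_def)
  \<comment> \<open>The time derivative of the pairing is
    \<open>Q \<bullet> A a + B Q \<bullet> a = 0\<close>; initially it is
    \<open>n z \<bullet> Dy0 z w\<close>, which vanishes by \<open>ortho\<close>.\<close>
  have cons: "Q z t \<bullet> fst (m t z w) = 0" if t: "0 \<le> t" and z: "z \<in> U" for t z w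
  proof -
    have "((\<lambda>t. Q z t \<bullet> fst (m t z w)) has_derivative (\<lambda>h. 0)) (at s within {0..})" if "s \<in> {0..}" for s
    proof -
      have s: "0 \<le> s" using that by simp
      have "((\<lambda>t. Q z t \<bullet> fst (m t z w)) has_vector_derivative
          (Q z s \<bullet> A s (X s (y0 z)) (fst (m s z w)) + B s (X s (y0 z)) (Q z s) \<bullet> fst (m s z w))) (at s within {0..})"
        by (rule bounded_bilinear.has_vector_derivative[OF bounded_bilinear_inner dQ[OF z s] da[OF s z]])
      then show ?thesis by (simp add: BA has_vector_derivative_def)
    qed
    then have "\<exists>c. \<forall>s\<in>{0..}. Q z s \<bullet> fst (m s z w) = c"
      by (intro has_derivative_zero_constant) auto
    then have "Q z t \<bullet> fst (m t z w) = Q z 0 \<bullet> fst (m 0 z w)" using t by fastforce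
    also have "\<dots> = 0" using z by (simp add: Q0 m0 E_def ortho)
    finally show ?thesis .
  qed
  \<comment> \<open>Both linear equations have bounded coefficients along the trajectory, so a
    solution that is zero at time \<open>t\<close> was zero initially. With \<open>B\<close> this
    keeps \<open>P\<close> nonzero; with \<open>A\<close> it carries the kernel condition back to
    \<open>Dy0\<close>.\<close>
  have backward: "a 0 = 0" if z: "z \<in> U" and t: "0 \<le> t" and C: "C = A \<or> C = B"
    and a: "\<And>s. 0 \<le> s \<Longrightarrow> (a has_vector_derivative C s (X s (y0 z)) (a s)) (at s within {0..})" and "a t = 0"
    for a t z C
  proof -
    obtain M where M: "0 \<le> M" "\<And>s w. s \<in> {0..t} \<Longrightarrow> norm (A s (X s (y0 z)) w) \<le> M * norm w"
        "\<And>s w. s \<in> {0..t} \<Longrightarrow> norm (B s (X s (y0 z)) w) \<le> M * norm w"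
      using bound[OF y0\<Omega>[OF z], of t] by blast
    have "norm (a 0 - (\<lambda>_. 0) (0::real)) \<le> exp ((M + 1) * (t - 0)) * norm (a t - (\<lambda>_. 0) t)"
    proof (rule gronwall_lipschitz(2)[OF t M(1)])
      show "(a has_vector_derivative C s (X s (y0 z)) (a s)) (at s within {0..t})" if "s \<in> {0..t}" for s
        using that by (intro sub a) auto
      show "((\<lambda>_. 0) has_vector_derivative 0) (at s within {0..t})" for s by simp
      show "norm (C s (X s (y0 z)) (a s) - 0) \<le> M * norm (a s - 0)" if "s \<in> {0..t}" for s
        using C M(2,3)[OF that] by auto
    qed
    with \<open>a t = 0\<close> show ?thesis by simp
  qed
  show thesis
  proof (rule that[of P "\<lambda>s w. snd (DY s w)" "\<lambda>s w. fst (DY s w)"])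
    show "P (t, z) \<noteq> 0" if "0 \<le> t" "z \<in> U" for t z
      using backward[OF that(2,1) disjI2[OF refl] dQ[OF that(2)]] nz[OF that(2)] Q0[OF that(2)] by (auto simp: P_def)
    show "P (0, z) = n z" if "z \<in> U" for z using Q0[OF that] by (simp add: P_def)
    show "P (t, z) \<bullet> fst (DY (t, z) (dt, dz)) = dt * (P (t, z) \<bullet> v t (X t (y0 z)))" if "0 \<le> t" "z \<in> U" for t z dt dz
      using cons[OF that] by (simp add: P_def DY_def f_def Y_def inner_add_right)
    show "Dy0 z w = 0" if "0 \<le> t" "z \<in> U" "fst (DY (t, z) (0, w)) = 0" for t z w
    proof -
      have "fst (m t z w) = 0" using that(3) by (simp add: DY_def)
      from backward[OF that(2,1) disjI1[OF refl] da[OF _ that(2)] this]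
      have "fst (m 0 z w) = 0" .
      then show ?thesis using that(2) by (simp add: m0 E_def)
    qed
  qed (rule PC XC)+
qed

section \<open>The tubular neighbourhood and the distance function\<close>

text \<open>Turns injectivity of \<open>G (t, _)\<close> and of its spatial derivative on
  \<open>\<Sigma>\<close> into an invertible space-time chart near
  \<open>{0..} \<times> \<Sigma>\<close>, although this set is unbounded in time and ends at
  \<open>t = 0\<close>.\<close>

lemma spacetime_tube:
  fixes G :: "real \<times> 'a::euclidean_space \<Rightarrow> 'a"
  assumes "open U" "open \<Omega>" and \<Sigma>: "compact \<Sigma>" "\<Sigma> \<subseteq> U"
    and G: "C1_deriv ({0..} \<times> U) G DG"
    and G\<Omega>: "\<And>t \<sigma>. \<lbrakk>0 \<le> t; \<sigma> \<in> \<Sigma>\<rbrakk> \<Longrightarrow> G (t, \<sigma>) \<in> \<Omega>"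
    and inj: "\<And>t \<sigma> \<sigma>'. \<lbrakk>0 \<le> t; \<sigma> \<in> \<Sigma>; \<sigma>' \<in> \<Sigma>; G (t, \<sigma>) = G (t, \<sigma>')\<rbrakk> \<Longrightarrow> \<sigma> = \<sigma>'"
    and ker: "\<And>t \<sigma> w. \<lbrakk>0 \<le> t; \<sigma> \<in> \<Sigma>; DG (t, \<sigma>) (0, w) = 0\<rbrakk> \<Longrightarrow> w = 0"
  obtains W \<Theta> g Dg \<epsilon> where "W \<subseteq> {0..} \<times> U" "{0..} \<times> \<Sigma> \<subseteq> W"
    "\<And>s t z. \<lbrakk>(t, z) \<in> W; 0 \<le> s; s \<le> t\<rbrakk> \<Longrightarrow> (s, z) \<in> W"
    "\<Theta> = (\<lambda>p. (fst p, G p)) ` W"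
    "openin (top_of_set ({0..} \<times> UNIV)) \<Theta>" "\<Theta> \<subseteq> {0..} \<times> \<Omega>"
    "C1_deriv \<Theta> g Dg" "\<And>t z. (t, z) \<in> W \<Longrightarrow> g (t, G (t, z)) = z"
    "\<And>t z dt dx. (t, z) \<in> W \<Longrightarrow> DG (t, z) (dt, Dg (t, G (t, z)) (dt, dx)) = dx"
    "\<And>t. 0 \<le> t \<Longrightarrow> 0 < \<epsilon> t" "antimono_on {0..} \<epsilon>"
    "\<And>t \<sigma> y. \<lbrakk>0 \<le> t; \<sigma> \<in> \<Sigma>; y \<in> ball (G (t, \<sigma>)) (\<epsilon> t)\<rbrakk> \<Longrightarrow> (t, y) \<in> \<Theta>"
proof -
  obtain H DH where H: "C1_deriv (UNIV \<times> U) H DH"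
    and HG: "\<And>t z. \<lbrakk>0 \<le> t; z \<in> U\<rbrakk> \<Longrightarrow> H (t, z) = G (t, z)"
    and DHG: "\<And>t z. \<lbrakk>0 \<le> t; z \<in> U\<rbrakk> \<Longrightarrow> DH (t, z) = DG (t, z)"
    using C1_deriv_reflect[OF G] by blast
  \<comment> \<open>Keeping time as a coordinate makes domain and range equidimensional, and reduces
    injectivity of \<open>DF\<close> to the spatial kernel condition.\<close>
  define F where "F = (\<lambda>p. (fst p :: real, H p))"
  define DF where "DF = (\<lambda>p w. (fst w :: real, DH p w))"
  have FU: "C1_deriv (UNIV \<times> U) F DF"
    unfolding F_def DF_def
    by (rule C1_derivI) (intro has_derivative_Pair has_derivative_fst has_derivative_ident C1_derivD(1)[OF H]
        continuous_on_Pair continuous_on_const C1_derivD(2)[OF H], assumption?)+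
  define V where "V = (UNIV \<times> U) \<inter> H -` \<Omega>"
  have "open V" unfolding V_def
    by (rule continuous_open_preimage[OF C1_derivD(4)[OF H]]) (use \<open>open U\<close> \<open>open \<Omega>\<close> in \<open>auto intro: open_Times\<close>)
  have F: "C1_deriv V F DF" by (rule C1_deriv_subset[OF FU]) (auto simp: V_def)
  define K where "K = (\<lambda>n::nat. {0..real n} \<times> \<Sigma>)"
  have cK: "compact (K n)" for n unfolding K_def by (intro compact_Times \<Sigma>) simp
  have KV: "K n \<subseteq> V" for n
    using \<Sigma>(2) G\<Omega> by (auto simp: K_def V_def HG)
  have "inj_on F (K n)" for n
    using \<Sigma>(2) by (intro inj_onI) (auto simp: K_def F_def HG subset_eq intro: inj)
  moreover have "inj (DF p)" if "p \<in> K n" for p n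
  proof -
    obtain t \<sigma> where p: "p = (t, \<sigma>)" "0 \<le> t" "\<sigma> \<in> \<Sigma>" using \<open>p \<in> K n\<close> by (auto simp: K_def)
    have lin: "linear (DF p)"
      using KV \<open>p \<in> K n\<close> by (intro bounded_linear.linear C1_derivD(3)[OF F]) blast
    have "w = 0" if "DF p w = 0" for w
    proof -
      have "fst w = 0" "DG (t, \<sigma>) w = 0"
        using that p \<Sigma>(2) DHG[of t \<sigma>] by (auto simp: DF_def zero_prod_def)
      then show "w = 0" using ker[OF p(2,3), of "snd w"] by (cases w) (auto simp: zero_prod_def)
    qed
    then show ?thesis using linear_injective_0[OF lin] by blast
  qed
  ultimately have "\<exists>\<delta>>0. (\<Union>p\<in>K n. ball p \<delta>) \<subseteq> V \<and> inj_on F (\<Union>p\<in>K n. ball p \<delta>) \<and>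
      (\<forall>p\<in>(\<Union>p\<in>K n. ball p \<delta>). inj (DF p))" for n
    using compact_injective_neighborhood[OF \<open>open V\<close> F cK KV] by metis
  then obtain \<delta> where \<delta>: "\<And>n. 0 < \<delta> n" "\<And>n. (\<Union>p\<in>K n. ball p (\<delta> n)) \<subseteq> V"
    "\<And>n. inj_on F (\<Union>p\<in>K n. ball p (\<delta> n))"
    "\<And>n p. p \<in> (\<Union>p\<in>K n. ball p (\<delta> n)) \<Longrightarrow> inj (DF p)"
    by metis
  \<comment> \<open>The minimum makes the radii nonincreasing in \<open>n\<close>; the half allows
    for errors in time and in space together.\<close>
  define d where "d = (\<lambda>n. Min (\<delta> ` {..n}) / 2)"
  have d: "0 < d n" "2 * d n \<le> \<delta> n" for n using \<delta>(1) by (auto simp: d_def)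
  have dmono: "d m \<le> d n" if "n \<le> m" for n m
    unfolding d_def using that by (intro divide_right_mono Min_antimono) auto
  \<comment> \<open>The slab reaches time \<open>n\<close> with width \<open>d n\<close>. A point
    can lie in slabs of large index only with small width, so the union thins out as time
    grows.\<close>
  define B where "B = (\<lambda>n. {- d n<..<real n} \<times> (\<Union>\<sigma>\<in>\<Sigma>. ball \<sigma> (d n)))"
  define W' where "W' = (\<Union>n. B n)"
  have "open W'" unfolding W'_def B_def by (intro open_UN ballI open_Times) auto
  have near: "(t, z) \<in> (\<Union>p\<in>K n. ball p (\<delta> n))" if "(t, z) \<in> B m" "t < real n" "n \<le> m" for t z n m
  proof -
    from that(1) obtain \<sigma> where \<sigma>: "\<sigma> \<in> \<Sigma>" "dist \<sigma> z < d m" "- d m < t"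
      by (auto simp: B_def)
    have "dist (max 0 t, \<sigma>) (t, z) \<le> dist (max 0 t) t + dist \<sigma> z"
      unfolding dist_Pair_Pair by (rule sqrt_sum_squares_le_sum) auto
    also have "\<dots> < 2 * d m" using \<sigma> d(1)[of m] by (auto simp: dist_real_def)
    also have "\<dots> \<le> \<delta> n" using dmono[OF that(3)] d(2)[of n] by linarith
    finally have "(t, z) \<in> ball (max 0 t, \<sigma>) (\<delta> n)" by simp
    moreover have "(max 0 t, \<sigma>) \<in> K n" using that(2) \<sigma>(1) by (auto simp: K_def)
    ultimately show ?thesis by blast
  qed
  have injW': "inj_on F W'"
  proof (rule inj_onI)
    fix p q assume "p \<in> W'" "q \<in> W'" "F p = F q"
    then obtain t z z' n m where pq: "p = (t, z)" "q = (t, z')" "(t, z) \<in> B n" "(t, z') \<in> B m"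
      by (cases p, cases q) (auto simp: W'_def F_def)
    \<comment> \<open>Equal images have equal times, and that time is below both indices. As the
      widths decrease, both points then lie in the injectivity neighbourhood of the slab with the
      smaller index.\<close>
    define k where "k = min n m"
    have "t < real k" using pq by (auto simp: k_def B_def min_def)
    have "p \<in> (\<Union>p\<in>K k. ball p (\<delta> k))"
      unfolding pq(1) by (rule near[OF pq(3) \<open>t < real k\<close>]) (simp add: k_def)
    moreover have "q \<in> (\<Union>p\<in>K k. ball p (\<delta> k))"
      unfolding pq(2) by (rule near[OF pq(4) \<open>t < real k\<close>]) (simp add: k_def)
    ultimately show "p = q" using inj_onD[OF \<delta>(3) \<open>F p = F q\<close>] by blast
  qed
  have W'near: "\<exists>n. p \<in> (\<Union>p\<in>K n. ball p (\<delta> n))" if p: "p \<in> W'" for p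
  proof -
    obtain n where "p \<in> B n" using p by (auto simp: W'_def)
    then have "p \<in> (\<Union>p\<in>K n. ball p (\<delta> n))"
      using near[of "fst p" "snd p" n n] by (auto simp: B_def simp del: UN_iff)
    then show ?thesis ..
  qed
  have W'V: "W' \<subseteq> V" using W'near \<delta>(2) by blast
  have injDF: "inj (DF p)" if "p \<in> W'" for p using W'near[OF that] \<delta>(4) by blast
  obtain h Dh where oFW: "open (F ` W')" and h: "\<And>p. p \<in> W' \<Longrightarrow> h (F p) = p" "C1_deriv (F ` W') h Dh"
    and Dh: "\<And>p w. p \<in> W' \<Longrightarrow> DF p (Dh (F p) w) = w"
    using C1_deriv_inverse[OF \<open>open W'\<close> C1_deriv_subset[OF F W'V] injW' injDF] by blast
  define W where "W = W' \<inter> ({0..} \<times> UNIV)"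
  define \<Theta> where "\<Theta> = (\<lambda>p. (fst p, G p)) ` W"
  have WU: "W \<subseteq> {0..} \<times> U" using W'V by (auto simp: W_def V_def)
  have FG: "F p = (fst p, G p)" if "p \<in> W" for p
    using that WU by (cases p) (auto simp: F_def HG)
  \<comment> \<open>\<open>F\<close> preserves time, so restricting to nonnegative times commutes
    with taking the image; relative openness of \<open>\<Theta>\<close> follows.\<close>
  have \<Theta>F: "\<Theta> = F ` W' \<inter> ({0..} \<times> UNIV)"
  proof -
    have "\<Theta> = F ` W" unfolding \<Theta>_def by (rule image_cong[OF refl]) (simp add: FG)
    also have "\<dots> = F ` W' \<inter> ({0..} \<times> UNIV)" by (auto simp: W_def F_def)
    finally show ?thesis .
  qed
  have KW: "{0..} \<times> \<Sigma> \<subseteq> W'"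
  proof
    fix p assume "p \<in> {0::real..} \<times> \<Sigma>"
    then obtain t \<sigma> where p: "p = (t, \<sigma>)" and t: "0 \<le> t" and "\<sigma> \<in> \<Sigma>" by blast
    obtain n :: nat where "t < real n" using reals_Archimedean2 by blast
    with t \<open>\<sigma> \<in> \<Sigma>\<close> d(1)[of n] have "(t, \<sigma>) \<in> B n" by (force simp: B_def)
    then show "p \<in> W'" by (auto simp: W'_def p)
  qed
  have "\<exists>e>0. (\<Union>q\<in>F ` K n. ball q e) \<subseteq> F ` W'" for n
  proof -
    have "continuous_on (K n) F" by (rule continuous_on_subset[OF C1_derivD(4)[OF F] KV])
    then have "compact (F ` K n)" by (intro compact_continuous_image cK)
    moreover have "F ` K n \<subseteq> F ` W'" using KW by (intro image_mono) (auto simp: K_def)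
    ultimately show ?thesis using compact_subset_open_imp_ball_epsilon_subset[OF _ oFW] by metis
  qed
  then obtain e where e: "\<And>n. 0 < e n" "\<And>n. (\<Union>q\<in>F ` K n. ball q (e n)) \<subseteq> F ` W'" by metis
  \<comment> \<open>Rounding time up selects a slab that contains it; the running minimum makes the
    radius nonincreasing.\<close>
  define \<epsilon> where "\<epsilon> = (\<lambda>t::real. Min (e ` {..nat \<lceil>t\<rceil>}))"
  show thesis
  proof (rule that[of W \<Theta> "\<lambda>q. snd (h q)" "\<lambda>q w. snd (Dh q w)" \<epsilon>])
    show "W \<subseteq> {0..} \<times> U" by (rule WU)
    show "{0..} \<times> \<Sigma> \<subseteq> W" using KW by (auto simp: W_def)
    show "(s, z) \<in> W" if tz: "(t, z) \<in> W" "0 \<le> s" "s \<le> t" for s t z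
    proof -
      \<comment> \<open>Each slab is a time interval times a set of labels, so lowering the time
        stays in the same slab.\<close>
      obtain n where n: "(t, z) \<in> B n" using tz(1) by (auto simp: W_def W'_def)
      have "- d n < s" using tz(2) d(1)[of n] by linarith
      then have "(s, z) \<in> B n" using n tz by (auto simp: B_def)
      then show ?thesis using tz by (auto simp: W_def W'_def)
    qed
    show "\<Theta> = (\<lambda>p. (fst p, G p)) ` W" by (rule \<Theta>_def)
    show "openin (top_of_set ({0..} \<times> UNIV)) \<Theta>"
      unfolding \<Theta>F openin_open using oFW by blast
    show "\<Theta> \<subseteq> {0..} \<times> \<Omega>"
    proof -
      have "G p \<in> \<Omega> \<and> 0 \<le> fst p" if "p \<in> W" for p
      proof -
        have "H p \<in> \<Omega>" using W'V that by (auto simp: W_def V_def)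
        moreover have "H p = G p" using HG[of "fst p" "snd p"] WU that by (auto simp: subset_eq)
        ultimately show ?thesis using WU that by auto
      qed
      then show ?thesis by (auto simp: \<Theta>_def)
    qed
    have hT: "C1_deriv \<Theta> h Dh" by (rule C1_deriv_subset[OF h(2)]) (auto simp: \<Theta>F)
    show "C1_deriv \<Theta> (\<lambda>q. snd (h q)) (\<lambda>q w. snd (Dh q w))"
      by (rule C1_derivI) (intro has_derivative_snd C1_derivD(1)[OF hT] continuous_on_snd C1_derivD(2)[OF hT], assumption?)+
    show "snd (h (t, G (t, z))) = z" if "(t, z) \<in> W" for t z
      using h(1)[of "(t, z)"] FG[OF that] that by (simp add: W_def)
    show "DG (t, z) (dt, snd (Dh (t, G (t, z)) (dt, dx))) = dx" if tz: "(t, z) \<in> W" for t z dt dx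
    proof -
      have "DF (t, z) (Dh (t, G (t, z)) (dt, dx)) = (dt, dx)"
        using Dh[of "(t, z)" "(dt, dx)"] FG[OF tz] tz by (simp add: W_def)
      then have "fst (Dh (t, G (t, z)) (dt, dx)) = dt" "DG (t, z) (Dh (t, G (t, z)) (dt, dx)) = dx"
        using DHG[of t z] tz WU by (auto simp: DF_def)
      then show ?thesis by (metis prod.collapse)
    qed
    show "0 < \<epsilon> t" for t using e(1) by (auto simp: \<epsilon>_def)
    show "antimono_on {0..} \<epsilon>"
    proof (rule monotone_onI)
      fix s t :: real assume "s \<le> t"
      then have "nat \<lceil>s\<rceil> \<le> nat \<lceil>t\<rceil>" by (intro nat_mono ceiling_mono)
      then show "\<epsilon> t \<le> \<epsilon> s" unfolding \<epsilon>_def by (intro Min_antimono image_mono) auto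
    qed
    show "(t, y) \<in> \<Theta>" if t: "0 \<le> t" and \<sigma>: "\<sigma> \<in> \<Sigma>" and y: "y \<in> ball (G (t, \<sigma>)) (\<epsilon> t)" for t \<sigma> y
    proof -
      define n where "n = nat \<lceil>t\<rceil>"
      have "\<epsilon> t \<le> e n" by (simp add: \<epsilon>_def n_def)
      have "(t, \<sigma>) \<in> K n" using t \<sigma> by (auto simp: K_def n_def real_nat_ceiling_ge)
      have "F (t, \<sigma>) = (t, G (t, \<sigma>))" using t \<sigma> \<Sigma>(2) by (auto simp: F_def HG)
      then have "(t, y) \<in> ball (F (t, \<sigma>)) (e n)"
        using y \<open>\<epsilon> t \<le> e n\<close> by (simp add: dist_Pair_Pair)
      then show ?thesis using e(2)[of n] \<open>(t, \<sigma>) \<in> K n\<close> t unfolding \<Theta>F by blast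
    qed
  qed
qed

text \<open>The preimages under \<open>X s\<close> move continuously because the inverses of
  \<open>X s\<close> are Lipschitz uniformly on \<open>{0..T}\<close>: compare
  \<open>\<gamma> r\<close> with the image at time \<open>r\<close> of the fixed label
  \<open>\<xi> s\<close>.\<close>

lemma pulled_back_path:
  fixes X :: "real \<Rightarrow> 'a::real_normed_vector \<Rightarrow> 'a"
  assumes X_cont: "\<And>\<xi>. \<xi> \<in> \<Omega> \<Longrightarrow> continuous_on {0..} (\<lambda>t. X t \<xi>)"
    and X_surj: "\<And>t x. \<lbrakk>0 \<le> t; x \<in> \<Omega>\<rbrakk> \<Longrightarrow> \<exists>\<xi>\<in>\<Omega>. X t \<xi> = x"
    and X_inj: "\<And>t \<xi> \<xi>'. \<lbrakk>0 \<le> t; \<xi> \<in> \<Omega>; \<xi>' \<in> \<Omega>\<rbrakk> \<Longrightarrow> norm (\<xi> - \<xi>') \<le> exp (K * t) * norm (X t \<xi> - X t \<xi>')"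
    and \<gamma>: "continuous_on {0..T} \<gamma>" "\<And>s. s \<in> {0..T} \<Longrightarrow> \<gamma> s \<in> \<Omega>"
  obtains \<xi> where "continuous_on {0..T} \<xi>" "\<And>s. s \<in> {0..T} \<Longrightarrow> \<xi> s \<in> \<Omega> \<and> X s (\<xi> s) = \<gamma> s"
proof -
  have "\<forall>s\<in>{0..T}. \<exists>\<xi>. \<xi> \<in> \<Omega> \<and> X s \<xi> = \<gamma> s" using X_surj \<gamma>(2) by fastforce
  then obtain \<xi> where \<xi>: "\<And>s. s \<in> {0..T} \<Longrightarrow> \<xi> s \<in> \<Omega> \<and> X s (\<xi> s) = \<gamma> s" by metis
  have "continuous_on {0..T} \<xi>"
    unfolding continuous_on_def
  proof
    fix s assume s: "s \<in> {0..T}"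
    define b where "b = (\<lambda>r. exp (\<bar>K\<bar> * T) * (norm (X r (\<xi> s) - X s (\<xi> s)) + norm (\<gamma> s - \<gamma> r)))"
    have "((\<lambda>r. \<xi> r - \<xi> s) \<longlongrightarrow> 0) (at s within {0..T})"
    proof (rule Lim_null_comparison)
      have "norm (\<xi> r - \<xi> s) \<le> b r" if r: "r \<in> {0..T}" for r
      proof -
        have "norm (\<xi> r - \<xi> s) \<le> exp (K * r) * norm (X r (\<xi> s) - X r (\<xi> r))"
          using X_inj[of r "\<xi> s" "\<xi> r"] \<xi> r s by (simp add: norm_minus_commute)
        also have "norm (X r (\<xi> s) - X r (\<xi> r)) = norm ((X r (\<xi> s) - X s (\<xi> s)) + (\<gamma> s - \<gamma> r))"
          using \<xi> r s by simp
        also have "exp (K * r) * \<dots> \<le> b r"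
        proof -
          have "K * r \<le> \<bar>K\<bar> * T" using r by (intro mult_mono) auto
          then show ?thesis unfolding b_def by (intro mult_mono norm_triangle_ineq) auto
        qed
        finally show ?thesis .
      qed
      then show "\<forall>\<^sub>F r in at s within {0..T}. norm (\<xi> r - \<xi> s) \<le> b r"
        by (simp add: eventually_at_filter)
      have "continuous_on {0..T} b" unfolding b_def
        by (intro continuous_intros \<gamma> continuous_on_subset[OF X_cont]) (use \<xi> s in auto)
      then have "(b \<longlongrightarrow> b s) (at s within {0..T})" using s by (simp add: continuous_on_def)
      then show "(b \<longlongrightarrow> 0) (at s within {0..T})" by (simp add: b_def)
    qed
    then show "(\<xi> \<longlongrightarrow> \<xi> s) (at s within {0..T})" by (rule LIM_zero_cancel)
  qed
  with \<xi> show thesis using that by blast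
qed

theorem theorem2p4:
  fixes \<Omega> \<Omega>p \<Omega>m \<Sigma>0 :: "(real ^ 3) set"
    and v :: "real \<Rightarrow> real ^ 3 \<Rightarrow> real ^ 3"
    and \<phi>0 :: "real ^ 3 \<Rightarrow> real"
  assumes "bounded \<Omega>" and "connected \<Omega>" and "open \<Omega>"
    and "velocity_regular \<Omega> v"
    and "velocity_tangential \<Omega> v"
    and "\<Omega>p \<subseteq> \<Omega>" and "open \<Omega>p" and "connected \<Omega>p" and "\<Omega>p \<noteq> {}"
    and "\<Sigma>0 = frontier \<Omega>p"
    and "closed_C2_surface \<Sigma>0"
    and "\<Sigma>0 \<inter> frontier \<Omega> = {}"
    and "\<Omega>m = \<Omega> - (\<Omega>p \<union> \<Sigma>0)"
    and "\<forall>x\<in>\<Omega>p. \<phi>0 x > 0"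
    and "\<forall>x\<in>\<Omega>m. \<phi>0 x < 0"
    and "{x \<in> \<Omega>. \<phi>0 x = 0} = \<Sigma>0"
    and "\<forall>x\<in>\<Sigma>0. grad \<phi>0 x \<noteq> 0"
    and "\<exists>U. open U \<and> \<Sigma>0 \<subseteq> U \<and> U \<subseteq> \<Omega> \<and> C2_on U \<phi>0 \<and> (\<forall>x\<in>U. norm (grad \<phi>0 x) = 1)"
  shows "\<exists>(\<Theta> :: (real \<times> (real ^ 3)) set) (\<phi> :: real \<Rightarrow> real ^ 3 \<Rightarrow> real).
    tubular_neighborhood \<Omega> (transported \<Omega> v \<Sigma>0) \<Theta> \<and>
    C2_on_subset ({0..} \<times> \<Omega>) \<Theta> (\<lambda>(t, x). \<phi> t x) \<and>
    (\<forall>(t, x)\<in>\<Theta>. t > 0 \<longrightarrow>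
       x - \<phi> t x *\<^sub>R grad (\<phi> t) x \<in> closure \<Omega> \<and>
       deriv (\<lambda>s. \<phi> s x) t + v t (x - \<phi> t x *\<^sub>R grad (\<phi> t) x) \<bullet> grad (\<phi> t) x = 0) \<and>
    (\<forall>x. (0, x) \<in> \<Theta> \<longrightarrow> \<phi> 0 x = \<phi>0 x) \<and>
    (\<forall>(t, x)\<in>\<Theta>. norm (grad (\<phi> t) x) = 1) \<and>
    (\<forall>t\<ge>0. (\<forall>x\<in>transported \<Omega> v \<Omega>p t. (t, x) \<in> \<Theta> \<longrightarrow> \<phi> t x > 0) \<and>
            (\<forall>x\<in>transported \<Omega> v \<Omega>m t. (t, x) \<in> \<Theta> \<longrightarrow> \<phi> t x < 0))"
proof -

  \<comment> \<open>Initial data and the flow\<close>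
  obtain U where U: "open U" "\<Sigma>0 \<subseteq> U" "U \<subseteq> \<Omega>" "C2_on U \<phi>0"
    and n1: "\<And>x. x \<in> U \<Longrightarrow> norm (grad \<phi>0 x) = 1"
    using assms(18) by blast
  define n where "n = grad \<phi>0"
  obtain H where d\<phi>: "\<And>x. x \<in> U \<Longrightarrow> (\<phi>0 has_derivative (\<lambda>h. h \<bullet> n x)) (at x)" and nC: "C1_deriv U n H"
    unfolding n_def by (rule C2_on_grad[OF U(1,4)]) blast
  have "\<Omega> \<noteq> {}" using assms by blast
  obtain X K where X0: "\<And>\<xi>. X 0 \<xi> = \<xi>" and X\<Omega>: "\<And>t \<xi>. \<lbrakk>0 \<le> t; \<xi> \<in> \<Omega>\<rbrakk> \<Longrightarrow> X t \<xi> \<in> \<Omega>"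
    and dX: "\<And>t \<xi>. \<lbrakk>0 \<le> t; \<xi> \<in> \<Omega>\<rbrakk> \<Longrightarrow> ((\<lambda>t. X t \<xi>) has_vector_derivative v t (X t \<xi>)) (at t within {0..})"
    and X_surj: "\<And>t x. \<lbrakk>0 \<le> t; x \<in> \<Omega>\<rbrakk> \<Longrightarrow> \<exists>\<xi>\<in>\<Omega>. X t \<xi> = x"
    and X_inj: "\<And>t \<xi> \<xi>'. \<lbrakk>0 \<le> t; \<xi> \<in> \<Omega>; \<xi>' \<in> \<Omega>\<rbrakk> \<Longrightarrow> norm (\<xi> - \<xi>') \<le> exp (K * t) * norm (X t \<xi> - X t \<xi>')"
    and fl: "\<And>t \<xi>. \<lbrakk>0 \<le> t; \<xi> \<in> \<Omega>\<rbrakk> \<Longrightarrow> flow \<Omega> v t 0 \<xi> = X t \<xi>"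
    by (rule domain_flow[OF assms(1,3) \<open>\<Omega> \<noteq> {}\<close> assms(4,5)]) blast
  have Xeq: "\<xi> = \<xi>'" if "0 \<le> t" "\<xi> \<in> \<Omega>" "\<xi>' \<in> \<Omega>" "X t \<xi> = X t \<xi>'" for t \<xi> \<xi>'
    using X_inj[OF that(1-3)] that(4) by simp
  have tr: "transported \<Omega> v S t = X t ` S" if "S \<subseteq> \<Omega>" "0 \<le> t" for S t
    unfolding transported_def by (rule image_cong[OF refl]) (use fl that in auto)
  have \<Sigma>: "compact \<Sigma>0" using assms(11) by (simp add: closed_C2_surface_def)
  have \<phi>\<Sigma>: "\<phi>0 \<sigma> = 0" "\<sigma> \<in> U" "\<sigma> \<in> \<Omega>" if "\<sigma> \<in> \<Sigma>0" for \<sigma> using that assms(16) U by auto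

  \<comment> \<open>Foot points of the initial normals\<close>
  define y0 where "y0 = (\<lambda>z. z - \<phi>0 z *\<^sub>R n z)"
  define Dy0 where "Dy0 = (\<lambda>z w. w - (\<phi>0 z *\<^sub>R H z w + (w \<bullet> n z) *\<^sub>R n z))"
  have \<phi>C: "continuous_on U \<phi>0"
    by (intro continuous_at_imp_continuous_on ballI has_derivative_continuous[OF d\<phi>])
  have y0C: "C1_deriv U y0 Dy0"
  proof (rule C1_derivI)
    show "(y0 has_derivative Dy0 z) (at z within U)" if "z \<in> U" for z
      unfolding y0_def Dy0_def
      by (intro has_derivative_diff has_derivative_ident has_derivative_scaleR C1_derivD(1)[OF nC that]
          has_derivative_at_withinI[OF d\<phi>[OF that]])
    show "continuous_on U (\<lambda>z. Dy0 z w)" for w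
      unfolding Dy0_def by (intro continuous_intros \<phi>C C1_derivD(2,4)[OF nC])
  qed
  \<comment> \<open>The labels are restricted to those whose foot point lies in
    \<open>\<Omega>\<close>, where the flow is available; on \<open>\<Sigma>0\<close> each point is
    its own foot.\<close>
  define U0 where "U0 = U \<inter> y0 -` \<Omega>"
  have "open U0" unfolding U0_def
    by (rule continuous_open_preimage[OF C1_derivD(4)[OF y0C] U(1) assms(3)])
  have U0: "U0 \<subseteq> U" and y0\<Omega>: "\<And>z. z \<in> U0 \<Longrightarrow> y0 z \<in> \<Omega>" by (auto simp: U0_def)
  have "\<Sigma>0 \<subseteq> U0" using \<phi>\<Sigma> by (auto simp: U0_def y0_def)
  have nn: "n z \<bullet> n z = 1" if "z \<in> U" for z using n1[OF that] by (simp add: n_def norm_eq_sqrt_inner)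
  have nH: "n z \<bullet> H z w = 0" if z: "z \<in> U" for z w
  proof -
    have "(n has_derivative H z) (at z)" using C1_derivD(1)[OF nC z] at_within_open[OF z U(1)] by simp
    from has_derivative_inner[OF this this]
    have "((\<lambda>z. n z \<bullet> n z) has_derivative (\<lambda>w. n z \<bullet> H z w + H z w \<bullet> n z)) (at z)" .
    then have "((\<lambda>z. 1 :: real) has_derivative (\<lambda>w. n z \<bullet> H z w + H z w \<bullet> n z)) (at z)"
      by (rule has_derivative_transform_within_open[OF _ U(1) z]) (rule nn)
    from has_derivative_unique[OF this has_derivative_const]
    have "n z \<bullet> H z w + H z w \<bullet> n z = 0" by meson
    then show ?thesis by (simp add: inner_commute)
  qed
  \<comment> \<open>The components of \<open>w\<close> along \<open>n z\<close> cancel, and the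
    curvature term drops out because \<open>n\<close> has constant length.\<close>
  have ortho: "n z \<bullet> Dy0 z w = 0" if "z \<in> U0" for z w
    using nH[of z w] nn[of z] that U0 by (auto simp: Dy0_def inner_diff_right inner_add_right inner_commute)
  have nz: "n z \<noteq> 0" if "z \<in> U0" for z using n1[of z] that U0 by (auto simp: n_def)

  \<comment> \<open>Transported normals and the map \<open>G\<close>\<close>
  define S where "S = {0::real..} \<times> U0"
  obtain P DP DX where PC: "C1_deriv S P DP" and Pnz: "\<And>t z. \<lbrakk>0 \<le> t; z \<in> U0\<rbrakk> \<Longrightarrow> P (t, z) \<noteq> 0"
    and P0: "\<And>z. z \<in> U0 \<Longrightarrow> P (0, z) = n z"
    and XC: "C1_deriv S (\<lambda>(t, z). X t (y0 z)) DX"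
    and PDX: "\<And>t z dt dz. \<lbrakk>0 \<le> t; z \<in> U0\<rbrakk> \<Longrightarrow>
      P (t, z) \<bullet> DX (t, z) (dt, dz) = dt * (P (t, z) \<bullet> v t (X t (y0 z)))"
    and kerX: "\<And>t z w. \<lbrakk>0 \<le> t; z \<in> U0; DX (t, z) (0, w) = 0\<rbrakk> \<Longrightarrow> Dy0 z w = 0"
    unfolding S_def
    by (rule conormal_transport[OF assms(4,3) \<open>open U0\<close> X0 X\<Omega> dX C1_deriv_subset[OF nC U0]
          C1_deriv_subset[OF y0C U0] nz y0\<Omega> ortho]) blast+
  define N where "N = (\<lambda>s. P s /\<^sub>R norm (P s))"
  have Pnz': "P s \<noteq> 0" if "s \<in> S" for s using that Pnz by (auto simp: S_def)
  obtain DN where NC: "C1_deriv S N DN" and NDN: "\<And>s w. s \<in> S \<Longrightarrow> N s \<bullet> DN s w = 0"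
    unfolding N_def by (rule C1_deriv_normalize[OF PC Pnz']) blast+
  have N1: "norm (N s) = 1" if "s \<in> S" for s using Pnz'[OF that] by (simp add: N_def)
  have N0: "N (0, z) = n z" if "z \<in> U0" for z
    using that n1[of z] U0 by (auto simp: N_def P0 n_def)
  define Xy where "Xy = (\<lambda>s. X (fst s) (y0 (snd s)))"
  have XyC: "C1_deriv S Xy DX" using XC by (simp add: Xy_def case_prod_unfold)
  have NDX: "N s \<bullet> DX s w = fst w * (N s \<bullet> v (fst s) (Xy s))" if "s \<in> S" for s w
    using PDX[of "fst s" "snd s" "fst w" "snd w"] that
    by (auto simp: S_def N_def Xy_def)
  \<comment> \<open>Move the foot by the flow, then go out along the transported unit normal by the
    original signed distance.\<close>
  define G where "G = (\<lambda>s. Xy s + \<phi>0 (snd s) *\<^sub>R N s)"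
  define DG where "DG = (\<lambda>s w. DX s w + (\<phi>0 (snd s) *\<^sub>R DN s w + (snd w \<bullet> n (snd s)) *\<^sub>R N s))"
  have GC: "C1_deriv S G DG"
  proof (rule C1_derivI)
    fix s assume s: "s \<in> S"
    then have "snd s \<in> U" using U0 by (auto simp: S_def)
    show "(G has_derivative DG s) (at s within S)"
      unfolding G_def DG_def
      by (intro has_derivative_add has_derivative_scaleR C1_derivD(1)[OF XyC s] C1_derivD(1)[OF NC s]
          has_derivative_compose[OF has_derivative_snd[OF has_derivative_ident] d\<phi>[OF \<open>snd s \<in> U\<close>]])
  next
    have c: "continuous_on S (\<lambda>s. h (snd s))" if "continuous_on U h" for h :: "real ^ 3 \<Rightarrow> 'c::topological_space"
      by (rule continuous_on_compose2[OF that]) (use U0 in \<open>auto simp: S_def intro: continuous_intros\<close>)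
    show "continuous_on S (\<lambda>s. DG s w)" for w
      unfolding DG_def
      by (intro continuous_intros C1_derivD(2)[OF XyC] C1_derivD(2,4)[OF NC] c[OF \<phi>C] c[OF C1_derivD(4)[OF nC]])
  qed
  have NDG: "N s \<bullet> DG s w = fst w * (N s \<bullet> v (fst s) (Xy s)) + snd w \<bullet> n (snd s)" if "s \<in> S" for s w
    using N1[OF that] by (simp add: DG_def inner_add_right NDX[OF that] NDN[OF that] norm_eq_1)
  have G\<Sigma>: "G (t, \<sigma>) = X t \<sigma>" if "\<sigma> \<in> \<Sigma>0" for t \<sigma>
    using \<phi>\<Sigma>(1)[OF that] by (simp add: G_def Xy_def y0_def)
  have G0: "G (0, z) = z" if "z \<in> U0" for z
    using N0[OF that] by (simp add: G_def Xy_def y0_def X0)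
  have tube1: "G (t, \<sigma>) \<in> \<Omega>" if "0 \<le> t" "\<sigma> \<in> \<Sigma>0" for t \<sigma>
    using X\<Omega> that \<phi>\<Sigma> by (simp add: G\<Sigma>)
  have tube2: "\<sigma> = \<sigma>'" if "0 \<le> t" "\<sigma> \<in> \<Sigma>0" "\<sigma>' \<in> \<Sigma>0" "G (t, \<sigma>) = G (t, \<sigma>')" for t \<sigma> \<sigma>'
    using Xeq[OF that(1) \<phi>\<Sigma>(3)[OF that(2)] \<phi>\<Sigma>(3)[OF that(3)]] that(4)
    by (simp add: G\<Sigma> that(2,3))
  have tube3: "w = 0" if t: "0 \<le> t" and \<sigma>: "\<sigma> \<in> \<Sigma>0" and "DG (t, \<sigma>) (0, w) = 0" for t \<sigma> w
  proof -
    have \<sigma>0: "\<sigma> \<in> U0" using \<sigma> \<open>\<Sigma>0 \<subseteq> U0\<close> by blast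
    then have wn: "w \<bullet> n \<sigma> = 0"
      using NDG[of "(t, \<sigma>)" "(0, w)"] t that(3) by (simp add: S_def)
    \<comment> \<open>On \<open>\<Sigma>0\<close> the factor \<open>\<phi>0\<close> removes the
      derivative of \<open>N\<close>. Pairing with \<open>N\<close> has already shown that
      \<open>w\<close> is tangential, so the last summand vanishes as well.\<close>
    then have "DX (t, \<sigma>) (0, w) = 0" using that(3) \<phi>\<Sigma>(1)[OF \<sigma>] by (simp add: DG_def)
    then have "Dy0 \<sigma> w = 0" by (rule kerX[OF t \<sigma>0])
    then show "w = 0" using wn \<phi>\<Sigma>(1)[OF \<sigma>] by (simp add: Dy0_def)
  qed

  \<comment> \<open>The tube, the label map and the level function\<close>
  obtain W \<Theta> g Dg \<epsilon> where WS: "W \<subseteq> S" and \<Sigma>W: "{0..} \<times> \<Sigma>0 \<subseteq> W"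
    and down: "\<And>s t z. \<lbrakk>(t, z) \<in> W; 0 \<le> s; s \<le> t\<rbrakk> \<Longrightarrow> (s, z) \<in> W"
    and \<Theta>: "\<Theta> = (\<lambda>p. (fst p, G p)) ` W"
    and \<Theta>_open: "openin (top_of_set ({0..} \<times> UNIV)) \<Theta>" and \<Theta>\<Omega>: "\<Theta> \<subseteq> {0..} \<times> \<Omega>"
    and gC: "C1_deriv \<Theta> g Dg" and gG: "\<And>t z. (t, z) \<in> W \<Longrightarrow> g (t, G (t, z)) = z"
    and DGDg: "\<And>t z dt dx. (t, z) \<in> W \<Longrightarrow> DG (t, z) (dt, Dg (t, G (t, z)) (dt, dx)) = dx"
    and \<epsilon>: "\<And>t. 0 \<le> t \<Longrightarrow> 0 < \<epsilon> t" "antimono_on {0..} \<epsilon>"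
      "\<And>t \<sigma> y. \<lbrakk>0 \<le> t; \<sigma> \<in> \<Sigma>0; y \<in> ball (G (t, \<sigma>)) (\<epsilon> t)\<rbrakk> \<Longrightarrow> (t, y) \<in> \<Theta>"
  proof (rule spacetime_tube[OF \<open>open U0\<close> assms(3) \<Sigma> \<open>\<Sigma>0 \<subseteq> U0\<close> GC[unfolded S_def], folded S_def], goal_cases)
    case 1 show ?case by (rule tube1[OF 1(2,3)])
  next
    case 2 show ?case by (rule tube2[OF 2(2-5)])
  next
    case 3 show ?case by (rule tube3[OF 3(2-4)])
  next
    case (4 W \<Theta> g Dg \<epsilon>)
    show thesis by (rule that[of W \<Theta> g Dg \<epsilon>]) (fact 4)+
  qed
  define \<phi> where "\<phi> = (\<lambda>t x. \<phi>0 (g (t, x)))"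
  define R where "R = (\<lambda>p. (fst p, g p))"
  have RW: "R p \<in> W" "G (R p) = snd p" if "p \<in> \<Theta>" for p
  proof -
    from that obtain t z where "(t, z) \<in> W" "p = (t, G (t, z))" by (auto simp: \<Theta>)
    then show "R p \<in> W" "G (R p) = snd p" by (simp_all add: R_def gG)
  qed
  have RS: "R p \<in> S" if "p \<in> \<Theta>" for p using RW(1)[OF that] WS by blast
  \<comment> \<open>Normal speed of the foot point; it is to become
    \<open>- \<partial>\<phi>/\<partial>t\<close>.\<close>
  define c where "c = (\<lambda>s. N s \<bullet> v (fst s) (Xy s))"
  obtain Dc where cC: "C1_deriv S c Dc"
  proof -
    \<comment> \<open>Joint C1 regularity of \<open>v\<close> in \<open>(t, x)\<close> is used here:
      it makes the time derivative of \<open>\<phi>\<close> a C1 function.\<close>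
    obtain Dv where Dv: "C1_deriv ({0..} \<times> \<Omega>) (\<lambda>(t, x). v t x) Dv"
      using assms(4) by (auto simp: velocity_regular_def C1_on_iff_C1_deriv)
    have gr: "C1_deriv S (\<lambda>s. (fst s, Xy s)) (\<lambda>s w. (fst w, DX s w))"
      by (rule C1_derivI) (intro has_derivative_Pair has_derivative_fst has_derivative_ident C1_derivD(1)[OF XyC]
          continuous_on_Pair continuous_on_const C1_derivD(2)[OF XyC], (assumption+)?)+
    have "(\<lambda>s. (fst s, Xy s)) ` S \<subseteq> {0..} \<times> \<Omega>"
      using X\<Omega> y0\<Omega> by (auto simp: S_def Xy_def)
    from C1_deriv_compose[OF gr Dv this]
    have vC: "C1_deriv S (\<lambda>s. v (fst s) (Xy s)) (\<lambda>s w. Dv (fst s, Xy s) (fst w, DX s w))"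
      by simp
    have "C1_deriv S c (\<lambda>s w. N s \<bullet> Dv (fst s, Xy s) (fst w, DX s w) + DN s w \<bullet> v (fst s) (Xy s))"
    proof (rule C1_derivI)
      show "(c has_derivative (\<lambda>w. N s \<bullet> Dv (fst s, Xy s) (fst w, DX s w) + DN s w \<bullet> v (fst s) (Xy s))) (at s within S)"
        if "s \<in> S" for s
        unfolding c_def by (rule has_derivative_inner[OF C1_derivD(1)[OF NC that] C1_derivD(1)[OF vC that]])
      show "continuous_on S (\<lambda>s. N s \<bullet> Dv (fst s, Xy s) (fst w, DX s w) + DN s w \<bullet> v (fst s) (Xy s))" for w
        by (intro continuous_on_add continuous_on_inner C1_derivD(2,4)[OF NC] C1_derivD(2,4)[OF vC])
    qed
    then show thesis by (rule that)
  qed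

  \<comment> \<open>Gradient and regularity in space-time\<close>
  have RC: "C1_deriv \<Theta> R (\<lambda>p w. (fst w, Dg p w))"
    unfolding R_def
    by (rule C1_derivI) (intro has_derivative_Pair has_derivative_fst has_derivative_ident C1_derivD(1)[OF gC]
        continuous_on_Pair continuous_on_const C1_derivD(2)[OF gC], (assumption+)?)+
  \<comment> \<open>The candidate for the full space-time gradient, written down directly as a
    composition of C1 maps; this supplies the second derivatives of \<open>\<phi>\<close>.\<close>
  define V where "V = (\<lambda>p. (- c (R p), N (R p)))"
  have "C1_deriv S (\<lambda>s. (- c s, N s)) (\<lambda>s w. (- Dc s w, DN s w))"
    by (rule C1_derivI) (intro has_derivative_Pair has_derivative_minus C1_derivD(1)[OF cC] C1_derivD(1)[OF NC]
        continuous_on_Pair continuous_on_minus C1_derivD(2)[OF cC] C1_derivD(2)[OF NC], (assumption+)?)+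
  then have VC: "C1_deriv \<Theta> V (\<lambda>p w. (- Dc (R p) (fst w, Dg p w), DN (R p) (fst w, Dg p w)))"
    unfolding V_def by (rule C1_deriv_compose[OF RC]) (use RS in auto)
  have d\<Phi>: "((\<lambda>(t, x). \<phi> t x) has_derivative (\<lambda>w. w \<bullet> V p)) (at p within \<Theta>)" if p: "p \<in> \<Theta>" for p
  proof -
    obtain t z where tz: "(t, z) \<in> W" "p = (t, G (t, z))" using p by (auto simp: \<Theta>)
    have Rp: "R p = (t, z)" using tz by (simp add: R_def gG)
    have "g p \<in> U" using RS[OF p] U0 by (auto simp: R_def S_def)
    have "((\<lambda>p. \<phi>0 (g p)) has_derivative (\<lambda>w. Dg p w \<bullet> n (g p))) (at p within \<Theta>)"
      by (rule has_derivative_compose[OF C1_derivD(1)[OF gC p] d\<phi>[OF \<open>g p \<in> U\<close>]])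
    moreover have "Dg p w \<bullet> n (g p) = w \<bullet> V p" for w
    proof -
      \<comment> \<open>Pairing \<open>DG (dt, Dg) = dx\<close> with \<open>N\<close> isolates
        \<open>n z \<bullet> Dg\<close>, the derivative of \<open>\<phi>0\<close> along the label
        map.\<close>
      have "N (t, z) \<bullet> snd w = fst w * c (t, z) + Dg p w \<bullet> n z"
        using NDG[of "(t, z)" "(fst w, Dg p w)"] DGDg[OF tz(1), of "fst w" "snd w"] tz WS
        by (auto simp: c_def)
      then show ?thesis using gG[OF tz(1)] tz(2) Rp
        by (simp add: V_def inner_prod_def inner_commute)
    qed
    ultimately show ?thesis by (simp add: \<phi>_def case_prod_unfold)
  qed
  have C2: "C2_on \<Theta> (\<lambda>(t, x). \<phi> t x)" by (rule C2_onI_gradient[OF VC d\<Phi>])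
  \<comment> \<open>Relative openness provides open spatial slices for \<open>t \<ge> 0\<close>, and
    two-sided time neighbourhoods for \<open>t > 0\<close>; there derivatives within
    \<open>\<Theta>\<close> become ordinary partial derivatives.\<close>
  obtain O' where O': "open O'" "\<Theta> = ({0..} \<times> UNIV) \<inter> O'" using \<Theta>_open by (auto simp: openin_open)
  have slice_open: "open {x. (t, x) \<in> \<Theta>}" if "0 \<le> t" for t
  proof -
    have "open ((\<lambda>x. (t, x)) -` O')" using O'(1) by (intro open_vimage continuous_intros) auto
    moreover have "(\<lambda>x. (t, x)) -` O' = {x. (t, x) \<in> \<Theta>}" using O'(2) that by auto
    ultimately show ?thesis by simp
  qed
  have grad: "grad (\<phi> t) x = N (R (t, x))" if p: "(t, x) \<in> \<Theta>" for t x
  proof (rule grad_eqI)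
    have t: "0 \<le> t" using p \<Theta>\<Omega> by auto
    have "((\<lambda>x. (\<lambda>(t, x). \<phi> t x) (t, x)) has_derivative (\<lambda>h. (0, h) \<bullet> V (t, x))) (at x within {x. (t, x) \<in> \<Theta>})"
      by (rule has_derivative_in_compose2[where t = \<Theta> and g = "\<lambda>(t, x). \<phi> t x", OF d\<Phi>])
        (use p in \<open>auto intro!: has_derivative_Pair has_derivative_const has_derivative_ident\<close>)
    then show "(\<phi> t has_derivative (\<lambda>h. h \<bullet> N (R (t, x)))) (at x)"
      using at_within_open[OF _ slice_open[OF t], of x] p by (simp add: V_def inner_prod_def)
  qed
  have foot: "x - \<phi> t x *\<^sub>R grad (\<phi> t) x = Xy (R (t, x))" if p: "(t, x) \<in> \<Theta>" for t x
  proof -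
    have "Xy (R (t, x)) + \<phi> t x *\<^sub>R N (R (t, x)) = x"
      using RW(2)[OF p] by (simp add: G_def R_def \<phi>_def)
    then show ?thesis unfolding grad[OF p] by (simp add: algebra_simps)
  qed
  have Xy\<Omega>: "Xy s \<in> \<Omega>" if "s \<in> S" for s using that X\<Omega> y0\<Omega> by (auto simp: Xy_def S_def)
  have dt: "deriv (\<lambda>s. \<phi> s x) t = - c (R (t, x))" if p: "(t, x) \<in> \<Theta>" and t: "0 < t" for t x
  proof (rule DERIV_imp_deriv)
    define I where "I = {0<..} \<inter> (\<lambda>s. (s, x)) -` O'"
    have "open I" unfolding I_def using O'(1) by (intro open_Int open_vimage continuous_intros) auto
    have "t \<in> I" using p t O'(2) by (auto simp: I_def)
    have "((\<lambda>s. (\<lambda>(t, x). \<phi> t x) (s, x)) has_derivative (\<lambda>h. (h, 0) \<bullet> V (t, x))) (at t within I)"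
      by (rule has_derivative_in_compose2[where t = \<Theta> and g = "\<lambda>(t, x). \<phi> t x", OF d\<Phi>])
        (use p t \<open>t \<in> I\<close> O'(2) in \<open>auto intro!: has_derivative_Pair has_derivative_const has_derivative_ident simp: I_def\<close>)
    then have "((\<lambda>s. \<phi> s x) has_derivative (\<lambda>h. h * - c (R (t, x)))) (at t)"
      using at_within_open[OF \<open>t \<in> I\<close> \<open>open I\<close>] by (simp add: V_def inner_prod_def)
    then show "((\<lambda>s. \<phi> s x) has_real_derivative - c (R (t, x))) (at t)"
      by (rule has_derivative_imp_has_field_derivative) simp
  qed

  \<comment> \<open>Preservation of the two sides\<close>
  have \<Sigma>p: "\<Sigma>0 \<inter> \<Omega>p = {}" using assms(7,10) by (simp add: frontier_def interior_open inf_commute Int_Diff)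
  \<comment> \<open>The phase at time \<open>t\<close> is defined through the flow label
    \<open>a\<close>, the sign of \<open>\<phi>\<close> through the label \<open>z\<close> of
    \<open>G\<close>. The two labels differ in general but are joined by a path avoiding
    \<open>\<Sigma>0\<close>.\<close>
  have side: "z \<in> \<Omega> - \<Sigma>0 \<and> (z \<in> \<Omega>p \<longleftrightarrow> a \<in> \<Omega>p)"
    if tz: "(t, z) \<in> W" and a: "a \<in> \<Omega>" "a \<notin> \<Sigma>0" and eq: "G (t, z) = X t a" for t z a
  proof -
    have t: "0 \<le> t" and zU0: "z \<in> U0" using tz WS by (auto simp: S_def)
    have z\<Sigma>: "z \<notin> \<Sigma>0"
      using Xeq[OF t, of z a] a eq by (auto simp: G\<Sigma> \<phi>\<Sigma>)
    \<comment> \<open>Closure of \<open>W\<close> under decreasing time keeps the whole path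
      \<open>G (s, z)\<close> in the range of the chart.\<close>
    have sW: "(s, z) \<in> W" if "s \<in> {0..t}" for s using down[OF tz] that by auto
    have contG: "continuous_on {0..t} (\<lambda>s. G (s, z))"
      by (rule continuous_on_compose2[OF C1_derivD(4)[OF GC], of _ "\<lambda>s. (s, z)"])
        (use zU0 in \<open>auto simp: S_def intro: continuous_intros\<close>)
    have G\<Omega>: "G (s, z) \<in> \<Omega>" if "s \<in> {0..t}" for s
      using sW[OF that] \<Theta>\<Omega> by (auto simp: \<Theta>)
    have contX: "continuous_on {0..} (\<lambda>t. X t \<xi>)" if "\<xi> \<in> \<Omega>" for \<xi>
      using has_vector_derivative_continuous[OF dX[OF _ that]] by (simp add: continuous_on_eq_continuous_within)
    obtain \<xi> where \<xi>: "continuous_on {0..t} \<xi>" "\<And>s. s \<in> {0..t} \<Longrightarrow> \<xi> s \<in> \<Omega> \<and> X s (\<xi> s) = G (s, z)"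
    proof (rule pulled_back_path[of \<Omega> X K t "\<lambda>s. G (s, z)"], goal_cases)
      case 1 then show ?case by (intro contX)
    next
      case 2 then show ?case by (intro X_surj)
    next
      case 3 then show ?case by (intro X_inj)
    next
      case 4 show ?case by (rule contG)
    next
      case 5 then show ?case by (intro G\<Omega>)
    next
      case (6 \<xi>)
      show thesis by (rule that[of \<xi>]) (fact 6)+
    qed
    have \<xi>0: "\<xi> 0 = z" using \<xi>(2)[of 0] t G0[OF zU0] by (simp add: X0)
    have "\<xi> t \<in> \<Omega>" "X t (\<xi> t) = X t a" using \<xi>(2)[of t] t eq by simp_all
    then have \<xi>t: "\<xi> t = a" by (intro Xeq[OF t _ a(1)])
    have "connected (\<xi> ` {0..t})" by (intro connected_continuous_image \<xi>) simp
    moreover have "\<xi> ` {0..t} \<inter> frontier \<Omega>p = {}"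
    proof -
      \<comment> \<open>A hit on \<open>\<Sigma>0\<close> would be a second label of
        \<open>G (s, z)\<close>, since \<open>G\<close> and the flow coincide there; the chart would
        force \<open>z\<close> itself onto \<open>\<Sigma>0\<close>.\<close>
      have "\<xi> s \<notin> \<Sigma>0" if s: "s \<in> {0..t}" for s
      proof
        assume \<sigma>: "\<xi> s \<in> \<Sigma>0"
        then have "G (s, \<xi> s) = G (s, z)" using \<xi>(2)[OF s] by (simp add: G\<Sigma>)
        moreover have "(s, \<xi> s) \<in> W" using \<Sigma>W \<sigma> s by auto
        ultimately have "\<xi> s = z" using gG sW[OF s] by metis
        then show False using \<sigma> z\<Sigma> by simp
      qed
      then show ?thesis using assms(10) by auto
    qed
    ultimately have "\<xi> ` {0..t} \<inter> \<Omega>p = {} \<or> \<xi> ` {0..t} \<subseteq> \<Omega>p"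
      using connected_Int_frontier by blast
    moreover have "z \<in> \<xi> ` {0..t}" "a \<in> \<xi> ` {0..t}" using \<xi>0 \<xi>t t by (auto simp: image_iff intro: bexI[of _ 0] bexI[of _ t])
    ultimately show ?thesis using z\<Sigma> zU0 U0 U(3) by blast
  qed

  \<comment> \<open>The asserted properties\<close>
  have "tubular_neighborhood \<Omega> (transported \<Omega> v \<Sigma>0) \<Theta>"
    unfolding tubular_neighborhood_def
  proof (intro conjI exI[of _ \<epsilon>] allI impI)
    have tr\<Sigma>: "transported \<Omega> v \<Sigma>0 t = (\<lambda>\<sigma>. G (t, \<sigma>)) ` \<Sigma>0" if "0 \<le> t" for t
      using tr[of \<Sigma>0 t] that \<phi>\<Sigma>(3) G\<Sigma> by auto
    show "\<Theta> \<subseteq> {0..} \<times> \<Omega>" by (rule \<Theta>\<Omega>)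
    show "(\<Union>t\<in>{0..}. {t} \<times> transported \<Omega> v \<Sigma>0 t) \<subseteq> \<Theta>"
      using \<epsilon>(1,3) tr\<Sigma> by fastforce
    show "open {x \<in> \<Omega>. (t, x) \<in> \<Theta>}" if "0 \<le> t" for t
    proof -
      have "{x \<in> \<Omega>. (t, x) \<in> \<Theta>} = {x. (t, x) \<in> \<Theta>}" using \<Theta>\<Omega> by auto
      then show ?thesis using slice_open[OF that] by simp
    qed
    show "{t} \<times> (\<Union>x\<in>transported \<Omega> v \<Sigma>0 t. ball x (\<epsilon> t)) \<subseteq> \<Theta>" if "0 \<le> t" for t
      using \<epsilon>(3)[OF that] tr\<Sigma>[OF that] by auto
  qed (use \<epsilon> in auto)
  moreover have "C2_on_subset ({0..} \<times> \<Omega>) \<Theta> (\<lambda>(t, x). \<phi> t x)"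
    unfolding C2_on_subset_def
    by (intro exI[of _ \<Theta>] conjI C2 openin_subset_trans[OF \<Theta>_open \<Theta>\<Omega>]) auto
  moreover have "x - \<phi> t x *\<^sub>R grad (\<phi> t) x \<in> closure \<Omega> \<and>
      deriv (\<lambda>s. \<phi> s x) t + v t (x - \<phi> t x *\<^sub>R grad (\<phi> t) x) \<bullet> grad (\<phi> t) x = 0"
    if p: "(t, x) \<in> \<Theta>" and t: "0 < t" for t x
    \<comment> \<open>The argument of \<open>v\<close> is the transported foot point; it lies in
      \<open>\<Omega>\<close>, and the two terms of the equation are \<open>- c\<close> and
      \<open>c\<close>.\<close>
    unfolding foot[OF p] dt[OF p t]
    using Xy\<Omega>[OF RS[OF p]] closure_subset[of \<Omega>] by (auto simp: grad[OF p] c_def R_def inner_commute)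
  moreover have "\<phi> 0 x = \<phi>0 x" if p: "(0, x) \<in> \<Theta>" for x
    using RW[OF p] G0[of "g (0, x)"] RS[OF p] by (auto simp: R_def S_def \<phi>_def)
  moreover have "norm (grad (\<phi> t) x) = 1" if p: "(t, x) \<in> \<Theta>" for t x
    using N1[OF RS[OF p]] by (simp add: grad[OF p])
  moreover have "\<phi> t x > 0" if t: "0 \<le> t" and x: "x \<in> transported \<Omega> v \<Omega>p t" and p: "(t, x) \<in> \<Theta>" for t x
  proof -
    obtain a where a: "a \<in> \<Omega>p" "x = X t a" using x tr[OF assms(6) t] by auto
    have "g (t, x) \<in> \<Omega>p"
      using side[of t "g (t, x)" a] RW[OF p] a assms(6) \<Sigma>p by (auto simp: R_def)
    then show ?thesis using assms(14) by (simp add: \<phi>_def)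
  qed
  moreover have "\<phi> t x < 0" if t: "0 \<le> t" and x: "x \<in> transported \<Omega> v \<Omega>m t" and p: "(t, x) \<in> \<Theta>" for t x
  proof -
    obtain a where a: "a \<in> \<Omega>m" "x = X t a" using x tr[of \<Omega>m t] t assms(13) by auto
    \<comment> \<open>Here \<open>a\<close> is off both \<open>\<Omega>p\<close> and
      \<open>\<Sigma>0\<close>; so is the label by \<open>side\<close>, which leaves only
      \<open>\<Omega>m\<close>.\<close>
    have "g (t, x) \<in> \<Omega>m"
      using side[of t "g (t, x)" a] RW[OF p] a assms(13) by (auto simp: R_def)
    then show ?thesis using assms(15) by (simp add: \<phi>_def)
  qed
  ultimately show ?thesis by (intro exI[of _ \<Theta>] exI[of _ \<phi>]) blast
qed

end
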